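(* Let $A \in \mathbb{R}^{n \times d}$ have full column rank. Let $\Pi = S C \in \mathbb{R}^{s \times n}$, where $S \in \mathbb{R}^{s \times n}$ is a random matrix each of whose columns is chosen independently and uniformly at random from the $s$ standard basis vectors of $\mathbb{R}^s$, and $C \in \mathbb{R}^{n \times n}$ is a diagonal matrix whose diagonal entries are independent standard Cauchy random variables (independent of $S$). Set $s = \omega d^5 \log^5 d$ with $\omega$ a sufficiently large absolute constant. Then with a constant probability (bounded below by an absolute positive constant), $$\frac{1}{O(d^2 \log^2 d)} \|Ax\|_1 \le \|\Pi A x\|_1 \le O(d \log d)\, \|Ax\|_1 \quad \text{for all } x \in \mathbb{R}^d,$$ where the constants hidden in $O(\cdot)$ do not depend on $n$, $d$ or $A$. In addition, $\Pi A$ can be computed in $O(\mathrm{nnz}(A))$ time.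
   Context: $\mathrm{nnz}(A)$ denotes the number of nonzero entries of $A$; $\|\cdot\|_1$ is the $\ell_1$ norm. The standard Cauchy distribution has density $1/(\pi(1+x^2))$. *)

theory Defs
  imports
    "HOL-Probability.Probability"
    "Jordan_Normal_Form.Matrix"
    "Jordan_Normal_Form.DL_Rank"
begin

section \<open>Norm, sparsity and rank\<close>

definition l1_norm :: "real vec \<Rightarrow> real" where
  "l1_norm v = (\<Sum>i<dim_vec v. \<bar>vec_index v i\<bar>)"

definition nonzero_positions :: "real mat \<Rightarrow> (nat \<times> nat) set" where
  "nonzero_positions A = {(i, j). i < dim_row A \<and> j < dim_col A \<and> A $$ (i, j) \<noteq> 0}"

definition nnz :: "real mat \<Rightarrow> nat" where
  "nnz A = card (nonzero_positions A)"

definition full_column_rank :: "real mat \<Rightarrow> bool" where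
  "full_column_rank A \<longleftrightarrow> vec_space.rank (dim_row A) A = dim_col A"


section \<open>The sparse Cauchy transform\<close>

definition std_cauchy :: "real measure" where
  "std_cauchy = density lborel (\<lambda>x. ennreal (1 / (pi * (1 + x\<^sup>2))))"

text \<open>
  Column \<open>i\<close> of \<open>S\<close> is the standard basis vector with index \<open>h i\<close>; a uniform choice of the
  basis vector is a uniform choice of its index.
\<close>

definition S_mat :: "nat \<Rightarrow> nat \<Rightarrow> (nat \<Rightarrow> nat) \<Rightarrow> real mat" where
  "S_mat s n h = mat_of_cols s (map (\<lambda>i. unit_vec s (h i)) [0..<n])"

definition C_mat :: "nat \<Rightarrow> (nat \<Rightarrow> real) \<Rightarrow> real mat" where
  "C_mat n c = mat_diag n c"

definition sparse_cauchy :: "nat \<Rightarrow> nat \<Rightarrow> (nat \<Rightarrow> nat) \<Rightarrow> (nat \<Rightarrow> real) \<Rightarrow> real mat" where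
  "sparse_cauchy s n h c = S_mat s n h * C_mat n c"

definition sparse_cauchy_space :: "nat \<Rightarrow> nat \<Rightarrow> ((nat \<Rightarrow> nat) \<times> (nat \<Rightarrow> real)) measure" where
  "sparse_cauchy_space s n =
     (\<Pi>\<^sub>M i\<in>{..<n}. uniform_count_measure {..<s}) \<Otimes>\<^sub>M (\<Pi>\<^sub>M i\<in>{..<n}. std_cauchy)"

text \<open>Rounded up to an integer; it is positive for \<open>d \<ge> 2\<close> and \<open>\<omega> > 0\<close>.\<close>

definition sketch_size :: "real \<Rightarrow> nat \<Rightarrow> nat" where
  "sketch_size \<omega> d = nat \<lceil>\<omega> * real d ^ 5 * ln (real d) ^ 5\<rceil>"


section \<open>Running time\<close>

text \<open>
  A unit-cost real RAM with structured control flow. The machine has index variables and index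
  arrays holding natural numbers, and real variables and real arrays holding exact reals; array
  cells are addressed by index variables. A program mentions only finitely many variables and
  arrays, so interleaving the arrays in one flat memory changes the cost only by a constant
  factor. There are no real comparisons and no branching other than loops; adding such
  instructions would only make more programs available.
\<close>

datatype instr =
    IConst string nat            \<comment> \<open>\<open>x := k\<close>\<close>
  | IAdd string string string    \<comment> \<open>\<open>x := y + z\<close>\<close>
  | ISub string string string    \<comment> \<open>\<open>x := y - z\<close>, truncated at zero\<close>
  | IMul string string string    \<comment> \<open>\<open>x := y * z\<close>\<close>
  | ILoad string string string   \<comment> \<open>\<open>x := a[y]\<close>\<close>
  | IStore string string string  \<comment> \<open>\<open>a[x] := y\<close>\<close>
  | RConst string rat            \<comment> \<open>\<open>u := q\<close>\<close>
  | RAdd string string string    \<comment> \<open>\<open>u := v + w\<close>\<close>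
  | RSub string string string    \<comment> \<open>\<open>u := v - w\<close>\<close>
  | RMul string string string    \<comment> \<open>\<open>u := v * w\<close>\<close>
  | RLoad string string string   \<comment> \<open>\<open>u := b[y]\<close>\<close>
  | RStore string string string  \<comment> \<open>\<open>b[x] := u\<close>\<close>

datatype prog =
    Instr instr
  | Seq prog prog
  | WhileLess string string prog \<comment> \<open>while \<open>x < y\<close>, for index variables \<open>x\<close> and \<open>y\<close>\<close>

record ram_state =
  ivar :: "string \<Rightarrow> nat"
  iarr :: "string \<Rightarrow> nat \<Rightarrow> nat"
  rvar :: "string \<Rightarrow> real"
  rarr :: "string \<Rightarrow> nat \<Rightarrow> real"

fun exec_instr :: "instr \<Rightarrow> ram_state \<Rightarrow> ram_state" where
  "exec_instr (IConst x k) st = st\<lparr>ivar := (ivar st)(x := k)\<rparr>"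
| "exec_instr (IAdd x y z) st = st\<lparr>ivar := (ivar st)(x := ivar st y + ivar st z)\<rparr>"
| "exec_instr (ISub x y z) st = st\<lparr>ivar := (ivar st)(x := ivar st y - ivar st z)\<rparr>"
| "exec_instr (IMul x y z) st = st\<lparr>ivar := (ivar st)(x := ivar st y * ivar st z)\<rparr>"
| "exec_instr (ILoad x a y) st = st\<lparr>ivar := (ivar st)(x := iarr st a (ivar st y))\<rparr>"
| "exec_instr (IStore a x y) st =
     st\<lparr>iarr := (iarr st)(a := (iarr st a)(ivar st x := ivar st y))\<rparr>"
| "exec_instr (RConst u q) st = st\<lparr>rvar := (rvar st)(u := of_rat q)\<rparr>"
| "exec_instr (RAdd u v w) st = st\<lparr>rvar := (rvar st)(u := rvar st v + rvar st w)\<rparr>"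
| "exec_instr (RSub u v w) st = st\<lparr>rvar := (rvar st)(u := rvar st v - rvar st w)\<rparr>"
| "exec_instr (RMul u v w) st = st\<lparr>rvar := (rvar st)(u := rvar st v * rvar st w)\<rparr>"
| "exec_instr (RLoad u b y) st = st\<lparr>rvar := (rvar st)(u := rarr st b (ivar st y))\<rparr>"
| "exec_instr (RStore b x u) st =
     st\<lparr>rarr := (rarr st)(b := (rarr st b)(ivar st x := rvar st u))\<rparr>"

text \<open>
  \<open>exec P st t st'\<close>: started in \<open>st\<close>, the program \<open>P\<close> halts in \<open>st'\<close> after \<open>t\<close> steps, each
  instruction and each evaluation of a loop guard being one step.
\<close>

inductive exec :: "prog \<Rightarrow> ram_state \<Rightarrow> nat \<Rightarrow> ram_state \<Rightarrow> bool" where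
  Instr: "exec (Instr i) st 1 (exec_instr i st)"
| Seq: "exec P st t st' \<Longrightarrow> exec Q st' t' st'' \<Longrightarrow> exec (Seq P Q) st (t + t') st''"
| WhileDone: "\<not> ivar st x < ivar st y \<Longrightarrow> exec (WhileLess x y P) st 1 st"
| WhileStep: "ivar st x < ivar st y \<Longrightarrow> exec P st t st' \<Longrightarrow>
    exec (WhileLess x y P) st' t' st'' \<Longrightarrow> exec (WhileLess x y P) st (1 + t + t') st''"

text \<open>
  Input: the dimensions; the nonzero entries of \<open>A\<close> in coordinate format, enumerated by \<open>es\<close> in
  an arbitrary order; the index of the basis vector in each column of \<open>S\<close>; the diagonal of
  \<open>C\<close>. All other memory, including the output array, is initially zero.
\<close>

definition input_state ::
  "nat \<Rightarrow> real mat \<Rightarrow> (nat \<times> nat) list \<Rightarrow> (nat \<Rightarrow> nat) \<Rightarrow> (nat \<Rightarrow> real) \<Rightarrow> ram_state" where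
  "input_state s A es h c =
    \<lparr> ivar = (\<lambda>_. 0)(''n'' := dim_row A, ''d'' := dim_col A, ''s'' := s, ''nnz'' := length es),
      iarr = (\<lambda>_ _. 0)
        (''row'' := (\<lambda>p. if p < length es then fst (es ! p) else 0),
         ''col'' := (\<lambda>p. if p < length es then snd (es ! p) else 0),
         ''S'' := (\<lambda>i. if i < dim_row A then h i else 0)),
      rvar = (\<lambda>_. 0),
      rarr = (\<lambda>_ _. 0)
        (''val'' := (\<lambda>p. if p < length es then A $$ (es ! p) else 0),
         ''C'' := (\<lambda>i. if i < dim_row A then c i else 0)) \<rparr>"

text \<open>Output: an \<open>s \<times> d\<close> matrix in row-major order.\<close>

definition outputs_mat :: "ram_state \<Rightarrow> real mat \<Rightarrow> bool" where
  "outputs_mat st B \<longleftrightarrow>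
     (\<forall>k<dim_row B. \<forall>j<dim_col B. rarr st ''out'' (k * dim_col B + j) = B $$ (k, j))"

definition computes_sketch_within ::
  "prog \<Rightarrow> nat \<Rightarrow> nat \<Rightarrow> real mat \<Rightarrow> (nat \<Rightarrow> nat) \<Rightarrow> (nat \<Rightarrow> real) \<Rightarrow> bool" where
  "computes_sketch_within P b s A h c \<longleftrightarrow>
     (\<forall>es. distinct es \<and> set es = nonzero_positions A \<longrightarrow>
        (\<exists>t st. exec P (input_state s A es h c) t st \<and> t \<le> b \<and>
           outputs_mat st (sparse_cauchy s (dim_row A) h c * A)))"

end

theory Submission
  imports Defs "HOL-Real_Asymp.Real_Asymp"
begin

text \<open>
  Choose a basis of the column space with entries \<open>U\<close> such that the entries of \<open>U\<close> have total absolute value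
  at most \<open>2 d\<close> and \<open>\<bar>x j\<bar> \<le> \<parallel>U x\<parallel>\<^sub>1\<close>. A bucket of the sketch of \<open>y = U x\<close> is a Cauchy variable whose scale is the
  \<open>l1\<close> mass of \<open>y\<close> in that bucket, so \<open>\<parallel>\<Pi> U\<parallel>\<^sub>1\<close> is \<open>O(d log d)\<close> with constant probability, which gives the upper bound.

  For the lower bound call a row of \<open>U\<close> heavy if its \<open>l1\<close> norm exceeds a threshold \<open>\<tau>\<close> of order \<open>1 / (d log d)\<close>. There are
  \<open>O(d\<^sup>2 log d)\<close> heavy rows; they are hashed into distinct buckets with almost no light mass beside them, and their Cauchy
  coefficients are all at least of order \<open>1 / (d\<^sup>2 log d)\<close>. This settles every \<open>y\<close> that has half of its mass on the heavy
  rows. For the other \<open>y\<close>, each bucket free of heavy rows carries mass at most \<open>2 \<tau>\<close>, so the sketch of a fixed \<open>y\<close> is small only with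
  probability \<open>exp (- \<Omega>(1 / \<tau>))\<close>, which survives a union bound over a grid of \<open>exp (O(d log d))\<close> points.
\<close>

section \<open>Cauchy variables\<close>

text \<open>A net argument alone would fail: if one row carries most of the mass of
  \<open>y\<close>, the sketch of \<open>y\<close> is small as soon as the Cauchy coefficient of
  that row is small. This has only polynomially small probability, too much for a union bound over
  exponentially many points. Heaviness is therefore read off the basis and not off \<open>y\<close>,
  so that one event about few coefficients serves all such \<open>y\<close> at once. In the other
  direction Cauchy variables have no mean, so Markov's inequality applies only after truncation;
  this costs the factor \<open>t\<close> of order log d.

  The power d^5 comes from the noise beside heavy rows. A heavy coefficient is only guaranteed to
  exceed some \<eta> of order \<tau> / d, so the light mass \<beta> in heavy buckets must be of
  order \<eta> / t, that is 1 / (d^2 log^2 d). Keeping the expected mass there below this level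
  takes d^2 / (\<tau> \<beta>), that is d^5 log^3 d, buckets up to constants.

  The two sources of randomness are used in turn: a hash function is good with probability 1/2, and
  for each fixed good one the coefficients succeed with probability 1/4.\<close>

lemma nn_integral_lborel_FTC:
  fixes f F :: "real \<Rightarrow> real"
  assumes F: "\<And>x. (F has_real_derivative f x) (at x)"
    and f: "continuous_on UNIV f" and nonneg: "\<And>x. f x \<ge> 0"
    and A: "(F \<longlongrightarrow> A) at_bot" and B: "(F \<longlongrightarrow> B) at_top"
  shows "(\<integral>\<^sup>+x. ennreal (f x) \<partial>lborel) = ennreal (B - A)"
proof -
  have A': "((F \<circ> real_of_ereal) \<longlongrightarrow> A) (at_right (-\<infinity>))"
    using A by (simp add: ereal_tendsto_simps)
  have B': "((F \<circ> real_of_ereal) \<longlongrightarrow> B) (at_left \<infinity>)"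
    using B by (simp add: ereal_tendsto_simps)
  have c: "isCont f x" for x
    using f by (simp add: continuous_on_eq_continuous_at)
  note ftc = interval_integral_FTC_nonneg[of "-\<infinity>" "\<infinity>" F f A B, OF _ F c _ A' B']
  have "set_integrable lborel (einterval (-\<infinity>) \<infinity>) f" by (rule ftc(1)) (auto simp: nonneg)
  hence int: "integrable lborel f" by (simp add: set_integrable_def)
  have "(LBINT x=-\<infinity>..\<infinity>. f x) = B - A" by (rule ftc(2)) (auto simp: nonneg)
  hence "(\<integral>x. f x \<partial>lborel) = B - A"
    by (simp add: interval_lebesgue_integral_def set_lebesgue_integral_def)
  thus ?thesis
    using int nonneg by (simp add: nn_integral_eq_integral)
qed

lemma cauchy_density_FTC:
  assumes "l > 0"
  shows "(\<integral>\<^sup>+x. ennreal (l / (l\<^sup>2 + x\<^sup>2)) \<partial>lborel) = ennreal pi"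
proof -
  have "(\<integral>\<^sup>+x. ennreal (l / (l\<^sup>2 + x\<^sup>2)) \<partial>lborel) = ennreal (pi / 2 - (- (pi / 2)))"
  proof (rule nn_integral_lborel_FTC[where F = "\<lambda>x. arctan (x / l)"])
    show "((\<lambda>x. arctan (x / l)) has_real_derivative l / (l\<^sup>2 + x\<^sup>2)) (at x)" for x
      using assms by (auto intro!: derivative_eq_intros simp: field_simps power2_eq_square)
    show "continuous_on UNIV (\<lambda>x. l / (l\<^sup>2 + x\<^sup>2))"
      using assms by (intro continuous_intros) (auto simp: sum_power2_eq_zero_iff)
    show "((\<lambda>x. arctan (x / l)) \<longlongrightarrow> pi / 2) at_top"
      using assms by real_asymp
    show "((\<lambda>x. arctan (x / l)) \<longlongrightarrow> - (pi / 2)) at_bot"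
      using assms by real_asymp
  qed (use assms in auto)
  thus ?thesis by simp
qed

text \<open>Partial fractions; the case \<open>u = 0\<close>, \<open>a = b\<close> is degenerate and excluded.\<close>

lemma cauchy_convolution_kernel:
  fixes a b u :: real
  assumes a: "a > 0" and b: "b > 0" and u: "u \<noteq> 0"
  shows "(\<integral>\<^sup>+v. ennreal (1 / ((b\<^sup>2 + v\<^sup>2) * (a\<^sup>2 + (u - v)\<^sup>2))) \<partial>lborel) =
    ennreal (pi * (a + b) / (a * b * ((a + b)\<^sup>2 + u\<^sup>2)))"
proof -
  define E where "E = a\<^sup>2 - b\<^sup>2 + u\<^sup>2"
  define E' where "E' = b\<^sup>2 - a\<^sup>2 + u\<^sup>2"
  define D where "D = E\<^sup>2 + 4 * b\<^sup>2 * u\<^sup>2"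
  \<comment> \<open>Integrating the partial fractions
    \<open>(2 * u * v + E) / (D * (b\<^sup>2 + v\<^sup>2))\<close> and its counterpart for
    \<open>a\<close>: the parts linear in \<open>v\<close> give the logarithms, the constants
    \<open>E\<close> and \<open>E'\<close> the arctangents.\<close>
  define F where "F = (\<lambda>v. u / D * (ln (b\<^sup>2 + v\<^sup>2) - ln (a\<^sup>2 + (u - v)\<^sup>2)) +
     E / (D * b) * arctan (v / b) + E' / (D * a) * arctan ((v - u) / a))"
  have D: "D > 0" using b u unfolding D_def by (simp add: add_nonneg_pos)
  \<comment> \<open>The second factor vanishes exactly in the degenerate case; it reappears in the
    numerator \<open>a * E + b * E'\<close> and cancels at the end.\<close>
  have D2: "D = ((a + b)\<^sup>2 + u\<^sup>2) * ((a - b)\<^sup>2 + u\<^sup>2)"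
    unfolding D_def E_def by (simp add: power2_eq_square algebra_simps)
  have p1: "b\<^sup>2 + v\<^sup>2 > 0" for v using b by (simp add: add_pos_nonneg)
  have p2: "a\<^sup>2 + (u - v)\<^sup>2 > 0" for v using a by (simp add: add_pos_nonneg)
  have pf: "(2 * u * v + E) * (a\<^sup>2 + (u - v)\<^sup>2) + (- 2 * u * (v - u) + E') * (b\<^sup>2 + v\<^sup>2) = D" for v
    unfolding D_def E_def E'_def by (simp add: power2_eq_square algebra_simps)
  have "(\<integral>\<^sup>+v. ennreal (1 / ((b\<^sup>2 + v\<^sup>2) * (a\<^sup>2 + (u - v)\<^sup>2))) \<partial>lborel) =
     ennreal ((E / (D * b) * (pi / 2) + E' / (D * a) * (pi / 2)) - (E / (D * b) * (- pi / 2) + E' / (D * a) * (- pi / 2)))"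
  proof (rule nn_integral_lborel_FTC[where F = F])
    fix v
    have d1: "((\<lambda>v. arctan (v / b)) has_real_derivative (b / (b\<^sup>2 + v\<^sup>2))) (at v)"
      using b by (auto intro!: derivative_eq_intros simp: field_simps power2_eq_square)
    have d2: "((\<lambda>v. arctan ((v - u) / a)) has_real_derivative (a / (a\<^sup>2 + (u - v)\<^sup>2))) (at v)"
      using a by (auto intro!: derivative_eq_intros simp: field_simps power2_eq_square)
    have d3: "((\<lambda>v. ln (b\<^sup>2 + v\<^sup>2)) has_real_derivative (2 * v / (b\<^sup>2 + v\<^sup>2))) (at v)"
      using p1[of v] by (auto intro!: derivative_eq_intros)
    have d4: "((\<lambda>v. ln (a\<^sup>2 + (u - v)\<^sup>2)) has_real_derivative (2 * (v - u) / (a\<^sup>2 + (u - v)\<^sup>2))) (at v)"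
      using p2[of v] by (auto intro!: derivative_eq_intros simp: field_simps)
    have "(F has_real_derivative (u / D * (2 * v / (b\<^sup>2 + v\<^sup>2) - 2 * (v - u) / (a\<^sup>2 + (u - v)\<^sup>2)) +
      E / (D * b) * (b / (b\<^sup>2 + v\<^sup>2)) + E' / (D * a) * (a / (a\<^sup>2 + (u - v)\<^sup>2)))) (at v)"
      unfolding F_def by (intro DERIV_add DERIV_cmult DERIV_diff d1 d2 d3 d4)
    also have "(u / D * (2 * v / (b\<^sup>2 + v\<^sup>2) - 2 * (v - u) / (a\<^sup>2 + (u - v)\<^sup>2)) +
      E / (D * b) * (b / (b\<^sup>2 + v\<^sup>2)) + E' / (D * a) * (a / (a\<^sup>2 + (u - v)\<^sup>2))) =
      ((2 * u * v + E) * (a\<^sup>2 + (u - v)\<^sup>2) + (- 2 * u * (v - u) + E') * (b\<^sup>2 + v\<^sup>2)) /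
        (D * ((b\<^sup>2 + v\<^sup>2) * (a\<^sup>2 + (u - v)\<^sup>2)))"
      using a b D p1[of v, THEN less_imp_neq] p2[of v, THEN less_imp_neq] by (simp add: divide_simps) (simp add: algebra_simps)
    also have "\<dots> = 1 / ((b\<^sup>2 + v\<^sup>2) * (a\<^sup>2 + (u - v)\<^sup>2))"
      unfolding pf using D by simp
    finally show "(F has_real_derivative 1 / ((b\<^sup>2 + v\<^sup>2) * (a\<^sup>2 + (u - v)\<^sup>2))) (at v)" .
    show "0 \<le> 1 / ((b\<^sup>2 + v\<^sup>2) * (a\<^sup>2 + (u - v)\<^sup>2))" using p1[of v] p2[of v] by simp
  next
    show "continuous_on UNIV (\<lambda>v. 1 / ((b\<^sup>2 + v\<^sup>2) * (a\<^sup>2 + (u - v)\<^sup>2)))"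
    proof -
      have "(b\<^sup>2 + v\<^sup>2) * (a\<^sup>2 + (u - v)\<^sup>2) \<noteq> 0" for v
        using mult_pos_pos[OF p1[of v] p2[of v]] by linarith
      thus ?thesis by (intro continuous_intros ballI)
    qed
  next
    \<comment> \<open>The logarithms enter with opposite signs and cancel at both ends, so only the
      jumps of the arctangents contribute to the integral.\<close>
    have l: "((\<lambda>v. ln (b\<^sup>2 + v\<^sup>2) - ln (a\<^sup>2 + (u - v)\<^sup>2)) \<longlongrightarrow> 0) at_top"
            "((\<lambda>v. ln (b\<^sup>2 + v\<^sup>2) - ln (a\<^sup>2 + (u - v)\<^sup>2)) \<longlongrightarrow> 0) at_bot"
      using a b by real_asymp+
    have m: "((\<lambda>v. arctan (v / b)) \<longlongrightarrow> pi / 2) at_top" "((\<lambda>v. arctan (v / b)) \<longlongrightarrow> - pi / 2) at_bot"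
      using b by real_asymp+
    have n: "((\<lambda>v. arctan ((v - u) / a)) \<longlongrightarrow> pi / 2) at_top" "((\<lambda>v. arctan ((v - u) / a)) \<longlongrightarrow> - pi / 2) at_bot"
      using a by real_asymp+
    show "(F \<longlongrightarrow> E / (D * b) * (- pi / 2) + E' / (D * a) * (- pi / 2)) at_bot"
      unfolding F_def by (rule tendsto_eq_intros l m n refl | simp)+
    show "(F \<longlongrightarrow> E / (D * b) * (pi / 2) + E' / (D * a) * (pi / 2)) at_top"
      unfolding F_def by (rule tendsto_eq_intros l m n refl | simp)+
  qed
  also have "(E / (D * b) * (pi / 2) + E' / (D * a) * (pi / 2)) - (E / (D * b) * (- pi / 2) + E' / (D * a) * (- pi / 2))
     = pi * (a * E + b * E') / (a * b * D)"
    using a b D by (simp add: field_simps)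
  also have "a * E + b * E' = (a + b) * ((a - b)\<^sup>2 + u\<^sup>2)"
    unfolding E_def E'_def by (simp add: power2_eq_square algebra_simps)
  also have "pi * ((a + b) * ((a - b)\<^sup>2 + u\<^sup>2)) / (a * b * D) = pi * (a + b) / (a * b * ((a + b)\<^sup>2 + u\<^sup>2))"
  proof -
    have "(a - b)\<^sup>2 + u\<^sup>2 > 0" using u by (simp add: add_nonneg_pos)
    moreover have "x * (y * z) / (c * (w * z)) = x * y / (c * w)" if "z \<noteq> 0" for x y z c w :: real
      using that by simp
    ultimately show ?thesis unfolding D2 by (metis less_irrefl)
  qed
  finally show ?thesis .
qed

section \<open>The standard Cauchy law and its stability under addition\<close>

lemma sets_std_cauchy [simp, measurable_cong]: "sets std_cauchy = sets borel"
  by (simp add: std_cauchy_def)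

lemma space_std_cauchy [simp]: "space std_cauchy = UNIV"
  by (simp add: std_cauchy_def)

lemma prob_space_std_cauchy: "prob_space std_cauchy"
proof
  have "emeasure std_cauchy (space std_cauchy) = (\<integral>\<^sup>+x. ennreal (1 / pi) * ennreal (1 / (1\<^sup>2 + x\<^sup>2)) \<partial>lborel)"
    by (simp add: std_cauchy_def emeasure_density ennreal_mult[symmetric])
  also have "\<dots> = ennreal (1 / pi) * ennreal pi"
    by (subst nn_integral_cmult, measurable, subst cauchy_density_FTC, auto)
  finally show "emeasure std_cauchy (space std_cauchy) = 1"
    by (simp add: ennreal_mult[symmetric])
qed

lemma nn_integral_std_cauchy:
  assumes [measurable]: "f \<in> borel_measurable borel"
  shows "(\<integral>\<^sup>+x. f x \<partial>std_cauchy) = (\<integral>\<^sup>+x. ennreal (1 / (pi * (1 + x\<^sup>2))) * f x \<partial>lborel)"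
  unfolding std_cauchy_def by (subst nn_integral_density) auto

lemma nn_integral_std_cauchy_scale:
  assumes [measurable]: "f \<in> borel_measurable borel" and l: "l > 0"
  shows "(\<integral>\<^sup>+x. f (t + l * x) \<partial>std_cauchy) = (\<integral>\<^sup>+u. ennreal (l / (pi * (l\<^sup>2 + (u - t)\<^sup>2))) * f u \<partial>lborel)"
proof -
  have "(\<integral>\<^sup>+u. ennreal (l / (pi * (l\<^sup>2 + (u - t)\<^sup>2))) * f u \<partial>lborel) =
     ennreal l * (\<integral>\<^sup>+x. ennreal (l / (pi * (l\<^sup>2 + (l * x)\<^sup>2))) * f (t + l * x) \<partial>lborel)"
    using l by (subst nn_integral_real_affine[where c = l and t = t]) (auto simp: ennreal_mult')
  also have "\<dots> = (\<integral>\<^sup>+x. ennreal l * (ennreal (l / (pi * (l\<^sup>2 + (l * x)\<^sup>2))) * f (t + l * x)) \<partial>lborel)"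
    by (subst nn_integral_cmult) auto
  also have "\<dots> = (\<integral>\<^sup>+x. ennreal (1 / (pi * (1 + x\<^sup>2))) * f (t + l * x) \<partial>lborel)"
  proof (intro nn_integral_cong)
    fix x
    have *: "l * l / (pi * (l\<^sup>2 + (l * x)\<^sup>2)) = 1 / (pi * (1 + x\<^sup>2))"
    proof -
      have "l\<^sup>2 + (l * x)\<^sup>2 = l * l * (1 + x\<^sup>2)" by (simp add: power2_eq_square algebra_simps)
      thus ?thesis using l by simp
    qed
    show "ennreal l * (ennreal (l / (pi * (l\<^sup>2 + (l * x)\<^sup>2))) * f (t + l * x)) =
       ennreal (1 / (pi * (1 + x\<^sup>2))) * f (t + l * x)"
      using l by (simp add: mult.assoc[symmetric] ennreal_mult'[symmetric] del: mult.assoc) (simp add: *)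
  qed
  finally show ?thesis by (subst nn_integral_std_cauchy) auto
qed

text \<open>Stability of the Cauchy law, by densities: for fixed \<open>y\<close> the variable
  \<open>a * x + b * y\<close> has a shifted Cauchy density; after exchanging the integrals, the
  kernel integral over \<open>v\<close> evaluates to the density of scale
  \<open>a + b\<close>.\<close>

lemma std_cauchy_add:
  fixes f :: "real \<Rightarrow> ennreal"
  assumes f[measurable]: "f \<in> borel_measurable borel" and a: "a > 0" and b: "b > 0"
  shows "(\<integral>\<^sup>+y. \<integral>\<^sup>+x. f (a * x + b * y) \<partial>std_cauchy \<partial>std_cauchy) = (\<integral>\<^sup>+z. f ((a + b) * z) \<partial>std_cauchy)"
proof -
  let ?p = "\<lambda>l u. ennreal (l / (pi * (l\<^sup>2 + u\<^sup>2)))"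
  have "(\<integral>\<^sup>+y. \<integral>\<^sup>+x. f (a * x + b * y) \<partial>std_cauchy \<partial>std_cauchy) =
     (\<integral>\<^sup>+y. \<integral>\<^sup>+u. ?p a (u - b * y) * f u \<partial>lborel \<partial>std_cauchy)"
    by (subst nn_integral_std_cauchy_scale[OF f a, symmetric]) (simp add: add.commute)
  also have "\<dots> = (\<integral>\<^sup>+v. ?p b v * (\<integral>\<^sup>+u. ?p a (u - v) * f u \<partial>lborel) \<partial>lborel)"
    by (subst nn_integral_std_cauchy_scale[OF _ b, where t = 0 and f = "\<lambda>v. \<integral>\<^sup>+u. ?p a (u - v) * f u \<partial>lborel", simplified]) auto
  also have "\<dots> = (\<integral>\<^sup>+v. (\<integral>\<^sup>+u. ?p b v * (?p a (u - v) * f u) \<partial>lborel) \<partial>lborel)"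
    by (subst nn_integral_cmult) auto
  also have "\<dots> = (\<integral>\<^sup>+u. (\<integral>\<^sup>+v. ?p b v * (?p a (u - v) * f u) \<partial>lborel) \<partial>lborel)"
    by (rule lborel_pair.Fubini') simp
  also have "\<dots> = (\<integral>\<^sup>+u. ?p (a + b) u * f u \<partial>lborel)"
  proof (rule nn_integral_cong_AE)
    \<comment> \<open>The degenerate point of the kernel is a null set.\<close>
    have "AE u in lborel. u \<noteq> (0::real)" by (rule AE_lborel_singleton)
    thus "AE u in lborel. (\<integral>\<^sup>+v. ?p b v * (?p a (u - v) * f u) \<partial>lborel) = ?p (a + b) u * f u"
    proof eventually_elim
      case (elim u)
      have eq: "?p b v * ?p a (u - v) = ennreal (a * b / pi\<^sup>2) * ennreal (1 / ((b\<^sup>2 + v\<^sup>2) * (a\<^sup>2 + (u - v)\<^sup>2)))" for v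
        using a b by (simp add: ennreal_mult'[symmetric] power2_eq_square mult_ac)
      have "(\<integral>\<^sup>+v. ?p b v * (?p a (u - v) * f u) \<partial>lborel) =
         (\<integral>\<^sup>+v. ennreal (a * b / pi\<^sup>2) * (ennreal (1 / ((b\<^sup>2 + v\<^sup>2) * (a\<^sup>2 + (u - v)\<^sup>2))) * f u) \<partial>lborel)"
        by (simp only: mult.assoc[symmetric] eq)
      also have "\<dots> = ennreal (a * b / pi\<^sup>2) * ennreal (pi * (a + b) / (a * b * ((a + b)\<^sup>2 + u\<^sup>2))) * f u"
        using a b elim
        by (subst nn_integral_cmult, simp, subst nn_integral_multc, simp, subst cauchy_convolution_kernel)
           (simp_all add: mult.assoc)
      also have "ennreal (a * b / pi\<^sup>2) * ennreal (pi * (a + b) / (a * b * ((a + b)\<^sup>2 + u\<^sup>2))) = ?p (a + b) u"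
        using a b by (simp add: ennreal_mult'[symmetric] power2_eq_square)
      finally show ?case .
    qed
  qed
  also have "\<dots> = (\<integral>\<^sup>+z. f ((a + b) * z) \<partial>std_cauchy)"
    using a b by (subst nn_integral_std_cauchy_scale[OF f, where t = 0 and l = "a + b", simplified]) auto
  finally show ?thesis .
qed

section \<open>Tails, truncated mean and Laplace transform of a Cauchy variable\<close>

lemma measure_std_cauchy_interval:
  assumes "R \<ge> 0"
  shows "measure std_cauchy {-R..R} = 2 * arctan R / pi"
proof -
  have "emeasure std_cauchy {-R..R} = (\<integral>\<^sup>+x. ennreal (1 / (pi * (1 + x\<^sup>2))) * indicator {-R..R} x \<partial>lborel)"
    by (simp add: std_cauchy_def emeasure_density)
  also have "\<dots> = ennreal (arctan R / pi - arctan (-R) / pi)"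
  proof (rule nn_integral_FTC_Icc)
    fix x
    have "((\<lambda>x. arctan x / pi) has_real_derivative inverse (1 + x\<^sup>2) / pi) (at x)"
      by (intro DERIV_cdivide DERIV_arctan)
    thus "((\<lambda>x. arctan x / pi) has_real_derivative 1 / (pi * (1 + x\<^sup>2))) (at x)"
      by (simp add: field_simps)
  qed (use assms in auto)
  finally show ?thesis
    using assms by (simp add: measure_def arctan_minus)
qed

lemma measure_std_cauchy_le:
  assumes "R \<ge> 0"
  shows "measure std_cauchy {x. \<bar>x\<bar> \<le> R} \<le> R"
proof -
  have "{x. \<bar>x\<bar> \<le> R} = {-R..R}" by auto
  moreover have "arctan R \<le> R" using assms by (rule arctan_le_self)
  hence "2 * arctan R / pi \<le> R"
    using assms pi_ge_two mult_mono[of 2 pi "arctan R" R] by (simp add: field_simps)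
  ultimately show ?thesis using measure_std_cauchy_interval[OF assms] by simp
qed

lemma measure_std_cauchy_gt:
  assumes "R > 0"
  shows "measure std_cauchy {x. \<bar>x\<bar> > R} \<le> 1 / R"
proof -
  interpret prob_space std_cauchy by (rule prob_space_std_cauchy)
  have "{x. \<bar>x\<bar> > R} = space std_cauchy - {-R..R}" by auto
  hence "measure std_cauchy {x. \<bar>x\<bar> > R} = 1 - 2 * arctan R / pi"
    using measure_std_cauchy_interval[of R] assms by (simp add: prob_compl[simplified])
  also have "arctan R = pi / 2 - arctan (1 / R)"
    using arctan_inverse[of R] assms by (simp add: inverse_eq_divide)
  also have "1 - 2 * (pi / 2 - arctan (1 / R)) / pi = 2 * arctan (1 / R) / pi"
    by (simp add: field_simps)
  also have "\<dots> \<le> 1 / R"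
    using assms pi_ge_two arctan_le_self[of "1 / R"] mult_mono[of 2 pi "arctan (1/R)" "1/R"] by (simp add: field_simps)
  finally show ?thesis .
qed

text \<open>Truncation leaves a mean of only logarithmic size, because
  \<open>x / (1 + x\<^sup>2)\<close> integrates to a logarithm on each half line. This logarithm is
  the origin of the factor \<open>t\<close> in the upper bound on the sketch.\<close>

lemma std_cauchy_truncated_moment:
  assumes "R \<ge> 0"
  shows "(\<integral>\<^sup>+x. ennreal \<bar>x\<bar> * indicator {-R..R} x \<partial>std_cauchy) \<le> ennreal (ln (1 + R\<^sup>2))"
proof -
  let ?p = "\<lambda>x::real. 1 / (pi * (1 + x\<^sup>2))"
  have pos: "1 + x\<^sup>2 > 0" for x :: real by (simp add: add_pos_nonneg)
  have d: "((\<lambda>x. ln (1 + x\<^sup>2) / (2 * pi)) has_real_derivative x * ?p x) (at x)" for x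
  proof -
    have "((\<lambda>x. ln (1 + x\<^sup>2) / (2 * pi)) has_real_derivative (inverse (1 + x\<^sup>2) * (2 * x)) / (2 * pi)) (at x)"
      using pos[of x] by (intro DERIV_cdivide) (auto intro!: derivative_eq_intros simp: field_simps)
    moreover have "inverse (1 + x\<^sup>2) * (2 * x) / (2 * pi) = x * ?p x"
      by (simp add: inverse_eq_divide)
    ultimately show ?thesis by simp
  qed
  have "(\<integral>\<^sup>+x. ennreal \<bar>x\<bar> * indicator {-R..R} x \<partial>std_cauchy) =
      (\<integral>\<^sup>+x. ennreal (?p x) * (ennreal \<bar>x\<bar> * indicator {-R..R} x) \<partial>lborel)"
    by (subst nn_integral_std_cauchy) auto
  also have "\<dots> \<le> (\<integral>\<^sup>+x. ennreal (x * ?p x) * indicator {0..R} x + ennreal (- x * ?p x) * indicator {-R..0} x \<partial>lborel)"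
    by (intro nn_integral_mono) (auto simp: indicator_def ennreal_mult'[symmetric] mult_ac)
  also have "\<dots> = (\<integral>\<^sup>+x. ennreal (x * ?p x) * indicator {0..R} x \<partial>lborel) +
       (\<integral>\<^sup>+x. ennreal (- x * ?p x) * indicator {-R..0} x \<partial>lborel)"
    by (subst nn_integral_add) auto
  also have "(\<integral>\<^sup>+x. ennreal (x * ?p x) * indicator {0..R} x \<partial>lborel) =
       ennreal (ln (1 + R\<^sup>2) / (2 * pi) - ln (1 + 0\<^sup>2) / (2 * pi))"
    using assms d by (intro nn_integral_FTC_Icc) auto
  also have "(\<integral>\<^sup>+x. ennreal (- x * ?p x) * indicator {-R..0} x \<partial>lborel) =
       ennreal (- ln (1 + 0\<^sup>2) / (2 * pi) - (- ln (1 + (-R)\<^sup>2) / (2 * pi)))"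
    using assms DERIV_minus[OF d] by (intro nn_integral_FTC_Icc) (auto simp: mult_nonpos_nonneg divide_nonpos_nonneg)
  also have "ennreal (ln (1 + R\<^sup>2) / (2 * pi) - ln (1 + 0\<^sup>2) / (2 * pi)) +
      ennreal (- ln (1 + 0\<^sup>2) / (2 * pi) - (- ln (1 + (-R)\<^sup>2) / (2 * pi))) = ennreal (ln (1 + R\<^sup>2) / pi)"
    by (simp add: ennreal_plus[symmetric] del: ennreal_plus)
  also have "\<dots> \<le> ennreal (ln (1 + R\<^sup>2))"
  proof (rule ennreal_leI)
    have "ln (1 + R\<^sup>2) * 1 \<le> ln (1 + R\<^sup>2) * pi" using pi_ge_two by (intro mult_left_mono) auto
    thus "ln (1 + R\<^sup>2) / pi \<le> ln (1 + R\<^sup>2)" by (simp add: field_simps)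
  qed
  finally show ?thesis .
qed

text \<open>The integrand is at most 1 on \<open>\<bar>x\<bar> \<le> 1/2\<close>, a set of
  probability at most 1/2, and at most \<open>exp (- z / 2)\<close> elsewhere. Hence the mean is at
  most \<open>(1 + exp (- z / 2)) / 2\<close>, which is at most 1 - z/8 for z in [0, 1].\<close>

lemma std_cauchy_laplace:
  assumes z: "0 \<le> z" "z \<le> 1"
  shows "(\<integral>\<^sup>+x. ennreal (exp (- z * \<bar>x\<bar>)) \<partial>std_cauchy) \<le> ennreal (exp (- z / 8))"
proof -
  interpret prob_space std_cauchy by (rule prob_space_std_cauchy)
  have A[measurable]: "{x::real. \<bar>x\<bar> \<le> 1/2} \<in> sets borel" by measurable
  have "(\<integral>\<^sup>+x. ennreal (exp (- z * \<bar>x\<bar>)) \<partial>std_cauchy) \<le>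
     (\<integral>\<^sup>+x. ennreal (exp (- z / 2)) + ennreal (1 - exp (- z / 2)) * indicator {x. \<bar>x\<bar> \<le> 1/2} x \<partial>std_cauchy)"
  proof (intro nn_integral_mono)
    fix x
    have "exp (- z * \<bar>x\<bar>) \<le> 1" using z by simp
    moreover have "exp (- z * \<bar>x\<bar>) \<le> exp (- z / 2)" if "\<bar>x\<bar> > 1/2"
      using mult_left_mono[of "1/2" "\<bar>x\<bar>" z] z that by simp
    ultimately show "ennreal (exp (- z * \<bar>x\<bar>)) \<le>
        ennreal (exp (- z / 2)) + ennreal (1 - exp (- z / 2)) * indicator {x. \<bar>x\<bar> \<le> 1/2} x"
      using z by (auto simp: indicator_def ennreal_plus[symmetric] not_le intro!: ennreal_leI simp del: ennreal_plus)
  qed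
  also have "\<dots> = ennreal (exp (- z / 2)) + ennreal (1 - exp (- z / 2)) * emeasure std_cauchy {x. \<bar>x\<bar> \<le> 1/2}"
    by (subst nn_integral_add) (auto simp: nn_integral_cmult_indicator emeasure_space_1[simplified])
  also have "\<dots> \<le> ennreal (exp (- z / 2)) + ennreal (1 - exp (- z / 2)) * ennreal (1/2)"
    using measure_std_cauchy_le[of "1/2"] by (intro add_left_mono mult_left_mono) (auto simp only: emeasure_eq_measure zero_le intro!: ennreal_leI)
  also have "\<dots> = ennreal ((1 + exp (- z / 2)) / 2)"
  proof -
    have "ennreal (exp (- z / 2)) + ennreal (1 - exp (- z / 2)) * ennreal (1/2) =
        ennreal (exp (- z / 2) + (1 - exp (- z / 2)) * (1/2))"
      using z by (subst ennreal_plus, simp, simp, subst ennreal_mult'', simp, simp)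
    thus ?thesis by (simp add: field_simps)
  qed
  also have "\<dots> \<le> ennreal (exp (- z / 8))"
  proof (rule ennreal_leI)
    have "exp (- (z / 2)) \<le> 1 / (1 + z / 2)"
      using exp_ge_add_one_self[of "z/2"] z by (simp add: exp_minus field_simps)
    also have "\<dots> \<le> 1 - z / 4" 
    proof -
      have "1 \<le> (1 - z / 4) * (1 + z / 2)" using mult_right_mono[of z 1 z] z by (simp add: field_simps)
      thus ?thesis using z by (simp add: divide_le_eq)
    qed
    finally show "(1 + exp (- z / 2)) / 2 \<le> exp (- z / 8)"
      using exp_ge_add_one_self[of "- z / 8"] by simp
  qed
  finally show ?thesis .
qed

section \<open>Sums of independent Cauchy variables\<close>

lemma nn_integral_std_cauchy_uminus:
  assumes [measurable]: "f \<in> borel_measurable borel"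
  shows "(\<integral>\<^sup>+x. f (- x) \<partial>std_cauchy) = (\<integral>\<^sup>+x. f x \<partial>std_cauchy)"
proof -
  have "(\<integral>\<^sup>+x. f x \<partial>std_cauchy) = (\<integral>\<^sup>+x. ennreal (1 / (pi * (1 + x\<^sup>2))) * f x \<partial>lborel)"
    by (rule nn_integral_std_cauchy) simp
  also have "\<dots> = (\<integral>\<^sup>+x. ennreal (1 / (pi * (1 + x\<^sup>2))) * f (- x) \<partial>lborel)"
    by (subst nn_integral_real_affine[where c = "-1" and t = 0]) auto
  also have "\<dots> = (\<integral>\<^sup>+x. f (- x) \<partial>std_cauchy)"
    by (rule nn_integral_std_cauchy[symmetric]) simp
  finally show ?thesis by simp
qed

lemma nn_integral_std_cauchy_abs_scale:
  assumes [measurable]: "f \<in> borel_measurable borel"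
  shows "(\<integral>\<^sup>+x. f (a * x) \<partial>std_cauchy) = (\<integral>\<^sup>+x. f (\<bar>a\<bar> * x) \<partial>std_cauchy)"
proof (cases "a \<ge> 0")
  case False
  thus ?thesis
    using nn_integral_std_cauchy_uminus[of "\<lambda>x. f (a * x)"] by simp
qed simp

text \<open>Symmetry of the law removes the sign of \<open>a\<close>; vanishing scales are treated
  apart, since the convolution formula requires both to be positive.\<close>

lemma std_cauchy_add_abs:
  fixes f :: "real \<Rightarrow> ennreal"
  assumes f[measurable]: "f \<in> borel_measurable borel" and b: "b \<ge> 0"
  shows "(\<integral>\<^sup>+y. \<integral>\<^sup>+x. f (a * y + b * x) \<partial>std_cauchy \<partial>std_cauchy) = (\<integral>\<^sup>+z. f ((\<bar>a\<bar> + b) * z) \<partial>std_cauchy)"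
proof -
  interpret prob_space std_cauchy by (rule prob_space_std_cauchy)
  have em: "emeasure std_cauchy UNIV = 1" using emeasure_space_1 by simp
  have "(\<integral>\<^sup>+y. \<integral>\<^sup>+x. f (a * y + b * x) \<partial>std_cauchy \<partial>std_cauchy) =
    (\<integral>\<^sup>+y. \<integral>\<^sup>+x. f (\<bar>a\<bar> * y + b * x) \<partial>std_cauchy \<partial>std_cauchy)"
    by (rule nn_integral_std_cauchy_abs_scale[where f = "\<lambda>z. \<integral>\<^sup>+x. f (z + b * x) \<partial>std_cauchy"]) measurable
  also have "\<dots> = (\<integral>\<^sup>+z. f ((\<bar>a\<bar> + b) * z) \<partial>std_cauchy)"
  proof (cases "a = 0 \<or> b = 0")
    case True
    thus ?thesis by (auto simp: em)
  next
    case False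
    thus ?thesis using std_cauchy_add[of f b "\<bar>a\<bar>"] b by (simp add: add.commute)
  qed
  finally show ?thesis .
qed

abbreviation cauchy_PiM :: "'i set \<Rightarrow> ('i \<Rightarrow> real) measure" where
  "cauchy_PiM J \<equiv> (\<Pi>\<^sub>M i\<in>J. std_cauchy)"

lemma prob_space_cauchy_PiM: "prob_space (cauchy_PiM J)"
  by (intro prob_space_PiM prob_space_std_cauchy)

lemma measurable_cauchy_component:
  "i \<in> J \<Longrightarrow> (\<lambda>c. c i) \<in> borel_measurable (cauchy_PiM J)"
  using measurable_component_singleton[of i J "\<lambda>_. std_cauchy"]
  by (simp add: measurable_cong_sets[OF refl sets_std_cauchy])

text \<open>This is what ties Cauchy variables to the l1 norm: a weighted sum of independent copies
  is one copy scaled by the l1 norm of the weights. Equality in law is expressed by integrals of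
  arbitrary nonnegative \<open>f\<close>.\<close>

lemma nn_integral_cauchy_sum:
  fixes f :: "real \<Rightarrow> ennreal"
  assumes J: "finite J" and f: "f \<in> borel_measurable borel"
  shows "(\<integral>\<^sup>+c. f (\<Sum>i\<in>J. a i * c i) \<partial>cauchy_PiM J) = (\<integral>\<^sup>+z. f ((\<Sum>i\<in>J. \<bar>a i\<bar>) * z) \<partial>std_cauchy)"
  using J f
proof (induction J arbitrary: f rule: finite_induct)
  case empty
  interpret prob_space std_cauchy by (rule prob_space_std_cauchy)
  interpret P: prob_space "cauchy_PiM ({} :: 'a set)" by (rule prob_space_cauchy_PiM)
  show ?case using emeasure_space_1 P.emeasure_space_1 by simp
next
  case (insert i J)
  note [measurable] = insert.prems
  interpret std: prob_space std_cauchy by (rule prob_space_std_cauchy)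
  interpret product_sigma_finite "\<lambda>_::'a. std_cauchy"
    by standard
  have "(\<integral>\<^sup>+c. f (\<Sum>j\<in>insert i J. a j * c j) \<partial>cauchy_PiM (insert i J)) =
     (\<integral>\<^sup>+y. (\<integral>\<^sup>+c. f (\<Sum>j\<in>insert i J. a j * (c(i := y)) j) \<partial>cauchy_PiM J) \<partial>std_cauchy)"
  proof (rule product_nn_integral_insert_rev[OF insert.hyps(1,2)])
    have "(\<lambda>c. \<Sum>j\<in>insert i J. a j * c j) \<in> borel_measurable (cauchy_PiM (insert i J))"
      by (intro borel_measurable_sum borel_measurable_times measurable_cauchy_component) auto
    thus "(\<lambda>c. f (\<Sum>j\<in>insert i J. a j * c j)) \<in> borel_measurable (cauchy_PiM (insert i J))"
      by measurable
  qed
  also have "\<dots> = (\<integral>\<^sup>+y. (\<integral>\<^sup>+c. f (a i * y + (\<Sum>j\<in>J. a j * c j)) \<partial>cauchy_PiM J) \<partial>std_cauchy)"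
    using insert.hyps by (intro nn_integral_cong arg_cong[of _ _ f]) (auto intro!: sum.cong)
  also have "\<dots> = (\<integral>\<^sup>+y. (\<integral>\<^sup>+x. f (a i * y + (\<Sum>j\<in>J. \<bar>a j\<bar>) * x) \<partial>std_cauchy) \<partial>std_cauchy)"
    \<comment> \<open>The induction hypothesis is applied to the translate of \<open>f\<close> by
      \<open>a i * y\<close>, hence the generalisation over \<open>f\<close>.\<close>
    by (intro nn_integral_cong insert.IH[where f = "\<lambda>z. f (_ + z)"]) measurable
  also have "\<dots> = (\<integral>\<^sup>+z. f ((\<bar>a i\<bar> + (\<Sum>j\<in>J. \<bar>a j\<bar>)) * z) \<partial>std_cauchy)"
    by (rule std_cauchy_add_abs) (auto simp: sum_nonneg)
  finally show ?case using insert.hyps by simp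
qed

lemma measurable_cauchy_sum:
  "I \<subseteq> J \<Longrightarrow> (\<lambda>c. \<Sum>i\<in>I. a i * c i) \<in> borel_measurable (cauchy_PiM J)"
  by (intro borel_measurable_sum borel_measurable_times measurable_cauchy_component) auto

text \<open>Indices outside \<open>I\<close> receive weight 0, which leaves the scale unchanged;
  thus the sums of all buckets live on one product space.\<close>

lemma nn_integral_cauchy_sum_subset:
  fixes f :: "real \<Rightarrow> ennreal"
  assumes J: "finite J" and I: "I \<subseteq> J" and f: "f \<in> borel_measurable borel"
  shows "(\<integral>\<^sup>+c. f (\<Sum>i\<in>I. a i * c i) \<partial>cauchy_PiM J) = (\<integral>\<^sup>+z. f ((\<Sum>i\<in>I. \<bar>a i\<bar>) * z) \<partial>std_cauchy)"
proof -
  have "(\<Sum>i\<in>I. a i * c i) = (\<Sum>i\<in>J. (if i \<in> I then a i else 0) * c i)" for c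
    using J I by (intro sum.mono_neutral_cong_left) auto
  moreover have "(\<Sum>i\<in>I. \<bar>a i\<bar>) = (\<Sum>i\<in>J. \<bar>if i \<in> I then a i else 0\<bar>)"
    using J I by (intro sum.mono_neutral_cong_left) auto
  ultimately show ?thesis
    using nn_integral_cauchy_sum[OF J f, of "\<lambda>i. if i \<in> I then a i else 0"] by simp
qed

lemma measure_cauchy_sum:
  assumes J: "finite J" and I: "I \<subseteq> J" and B[measurable]: "B \<in> sets borel"
  shows "measure (cauchy_PiM J) {c \<in> space (cauchy_PiM J). (\<Sum>i\<in>I. a i * c i) \<in> B} =
    measure std_cauchy {z. (\<Sum>i\<in>I. \<bar>a i\<bar>) * z \<in> B}"
proof -
  have [measurable]: "(\<lambda>c. \<Sum>i\<in>I. a i * c i) \<in> borel_measurable (cauchy_PiM J)"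
    using I by (rule measurable_cauchy_sum)
  have "emeasure (cauchy_PiM J) {c \<in> space (cauchy_PiM J). (\<Sum>i\<in>I. a i * c i) \<in> B} =
     (\<integral>\<^sup>+c. indicator {c \<in> space (cauchy_PiM J). (\<Sum>i\<in>I. a i * c i) \<in> B} c \<partial>cauchy_PiM J)"
    by (rule nn_integral_indicator[symmetric]) measurable
  also have "\<dots> = (\<integral>\<^sup>+c. indicator B (\<Sum>i\<in>I. a i * c i) \<partial>cauchy_PiM J)"
    by (intro nn_integral_cong) (auto simp: indicator_def)
  also have "\<dots> = (\<integral>\<^sup>+z. indicator B ((\<Sum>i\<in>I. \<bar>a i\<bar>) * z) \<partial>std_cauchy)"
    by (rule nn_integral_cauchy_sum_subset[OF J I]) measurable
  also have "\<dots> = (\<integral>\<^sup>+z. indicator {z. (\<Sum>i\<in>I. \<bar>a i\<bar>) * z \<in> B} z \<partial>std_cauchy)"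
    by (intro nn_integral_cong) (auto simp: indicator_def)
  also have "\<dots> = emeasure std_cauchy {z. (\<Sum>i\<in>I. \<bar>a i\<bar>) * z \<in> B}"
    by (rule nn_integral_indicator) measurable
  finally show ?thesis by (simp add: measure_def)
qed

lemma measure_cauchy_component:
  assumes J: "finite J" and i: "i \<in> J" and B: "B \<in> sets borel"
  shows "measure (cauchy_PiM J) {c \<in> space (cauchy_PiM J). c i \<in> B} = measure std_cauchy B"
  using measure_cauchy_sum[OF J, of "{i}" B "\<lambda>_. 1"] i B by simp

lemma prob_Markov:
  assumes "prob_space M" and X[measurable]: "X \<in> borel_measurable M" and X0: "\<And>x. X x \<ge> 0"
    and E: "(\<integral>\<^sup>+x. ennreal (X x) \<partial>M) \<le> ennreal e" and "e \<ge> 0" and r: "r > 0"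
  shows "measure M {x \<in> space M. X x \<ge> r} \<le> e / r"
proof -
  interpret prob_space M by fact
  have "emeasure M {x \<in> space M. 1 \<le> ennreal (1 / r) * ennreal (X x)} \<le>
      ennreal (1 / r) * (\<integral>\<^sup>+x. ennreal (X x) * indicator (space M) x \<partial>M)"
    by (rule nn_integral_Markov_inequality) auto
  also have "(\<integral>\<^sup>+x. ennreal (X x) * indicator (space M) x \<partial>M) = (\<integral>\<^sup>+x. ennreal (X x) \<partial>M)"
    by (intro nn_integral_cong) auto
  also have "ennreal (1 / r) * \<dots> \<le> ennreal (1 / r) * ennreal e"
    by (intro mult_left_mono E) auto
  also have "\<dots> = ennreal (e / r)"
    using assms by (simp add: ennreal_mult'[symmetric])
  also have "{x \<in> space M. 1 \<le> ennreal (1 / r) * ennreal (X x)} = {x \<in> space M. X x \<ge> r}"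
  proof -
    have "1 \<le> ennreal (1 / r) * ennreal (X x) \<longleftrightarrow> X x \<ge> r" for x
    proof -
      have "ennreal (1 / r) * ennreal (X x) = ennreal (X x / r)"
        using r X0 by (simp add: ennreal_mult'[symmetric])
      thus ?thesis using r X0[of x] by (simp add: ennreal_le_iff2 ennreal_1[symmetric] le_divide_eq del: ennreal_1)
    qed
    thus ?thesis by simp
  qed
  finally show ?thesis
    using assms by (simp add: emeasure_eq_measure)
qed

text \<open>
  Each sum is truncated at a fixed multiple of its own scale; a Cauchy variable of scale
  \<open>\<gamma>\<close> truncated at \<open>R \<gamma>\<close> has mean of order \<open>\<gamma> ln R\<close>.
\<close>

lemma cauchy_sums_upper_tail:
  fixes b :: "'q \<Rightarrow> 'i \<Rightarrow> real"
  assumes J: "finite J" and Q: "finite Q" and I: "\<And>q. q \<in> Q \<Longrightarrow> I q \<subseteq> J"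
    and m: "real (card Q) \<le> m" "m \<ge> 1" and t: "t \<ge> 8 * ln (1 + 64 * m\<^sup>2)"
  shows "measure (cauchy_PiM J) {c \<in> space (cauchy_PiM J).
     (\<Sum>q\<in>Q. \<bar>\<Sum>i\<in>I q. b q i * c i\<bar>) > t * (\<Sum>q\<in>Q. \<Sum>i\<in>I q. \<bar>b q i\<bar>)} \<le> 1 / 4"
proof -
  let ?P = "cauchy_PiM J"
  interpret prob_space ?P by (rule prob_space_cauchy_PiM)
  interpret std: prob_space std_cauchy by (rule prob_space_std_cauchy)
  define Y where "Y q c = (\<Sum>i\<in>I q. b q i * c i)" for q c
  define g where "g q = (\<Sum>i\<in>I q. \<bar>b q i\<bar>)" for q
  define G where "G = (\<Sum>q\<in>Q. g q)"
  \<comment> \<open>Each of at most \<open>m\<close> sums exceeds \<open>R\<close> times its scale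
    with probability at most \<open>1 / R\<close>, so this choice makes the union bound 1/8;
    \<open>R\<^sup>2\<close> is the \<open>64 * m\<^sup>2\<close> in the condition on
    \<open>t\<close>.\<close>
  define R where "R = 8 * m"
  define L where "L = ln (1 + R\<^sup>2)"
  have R: "R > 0" using m by (simp add: R_def)
  have L: "L > 0" using zero_less_power[OF R, of 2] unfolding L_def by (intro ln_gt_zero) linarith
  have tL: "t \<ge> 8 * L" using t unfolding L_def R_def by (simp add: power2_eq_square)
  have t0: "t > 0" using L tL by simp
  have g0: "g q \<ge> 0" for q by (simp add: g_def sum_nonneg)
  have G0: "G \<ge> 0" by (simp add: G_def g0 sum_nonneg)
  have [measurable]: "Y q \<in> borel_measurable ?P" if "q \<in> Q" for q
    unfolding Y_def using I[OF that] by (rule measurable_cauchy_sum)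
  \<comment> \<open>The sums may be dependent, as are those of different columns in one bucket;
    \<open>T\<close> is controlled through linearity of expectation.\<close>
  define T where "T c = (\<Sum>q\<in>Q. if \<bar>Y q c\<bar> \<le> R * g q then \<bar>Y q c\<bar> else 0)" for c
  have T0: "T c \<ge> 0" for c unfolding T_def by (intro sum_nonneg) auto
  have [measurable]: "T \<in> borel_measurable ?P"
    unfolding T_def by (intro borel_measurable_sum) measurable
  have bad1: "prob {c \<in> space ?P. \<bar>Y q c\<bar> > R * g q} \<le> 1 / R" if q: "q \<in> Q" for q
  proof -
    have "prob {c \<in> space ?P. \<bar>Y q c\<bar> > R * g q} = prob {c \<in> space ?P. Y q c \<in> {z. \<bar>z\<bar> > R * g q}}"
      by simp
    also have "\<dots> = measure std_cauchy {z. g q * z \<in> {z. \<bar>z\<bar> > R * g q}}"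
      unfolding Y_def g_def by (rule measure_cauchy_sum[OF J I[OF q]]) measurable
    also have "\<dots> \<le> measure std_cauchy {z. \<bar>z\<bar> > R}"
    proof (rule std.finite_measure_mono)
      have "\<bar>z\<bar> > R" if "\<bar>g q * z\<bar> > R * g q" for z
      proof (rule ccontr)
        assume "\<not> \<bar>z\<bar> > R"
        hence "\<bar>g q * z\<bar> \<le> g q * R" using g0[of q] by (simp add: abs_mult mult_left_mono)
        thus False using that by (simp add: mult.commute)
      qed
      thus "{z. g q * z \<in> {z. \<bar>z\<bar> > R * g q}} \<subseteq> {z. \<bar>z\<bar> > R}" by auto
      show "{z. \<bar>z\<bar> > R} \<in> sets std_cauchy" by simp
    qed
    also have "\<dots> \<le> 1 / R" using R by (rule measure_std_cauchy_gt)
    finally show ?thesis .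
  qed
  have ET: "(\<integral>\<^sup>+c. ennreal (T c) \<partial>?P) \<le> ennreal (G * L)"
  proof -
    have "(\<integral>\<^sup>+c. ennreal (T c) \<partial>?P) = (\<integral>\<^sup>+c. (\<Sum>q\<in>Q. ennreal (if \<bar>Y q c\<bar> \<le> R * g q then \<bar>Y q c\<bar> else 0)) \<partial>?P)"
      unfolding T_def by (intro nn_integral_cong sum_ennreal[symmetric]) auto
    also have "\<dots> = (\<Sum>q\<in>Q. \<integral>\<^sup>+c. ennreal (if \<bar>Y q c\<bar> \<le> R * g q then \<bar>Y q c\<bar> else 0) \<partial>?P)"
      by (intro nn_integral_sum) measurable
    also have "\<dots> \<le> (\<Sum>q\<in>Q. ennreal (g q * L))"
    proof (intro sum_mono)
      fix q assume q: "q \<in> Q"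
      have "(\<integral>\<^sup>+c. ennreal (if \<bar>Y q c\<bar> \<le> R * g q then \<bar>Y q c\<bar> else 0) \<partial>?P) =
          (\<integral>\<^sup>+z. ennreal (if \<bar>g q * z\<bar> \<le> R * g q then \<bar>g q * z\<bar> else 0) \<partial>std_cauchy)"
        using nn_integral_cauchy_sum_subset[OF J I[OF q], of "\<lambda>y. ennreal (if \<bar>y\<bar> \<le> R * g q then \<bar>y\<bar> else 0)" "b q"]
        by (simp only: Y_def[symmetric] g_def[symmetric]) simp
      also have "\<dots> \<le> (\<integral>\<^sup>+z. ennreal (g q) * (ennreal \<bar>z\<bar> * indicator {-R..R} z) \<partial>std_cauchy)"
      proof (intro nn_integral_mono)
        fix z
        show "ennreal (if \<bar>g q * z\<bar> \<le> R * g q then \<bar>g q * z\<bar> else 0) \<le>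
            ennreal (g q) * (ennreal \<bar>z\<bar> * indicator {-R..R} z)"
        proof (cases "g q = 0")
          case False
          hence "g q > 0" using g0[of q] by simp
          hence "g q * \<bar>z\<bar> \<le> g q * R \<longleftrightarrow> \<bar>z\<bar> \<le> R"
            by (rule mult_le_cancel_left_pos)
          hence iff: "\<bar>g q * z\<bar> \<le> R * g q \<longleftrightarrow> \<bar>z\<bar> \<le> R"
            using g0[of q] by (simp add: abs_mult mult.commute)
          show ?thesis
          proof (cases "\<bar>z\<bar> \<le> R")
            case True
            hence "z \<in> {-R..R}" by auto
            thus ?thesis using True iff g0[of q] by (simp add: abs_mult ennreal_mult' del: atLeastAtMost_iff)
          next
            case False
            thus ?thesis using iff by simp
          qed
        qed simp
      qed
      also have "\<dots> = ennreal (g q) * (\<integral>\<^sup>+z. ennreal \<bar>z\<bar> * indicator {-R..R} z \<partial>std_cauchy)"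
        by (rule nn_integral_cmult) measurable
      also have "\<dots> \<le> ennreal (g q) * ennreal L"
        unfolding L_def using R by (intro mult_left_mono std_cauchy_truncated_moment) auto
      finally show "(\<integral>\<^sup>+c. ennreal (if \<bar>Y q c\<bar> \<le> R * g q then \<bar>Y q c\<bar> else 0) \<partial>?P) \<le> ennreal (g q * L)"
        using g0 L by (simp add: ennreal_mult')
    qed
    also have "\<dots> = ennreal (G * L)"
      unfolding G_def using g0 L by (simp add: sum_distrib_right)
    finally show ?thesis .
  qed
  have bad2: "prob {c \<in> space ?P. T c > t * G} \<le> 1 / 8"
  proof (cases "G = 0")
    case True
    hence "g q = 0" if "q \<in> Q" for q
      using that Q g0 unfolding G_def by (simp add: sum_nonneg_eq_0_iff)
    hence "T c = 0" for c unfolding T_def by (intro sum.neutral) (auto split: if_splits)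
    thus ?thesis using True by simp
  next
    case False
    hence G: "G > 0" using G0 by simp
    have "prob {c \<in> space ?P. T c > t * G} \<le> prob {c \<in> space ?P. T c \<ge> t * G}"
      by (intro finite_measure_mono) auto
    also have "\<dots> \<le> G * L / (t * G)"
      using G L t0 by (intro prob_Markov[OF prob_space_axioms _ T0 ET]) auto
    also have "\<dots> \<le> 1 / 8" using G L tL t0 by (simp add: field_simps)
    finally show ?thesis .
  qed
  have ev1: "{c \<in> space ?P. \<bar>Y q c\<bar> > R * g q} \<in> events" if "q \<in> Q" for q
    using that by measurable
  hence ev1': "(\<Union>q\<in>Q. {c \<in> space ?P. \<bar>Y q c\<bar> > R * g q}) \<in> events"
    using Q by (intro sets.finite_UN) auto
  have ev2: "{c \<in> space ?P. T c > t * G} \<in> events" by measurable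
  have "prob {c \<in> space ?P. (\<Sum>q\<in>Q. \<bar>Y q c\<bar>) > t * G} \<le>
     prob ((\<Union>q\<in>Q. {c \<in> space ?P. \<bar>Y q c\<bar> > R * g q}) \<union> {c \<in> space ?P. T c > t * G})"
  proof (rule finite_measure_mono)
    \<comment> \<open>Away from the exceedance events the truncation does nothing.\<close>
    have "T c = (\<Sum>q\<in>Q. \<bar>Y q c\<bar>)" if "\<forall>q\<in>Q. \<not> \<bar>Y q c\<bar> > R * g q" for c
      unfolding T_def using that by (intro sum.cong) auto
    thus "{c \<in> space ?P. (\<Sum>q\<in>Q. \<bar>Y q c\<bar>) > t * G} \<subseteq>
       (\<Union>q\<in>Q. {c \<in> space ?P. \<bar>Y q c\<bar> > R * g q}) \<union> {c \<in> space ?P. T c > t * G}"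
      by auto
    show "(\<Union>q\<in>Q. {c \<in> space ?P. \<bar>Y q c\<bar> > R * g q}) \<union> {c \<in> space ?P. T c > t * G} \<in> events"
      using ev1' ev2 by (rule sets.Un)
  qed
  also have "\<dots> \<le> prob (\<Union>q\<in>Q. {c \<in> space ?P. \<bar>Y q c\<bar> > R * g q}) + prob {c \<in> space ?P. T c > t * G}"
    by (intro measure_Un_le ev1' ev2)
  also have "prob (\<Union>q\<in>Q. {c \<in> space ?P. \<bar>Y q c\<bar> > R * g q}) \<le> (\<Sum>q\<in>Q. prob {c \<in> space ?P. \<bar>Y q c\<bar> > R * g q})"
    using Q ev1 by (intro finite_measure_subadditive_finite) auto
  also have "\<dots> \<le> (\<Sum>q\<in>Q. 1 / R)" by (intro sum_mono bad1)
  also have "\<dots> \<le> 1 / 8" using m by (simp add: R_def field_simps)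
  finally show ?thesis using bad2 unfolding Y_def g_def G_def by simp
qed

section \<open>Lower tails for sums over disjoint blocks\<close>

lemma indep_vars_cauchy_PiM:
  assumes "finite J"
  shows "prob_space.indep_vars (cauchy_PiM J) (\<lambda>_. std_cauchy) (\<lambda>i c. c i) J"
proof (cases "J = {}")
  case True
  interpret prob_space "cauchy_PiM J" by (rule prob_space_cauchy_PiM)
  show ?thesis unfolding indep_vars_def indep_sets_def using True by auto
next
  case False
  interpret prob_space "cauchy_PiM J" by (rule prob_space_cauchy_PiM)
  have "distr (cauchy_PiM J) (cauchy_PiM J) (\<lambda>c. \<lambda>i\<in>J. c i) = distr (cauchy_PiM J) (cauchy_PiM J) (\<lambda>c. c)"
    by (intro distr_cong) (auto simp: space_PiM PiE_def extensional_restrict)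
  also have "\<dots> = cauchy_PiM J" by (rule distr_id)
  also have "\<dots> = (\<Pi>\<^sub>M i\<in>J. distr (cauchy_PiM J) std_cauchy (\<lambda>c. c i))"
    by (intro PiM_cong refl distr_PiM_component[symmetric] prob_space_std_cauchy)
  finally show ?thesis
    using False by (subst indep_vars_iff_distr_eq_PiM') auto
qed

text \<open>Exponential moments at rate \<open>1 / g\<close>: no block has scale above
  \<open>g\<close>, so the Laplace bound applies to each, and independence of disjoint blocks
  multiplies the bounds to \<open>exp (- G / (8 * g))\<close>. Markov's inequality at level
  \<open>G / 16\<close> gives back half of the exponent. The finer the mass is spread over the
  blocks, the smaller the failure probability.\<close>

lemma cauchy_block_sums_lower_tail:
  fixes y :: "'i \<Rightarrow> real"
  assumes J: "finite J" and K: "finite K" and I: "\<And>k. k \<in> K \<Longrightarrow> I k \<subseteq> J"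
    and disj: "disjoint_family_on I K"
    and g: "g > 0" "\<And>k. k \<in> K \<Longrightarrow> (\<Sum>i\<in>I k. \<bar>y i\<bar>) \<le> g"
    and G: "G \<le> (\<Sum>k\<in>K. \<Sum>i\<in>I k. \<bar>y i\<bar>)"
  shows "measure (cauchy_PiM J) {c \<in> space (cauchy_PiM J).
     (\<Sum>k\<in>K. \<bar>\<Sum>i\<in>I k. y i * c i\<bar>) \<le> G / 16} \<le> exp (- G / (16 * g))"
proof -
  let ?P = "cauchy_PiM J"
  interpret prob_space ?P by (rule prob_space_cauchy_PiM)
  define Y where "Y k c = (\<Sum>i\<in>I k. y i * c i)" for k c
  define s where "s k = (\<Sum>i\<in>I k. \<bar>y i\<bar>)" for k
  have s0: "s k \<ge> 0" for k by (simp add: s_def sum_nonneg)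
  have Ym: "Y k \<in> borel_measurable ?P" if "k \<in> K" for k
    unfolding Y_def using I[OF that] by (rule measurable_cauchy_sum)
  have "indep_vars (\<lambda>k. PiM (I k) (\<lambda>_. std_cauchy)) (\<lambda>k c. restrict (\<lambda>i. c i) (I k)) K"
    by (rule indep_vars_restrict[OF indep_vars_cauchy_PiM[OF J] I disj])
  hence "indep_vars (\<lambda>_. borel) (\<lambda>k c. (\<lambda>d. ennreal (exp (- \<bar>\<Sum>i\<in>I k. y i * d i\<bar> / g))) (restrict (\<lambda>i. c i) (I k))) K"
  proof (rule indep_vars_compose2)
    fix k
    have [measurable]: "(\<lambda>d. \<Sum>i\<in>I k. y i * d i) \<in> borel_measurable (cauchy_PiM (I k))"
      by (rule measurable_cauchy_sum) simp
    show "(\<lambda>d. ennreal (exp (- \<bar>\<Sum>i\<in>I k. y i * d i\<bar> / g))) \<in> borel_measurable (cauchy_PiM (I k))"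
      by measurable
  qed
  hence ind: "indep_vars (\<lambda>_. borel) (\<lambda>k c. ennreal (exp (- \<bar>Y k c\<bar> / g))) K"
    unfolding Y_def by simp
  define X where "X c = exp (- (\<Sum>k\<in>K. \<bar>Y k c\<bar>) / g)" for c
  have Xm: "X \<in> borel_measurable ?P"
  proof -
    have "(\<lambda>c. \<Sum>k\<in>K. \<bar>Y k c\<bar>) \<in> borel_measurable ?P"
      using Ym by (intro borel_measurable_sum borel_measurable_abs) auto
    thus ?thesis unfolding X_def by measurable
  qed
  have "(\<integral>\<^sup>+c. ennreal (X c) \<partial>?P) = (\<integral>\<^sup>+c. (\<Prod>k\<in>K. ennreal (exp (- \<bar>Y k c\<bar> / g))) \<partial>?P)"
    unfolding X_def by (intro nn_integral_cong) (simp add: prod_ennreal exp_sum[OF K, symmetric] sum_negf sum_divide_distrib)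
  also have "\<dots> = (\<Prod>k\<in>K. \<integral>\<^sup>+c. ennreal (exp (- \<bar>Y k c\<bar> / g)) \<partial>?P)"
    by (rule indep_vars_nn_integral[OF K ind]) simp
  also have "\<dots> \<le> (\<Prod>k\<in>K. ennreal (exp (- (s k / g) / 8)))"
  proof (rule prod_mono_ennreal)
    fix k assume k: "k \<in> K"
    have "(\<integral>\<^sup>+c. ennreal (exp (- \<bar>Y k c\<bar> / g)) \<partial>?P) = (\<integral>\<^sup>+z. ennreal (exp (- \<bar>s k * z\<bar> / g)) \<partial>std_cauchy)"
      using nn_integral_cauchy_sum_subset[OF J I[OF k], of "\<lambda>z. ennreal (exp (- \<bar>z\<bar> / g))" y]
      by (simp only: Y_def[symmetric] s_def[symmetric]) simp
    also have "\<dots> = (\<integral>\<^sup>+z. ennreal (exp (- (s k / g) * \<bar>z\<bar>)) \<partial>std_cauchy)"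
      using s0[of k] by (simp add: abs_mult)
    also have "\<dots> \<le> ennreal (exp (- (s k / g) / 8))"
      using g s0[of k] k by (intro std_cauchy_laplace) (auto simp: s_def)
    finally show "(\<integral>\<^sup>+c. ennreal (exp (- \<bar>Y k c\<bar> / g)) \<partial>?P) \<le> ennreal (exp (- (s k / g) / 8))" .
  qed
  also have "\<dots> = ennreal (exp (- (\<Sum>k\<in>K. s k) / (8 * g)))"
    by (simp add: prod_ennreal exp_sum[OF K, symmetric] sum_negf sum_divide_distrib mult.commute)
  also have "\<dots> \<le> ennreal (exp (- G / (8 * g)))"
    using G g unfolding s_def by (intro ennreal_leI) (simp add: divide_right_mono)
  finally have E: "(\<integral>\<^sup>+c. ennreal (X c) \<partial>?P) \<le> ennreal (exp (- G / (8 * g)))" .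
  have "prob {c \<in> space ?P. (\<Sum>k\<in>K. \<bar>Y k c\<bar>) \<le> G / 16} = prob {c \<in> space ?P. X c \<ge> exp (- (G / 16) / g)}"
  proof -
    have "S \<le> G / 16 \<longleftrightarrow> exp (- S / g) \<ge> exp (- (G / 16) / g)" for S
      using g(1) by (simp add: field_simps)
    thus ?thesis unfolding X_def by simp
  qed
  also have "\<dots> \<le> exp (- G / (8 * g)) / exp (- (G / 16) / g)"
    by (rule prob_Markov[OF prob_space_axioms Xm _ E]) (auto simp: X_def)
  also have "\<dots> = exp (- G / (16 * g))"
    using g by (simp add: exp_diff[symmetric] field_simps)
  finally show ?thesis unfolding Y_def .
qed

section \<open>Hashing\<close>

abbreviation hash_PiM :: "nat \<Rightarrow> nat \<Rightarrow> (nat \<Rightarrow> nat) measure" where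
  "hash_PiM s n \<equiv> (\<Pi>\<^sub>M i\<in>{..<n}. uniform_count_measure {..<s})"

lemma prob_space_hash_PiM:
  assumes "s > 0"
  shows "prob_space (hash_PiM s n)"
  using assms by (intro prob_space_PiM prob_space_uniform_count_measure) auto

lemma space_hash_PiM: "space (hash_PiM s n) = ({..<n} \<rightarrow>\<^sub>E {..<s})"
  by (simp add: space_PiM space_uniform_count_measure)

lemma sets_hash_PiM: "sets (hash_PiM s n) = Pow ({..<n} \<rightarrow>\<^sub>E {..<s})"
proof -
  have "sets (hash_PiM s n) = sets (\<Pi>\<^sub>M i\<in>{..<n}. count_space {..<s})"
    by (intro sets_PiM_cong refl) (simp add: sets_uniform_count_measure)
  also have "(\<Pi>\<^sub>M i\<in>{..<n}. count_space {..<s}) = count_space ({..<n} \<rightarrow>\<^sub>E {..<s})"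
    by (rule count_space_PiM_finite) auto
  finally show ?thesis by simp
qed

lemma measurable_hash_PiM: "f \<in> borel_measurable (hash_PiM s n)"
  by (rule borel_measurableI) (auto simp: sets_hash_PiM space_hash_PiM)

text \<open>The event that both indices receive a given value \<open>k\<close> is a box of
  probability 1/s^2, and the boxes for the s values of \<open>k\<close> are disjoint.\<close>

lemma prob_hash_collision:
  assumes s: "s > 0" and ij: "i < n" "j < n" "i \<noteq> j"
  shows "emeasure (hash_PiM s n) {h \<in> space (hash_PiM s n). h i = h j} = ennreal (1 / real s)"
proof -
  let ?H = "hash_PiM s n"
  let ?u = "uniform_count_measure {..<s}"
  interpret u: prob_space ?u using s by (intro prob_space_uniform_count_measure) auto
  interpret product_sigma_finite "\<lambda>_::nat. ?u" by standard
  define B where "B k = ({..<n} \<rightarrow>\<^sub>E {..<s}) \<inter> {h. h i = k \<and> h j = k}" for k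
  have eB: "emeasure ?H (B k) = ennreal (1 / real s ^ 2)" if k: "k < s" for k
  proof -
    have "B k = (\<Pi>\<^sub>E l\<in>{..<n}. if l = i \<or> l = j then {k} else {..<s})"
    proof (rule Set.set_eqI)
      fix h
      have eq: "(\<forall>l<n. h l \<in> (if l = i \<or> l = j then {k} else {..<s})) \<longleftrightarrow> (\<forall>l<n. h l < s) \<and> h i = k \<and> h j = k"
      proof (intro iffI conjI allI impI)
        assume A: "\<forall>l<n. h l \<in> (if l = i \<or> l = j then {k} else {..<s})"
        show "h i = k" "h j = k" using A[rule_format, OF ij(1)] A[rule_format, OF ij(2)] by auto
        show "h l < s" if "l < n" for l
          using A[rule_format, OF that] k by (cases "l = i \<or> l = j") auto
      next
        fix l assume "(\<forall>l<n. h l < s) \<and> h i = k \<and> h j = k" "l < n"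
        thus "h l \<in> (if l = i \<or> l = j then {k} else {..<s})" by auto
      qed
      thus "h \<in> B k \<longleftrightarrow> h \<in> (\<Pi>\<^sub>E l\<in>{..<n}. if l = i \<or> l = j then {k} else {..<s})"
        by (simp only: B_def Int_iff PiE_iff mem_Collect_eq Ball_def lessThan_iff eq conj_ac)
    qed
    hence "emeasure ?H (B k) = (\<Prod>l\<in>{..<n}. emeasure ?u (if l = i \<or> l = j then {k} else {..<s}))"
      using k by (simp add: emeasure_PiM sets_uniform_count_measure)
    also have "\<dots> = (\<Prod>l\<in>{..<n}. ennreal (if l = i \<or> l = j then 1 / real s else 1))"
      using k s by (intro prod.cong refl) (auto simp: emeasure_uniform_count_measure)
    also have "\<dots> = (\<Prod>l\<in>{i, j}. ennreal (if l = i \<or> l = j then 1 / real s else 1))"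
      using ij by (intro prod.mono_neutral_right) auto
    also have "\<dots> = ennreal (1 / real s ^ 2)"
      using ij s by (simp add: ennreal_mult'[symmetric] power2_eq_square)
    finally show ?thesis .
  qed
  have "{h \<in> space ?H. h i = h j} = (\<Union>k\<in>{..<s}. B k)"
  proof -
    have hs: "h i < s" if "h \<in> {..<n} \<rightarrow>\<^sub>E {..<s}" for h
      using PiE_mem[OF that, of i] ij by simp
    have eq: "{h \<in> E. h i = h j} = (\<Union>k\<in>{..<s}. E \<inter> {h. h i = k \<and> h j = k})"
      if "\<And>h. h \<in> E \<Longrightarrow> h i < s" for E by (auto dest: that)
    show ?thesis unfolding B_def space_hash_PiM by (rule eq) (rule hs)
  qed
  also have "emeasure ?H \<dots> = (\<Sum>k\<in>{..<s}. emeasure ?H (B k))"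
  proof (intro sum_emeasure[symmetric])
    show "B ` {..<s} \<subseteq> sets ?H" unfolding B_def sets_hash_PiM by (intro image_subsetI PowI Int_lower1)
    have "disjoint_family_on (\<lambda>k. E \<inter> {h. h i = k \<and> h j = k}) {..<s}" for E
      by (auto simp: disjoint_family_on_def)
    thus "disjoint_family_on B {..<s}" unfolding B_def .
  qed simp
  also have "\<dots> = (\<Sum>k\<in>{..<s}. ennreal (1 / real s ^ 2))"
    by (intro sum.cong refl eB) simp
  also have "\<dots> = ennreal (1 / real s)"
    using s by (simp add: ennreal_of_nat_eq_real_of_nat ennreal_mult'[symmetric] power2_eq_square)
  finally show ?thesis .
qed

text \<open>The weighted number of collisions has mean at most 1/2, so Markov's inequality applies
  at level 1. General weights allow several kinds of bad collisions to be charged to a single sum in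
  which every failure costs at least 1.\<close>

lemma hash_weighted_collisions:
  fixes v :: "nat \<Rightarrow> nat \<Rightarrow> real"
  assumes s: "s > 0" and v: "\<And>i j. v i j \<ge> 0"
    and total: "2 * (\<Sum>i<n. \<Sum>j<n. v i j) \<le> real s"
  shows "measure (hash_PiM s n) {h \<in> space (hash_PiM s n).
    (\<Sum>i<n. \<Sum>j<n. if i \<noteq> j \<and> h i = h j then v i j else 0) < 1} \<ge> 1 / 2"
proof -
  let ?H = "hash_PiM s n"
  interpret prob_space ?H using s by (rule prob_space_hash_PiM)
  have all: "A \<in> events" if "A \<subseteq> space ?H" for A
    using that by (simp add: sets_hash_PiM space_hash_PiM)
  define Z where "Z h = (\<Sum>i<n. \<Sum>j<n. if i \<noteq> j \<and> h i = h j then v i j else 0)" for h :: "nat \<Rightarrow> nat"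
  have Z0: "Z h \<ge> 0" for h unfolding Z_def using v by (intro sum_nonneg) auto
  have "(\<integral>\<^sup>+h. ennreal (Z h) \<partial>?H) = (\<integral>\<^sup>+h. (\<Sum>i<n. \<Sum>j<n. ennreal (if i \<noteq> j \<and> h i = h j then v i j else 0)) \<partial>?H)"
    unfolding Z_def using v by (intro nn_integral_cong) (simp add: sum_ennreal sum_nonneg)
  also have "\<dots> = (\<Sum>i<n. \<Sum>j<n. \<integral>\<^sup>+h. ennreal (if i \<noteq> j \<and> h i = h j then v i j else 0) \<partial>?H)"
    by (subst nn_integral_sum, rule measurable_hash_PiM, intro sum.cong refl nn_integral_sum measurable_hash_PiM)
  also have "\<dots> \<le> (\<Sum>i<n. \<Sum>j<n. ennreal (v i j / real s))"
  proof (intro sum_mono)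
    fix i j assume ij: "i \<in> {..<n}" "j \<in> {..<n}"
    show "(\<integral>\<^sup>+h. ennreal (if i \<noteq> j \<and> h i = h j then v i j else 0) \<partial>?H) \<le> ennreal (v i j / real s)"
    proof (cases "i = j")
      case False
      have "(\<integral>\<^sup>+h. ennreal (if i \<noteq> j \<and> h i = h j then v i j else 0) \<partial>?H) =
        (\<integral>\<^sup>+h. ennreal (v i j) * indicator {h \<in> space ?H. h i = h j} h \<partial>?H)"
        using False by (intro nn_integral_cong) (auto simp: indicator_def)
      also have "\<dots> = ennreal (v i j) * ennreal (1 / real s)"
        using ij False s by (subst nn_integral_cmult_indicator) (auto simp: prob_hash_collision intro!: all)
      also have "\<dots> = ennreal (v i j / real s)"
        using v by (simp add: ennreal_mult'[symmetric])
      finally show ?thesis by simp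
    qed simp
  qed
  also have "\<dots> = ennreal ((\<Sum>i<n. \<Sum>j<n. v i j) / real s)"
    using v s by (simp add: sum_nonneg sum_divide_distrib)
  also have "\<dots> \<le> ennreal (1 / 2)"
    using total s by (intro ennreal_leI) (simp add: field_simps)
  finally have "prob {h \<in> space ?H. Z h \<ge> 1} \<le> 1 / 2 / 1"
    by (intro prob_Markov[OF prob_space_axioms measurable_hash_PiM Z0]) auto
  moreover have "prob {h \<in> space ?H. Z h < 1} = 1 - prob {h \<in> space ?H. Z h \<ge> 1}"
    using prob_neg[of "\<lambda>h. Z h \<ge> 1"] by (simp add: all not_le)
  ultimately show ?thesis unfolding Z_def by simp
qed

text \<open>\<open>w\<close> will be the row weights of the basis. The clauses serve three purposes:
  a heavy coordinate can be read off its own bucket, the noise added to it there is small, and the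
  scale of a light bucket is small enough for the exponential moment bound.\<close>

definition good_hash :: "nat \<Rightarrow> (nat \<Rightarrow> real) \<Rightarrow> real \<Rightarrow> real \<Rightarrow> (nat \<Rightarrow> nat) \<Rightarrow> bool" where
  "good_hash n w \<tau> \<beta> h \<longleftrightarrow>
     inj_on h {i. i < n \<and> w i > \<tau>} \<and>
     (\<Sum>j | j < n \<and> w j \<le> \<tau> \<and> h j \<in> h ` {i. i < n \<and> w i > \<tau>}. w j) \<le> \<beta> \<and>
     (\<forall>k. (\<Sum>j | j < n \<and> w j \<le> \<tau> \<and> h j = k. w j) \<le> 2 * \<tau>)"

lemma card_heavy_le:
  fixes w :: "nat \<Rightarrow> real"
  assumes w: "\<And>i. w i \<ge> 0" and b: "(\<Sum>i<n. w i) \<le> b" and \<tau>: "\<tau> > 0"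
  shows "real (card {i. i < n \<and> w i > \<tau>}) \<le> b / \<tau>"
proof -
  have "real (card {i. i < n \<and> w i > \<tau>}) * \<tau> = (\<Sum>i | i < n \<and> w i > \<tau>. \<tau>)" by simp
  also have "\<dots> \<le> (\<Sum>i | i < n \<and> w i > \<tau>. w i)" by (intro sum_mono) auto
  also have "\<dots> \<le> (\<Sum>i<n. w i)" using w by (intro sum_mono2) auto
  finally show ?thesis using b \<tau> by (simp add: field_simps)
qed

text \<open>The weights \<open>v\<close> price the three failures: a heavy pair costs 1, a light row
  beside a heavy one its share of the budget \<open>\<beta>\<close>, and a light pair
  \<open>w i * w j / (2 * \<tau>\<^sup>2)\<close>, so that an overfull light bucket costs more than
  1 in total.\<close>

lemma few_collisions_imp_good_hash:
  fixes w :: "nat \<Rightarrow> real"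
  assumes w: "\<And>i. w i \<ge> 0" and \<tau>: "\<tau> > 0" and \<beta>: "\<beta> > 0"
  defines "v \<equiv> \<lambda>i j. if w i > \<tau> then (if w j > \<tau> then 1 else w j / \<beta>) else (if w j > \<tau> then 0 else w i * w j / (2 * \<tau>\<^sup>2))"
  assumes Z: "(\<Sum>i<n. \<Sum>j<n. if i \<noteq> j \<and> h i = h j then v i j else 0) < 1"
  shows "good_hash n w \<tau> \<beta> h"
proof -
  define u where "u i j = (if i \<noteq> j \<and> h i = h j then v i j else 0)" for i j
  have v0: "v i j \<ge> 0" for i j unfolding v_def using w \<tau> \<beta> by simp
  hence u0: "u i j \<ge> 0" for i j unfolding u_def by simp
  have Z': "(\<Sum>p\<in>{..<n}\<times>{..<n}. u (fst p) (snd p)) < 1"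
    using Z unfolding u_def by (simp add: sum.cartesian_product case_prod_beta)
  have sub: "(\<Sum>p\<in>S. u (fst p) (snd p)) < 1" if "S \<subseteq> {..<n}\<times>{..<n}" for S
    by (rule le_less_trans[OF sum_mono2 Z']) (use that u0 in auto)
  have 1: "inj_on h {i. i < n \<and> w i > \<tau>}"
  proof (rule inj_onI, rule ccontr)
    fix i j assume ij: "i \<in> {i. i < n \<and> w i > \<tau>}" "j \<in> {i. i < n \<and> w i > \<tau>}" "h i = h j" "i \<noteq> j"
    have "(\<Sum>p\<in>{(i, j)}. u (fst p) (snd p)) < 1" using ij by (intro sub) auto
    thus False using ij by (simp add: u_def v_def)
  qed
  have 2: "(\<Sum>j | j < n \<and> w j \<le> \<tau> \<and> h j \<in> h ` {i. i < n \<and> w i > \<tau>}. w j) \<le> \<beta>"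
  proof -
    let ?L = "{j. j < n \<and> w j \<le> \<tau> \<and> h j \<in> h ` {i. i < n \<and> w i > \<tau>}}"
    \<comment> \<open>One heavy companion \<open>f j\<close> is chosen for each light
      \<open>j\<close>, so that the pairs \<open>(f j, j)\<close> are distinct and each light weight
      is charged once.\<close>
    have "\<forall>j\<in>?L. \<exists>i. i < n \<and> w i > \<tau> \<and> h i = h j" by auto
    then obtain f where "\<forall>j\<in>?L. f j < n \<and> w (f j) > \<tau> \<and> h (f j) = h j"
      by (rule bchoice[THEN exE])
    hence f: "f j < n \<and> w (f j) > \<tau> \<and> h (f j) = h j" if "j \<in> ?L" for j
      using that by blast
    have "(\<Sum>j\<in>?L. w j / \<beta>) = (\<Sum>j\<in>?L. u (f j) j)"
    proof (intro sum.cong refl)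
      fix j assume j: "j \<in> ?L"
      hence "f j \<noteq> j" using f[OF j] by auto
      thus "w j / \<beta> = u (f j) j" using f[OF j] j by (simp add: u_def v_def)
    qed
    also have "\<dots> = (\<Sum>p\<in>(\<lambda>j. (f j, j)) ` ?L. u (fst p) (snd p))"
      by (subst sum.reindex) (auto simp: inj_on_def)
    also have "\<dots> < 1" using f by (intro sub) auto
    finally show ?thesis using \<beta> by (simp add: sum_divide_distrib[symmetric])
  qed
  have 3: "(\<Sum>j | j < n \<and> w j \<le> \<tau> \<and> h j = k. w j) \<le> 2 * \<tau>" for k
  proof (rule ccontr)
    let ?L = "{j. j < n \<and> w j \<le> \<tau> \<and> h j = k}"
    define W where "W = (\<Sum>j\<in>?L. w j)"
    assume "\<not> (\<Sum>j\<in>?L. w j) \<le> 2 * \<tau>"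
    hence W: "W > 2 * \<tau>" by (simp add: W_def)
    have "(\<Sum>i\<in>?L. \<Sum>j\<in>?L. w i * w j) = W * W"
      unfolding W_def by (simp add: sum_product)
    \<comment> \<open>Off the diagonal this is the price of a light collision; on it, lightness
      gives \<open>w j * w j \<le> \<tau> * w j\<close>. The resulting
      \<open>W * W < 2 * \<tau>\<^sup>2 + \<tau> * W\<close> is impossible for
      \<open>W > 2 * \<tau>\<close>.\<close>
    moreover have "(\<Sum>i\<in>?L. \<Sum>j\<in>?L. w i * w j) \<le> (\<Sum>i\<in>?L. \<Sum>j\<in>?L. 2 * \<tau>\<^sup>2 * u i j + (if i = j then \<tau> * w j else 0))"
    proof (intro sum_mono)
      fix i j assume ij: "i \<in> ?L" "j \<in> ?L"
      show "w i * w j \<le> 2 * \<tau>\<^sup>2 * u i j + (if i = j then \<tau> * w j else 0)"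
        using ij w \<tau> by (auto simp: u_def v_def mult_right_mono)
    qed
    moreover have "\<dots> = 2 * \<tau>\<^sup>2 * (\<Sum>i\<in>?L. \<Sum>j\<in>?L. u i j) + \<tau> * W"
    proof -
      have "(\<Sum>i\<in>?L. \<Sum>j\<in>?L. (if i = j then \<tau> * w j else 0)) = \<tau> * W"
        unfolding W_def by (simp add: sum.delta sum_distrib_left)
      thus ?thesis by (simp add: sum.distrib sum_distrib_left)
    qed
    moreover have "(\<Sum>i\<in>?L. \<Sum>j\<in>?L. u i j) < 1"
      using sub[of "?L \<times> ?L"] by (simp add: sum.cartesian_product case_prod_beta subset_iff)
    hence "2 * \<tau>\<^sup>2 * (\<Sum>i\<in>?L. \<Sum>j\<in>?L. u i j) < 2 * \<tau>\<^sup>2 * 1"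
      using \<tau> by (intro mult_strict_left_mono) auto
    ultimately have "W * W < 2 * \<tau>\<^sup>2 + \<tau> * W" by simp
    moreover have "\<tau> * (2 * \<tau>) < (W - \<tau>) * W"
      using W \<tau> by (intro mult_strict_mono) auto
    ultimately show False by (simp add: power2_eq_square algebra_simps)
  qed
  show ?thesis using 1 2 3 unfolding good_hash_def by blast
qed

text \<open>With at most \<open>b / \<tau>\<close> heavy indices and total weight at most
  \<open>b\<close>, the prices sum to at most b^2/\<tau>^2 + b^2/(\<tau> \<beta>) + b^2/(2
  \<tau>^2). The hypothesis on \<open>s\<close> is twice this amount.\<close>

lemma prob_good_hash:
  fixes w :: "nat \<Rightarrow> real"
  assumes s0: "s > 0" and w: "\<And>i. w i \<ge> 0" and b: "(\<Sum>i<n. w i) \<le> b" and \<tau>: "\<tau> > 0" and \<beta>: "\<beta> > 0"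
    and s: "3 * b\<^sup>2 / \<tau>\<^sup>2 + 2 * b\<^sup>2 / (\<tau> * \<beta>) \<le> real s"
  shows "measure (hash_PiM s n) {h \<in> space (hash_PiM s n). good_hash n w \<tau> \<beta> h} \<ge> 1 / 2"
proof -
  interpret prob_space "hash_PiM s n" using s0 by (rule prob_space_hash_PiM)
  define v where "v \<equiv> \<lambda>i j. if w i > \<tau> then (if w j > \<tau> then 1 else w j / \<beta>) else (if w j > \<tau> then 0 else w i * w j / (2 * \<tau>\<^sup>2))"
  define N where "N = real (card {i. i < n \<and> w i > \<tau>})"
  define W where "W = (\<Sum>i<n. w i)"
  have N: "N \<le> b / \<tau>" "N \<ge> 0" unfolding N_def using card_heavy_le[OF w b \<tau>] by auto
  have W: "W \<le> b" "W \<ge> 0" unfolding W_def using b w by (auto simp: sum_nonneg)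
  have b0: "b \<ge> 0" using W by linarith
  have v0: "v i j \<ge> 0" for i j unfolding v_def using w \<tau> \<beta> by simp
  let ?c = "\<lambda>i. if w i > \<tau> then 1 else 0 :: real"
  have c: "(\<Sum>i<n. ?c i) = N"
  proof -
    have "{..<n} \<inter> {i. \<tau> < w i} = {i. i < n \<and> w i > \<tau>}" by auto
    thus ?thesis unfolding N_def by (simp add: sum.If_cases)
  qed
  have "(\<Sum>i<n. \<Sum>j<n. v i j) \<le> (\<Sum>i<n. \<Sum>j<n. ?c i * ?c j + ?c i * w j / \<beta> + w i * w j / (2 * \<tau>\<^sup>2))"
    using w \<beta> by (intro sum_mono) (auto simp: v_def add_nonneg_nonneg)
  also have "\<dots> = N * N + N * W / \<beta> + W * W / (2 * \<tau>\<^sup>2)"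
    unfolding W_def c[symmetric] by (simp only: sum.distrib sum_product sum_divide_distrib)
  also have "\<dots> \<le> (b / \<tau>) * (b / \<tau>) + (b / \<tau>) * b / \<beta> + b * b / (2 * \<tau>\<^sup>2)"
    using N W b0 \<tau> \<beta> by (intro add_mono mult_mono divide_right_mono) auto
  finally have "2 * (\<Sum>i<n. \<Sum>j<n. v i j) \<le> 3 * b\<^sup>2 / \<tau>\<^sup>2 + 2 * b\<^sup>2 / (\<tau> * \<beta>)"
    by (simp add: power2_eq_square)
  hence "2 * (\<Sum>i<n. \<Sum>j<n. v i j) \<le> real s" using s by simp
  hence "1 / 2 \<le> prob {h \<in> space (hash_PiM s n). (\<Sum>i<n. \<Sum>j<n. if i \<noteq> j \<and> h i = h j then v i j else 0) < 1}"
    by (intro hash_weighted_collisions s0 v0)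
  also have "\<dots> \<le> prob {h \<in> space (hash_PiM s n). good_hash n w \<tau> \<beta> h}"
  proof (rule finite_measure_mono)
    show "{h \<in> space (hash_PiM s n). (\<Sum>i<n. \<Sum>j<n. if i \<noteq> j \<and> h i = h j then v i j else 0) < 1} \<subseteq>
      {h \<in> space (hash_PiM s n). good_hash n w \<tau> \<beta> h}"
      using few_collisions_imp_good_hash[where w=w and \<tau>=\<tau> and \<beta>=\<beta> and n=n, OF w \<tau> \<beta>] unfolding v_def by blast
    show "{h \<in> space (hash_PiM s n). good_hash n w \<tau> \<beta> h} \<in> events"
      by (simp add: sets_hash_PiM space_hash_PiM subset_iff)
  qed
  finally show ?thesis .
qed

section \<open>Subspace embedding for a well-conditioned basis\<close>

text \<open>An Auerbach-type basis given by its entries. The two inequalities bracket the l1 norm of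
  a combination between the largest coordinate and \<open>b\<close> times it, so unit vectors have
  coordinates in the unit cube.\<close>

locale conditioned_basis =
  fixes n d s :: nat and U :: "nat \<Rightarrow> nat \<Rightarrow> real" and b :: real
  assumes d_pos: "d > 0" and s_pos: "s > 0" and b_pos: "b > 0"
    and total: "(\<Sum>i<n. \<Sum>j<d. \<bar>U i j\<bar>) \<le> b"
    and conditioned: "\<And>x j. j < d \<Longrightarrow> \<bar>x j\<bar> \<le> (\<Sum>i<n. \<bar>\<Sum>j<d. U i j * x j\<bar>)"
begin

definition comb :: "(nat \<Rightarrow> real) \<Rightarrow> nat \<Rightarrow> real" where
  "comb x i = (\<Sum>j<d. U i j * x j)"

definition row_weight :: "nat \<Rightarrow> real" where
  "row_weight i = (\<Sum>j<d. \<bar>U i j\<bar>)"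

text \<open>The l1 norm of the sketch of \<open>y\<close>, written bucket by bucket without
  matrices.\<close>

definition sketch_norm :: "(nat \<Rightarrow> nat) \<Rightarrow> (nat \<Rightarrow> real) \<Rightarrow> (nat \<Rightarrow> real) \<Rightarrow> real" where
  "sketch_norm h c y = (\<Sum>k<s. \<bar>\<Sum>i | i < n \<and> h i = k. y i * c i\<bar>)"

lemma row_weight_nonneg: "row_weight i \<ge> 0"
  by (simp add: row_weight_def sum_nonneg)

lemma sum_row_weight: "(\<Sum>i<n. row_weight i) \<le> b"
  using total by (simp add: row_weight_def)

lemma comb_diff: "comb (\<lambda>j. x j - x' j) i = comb x i - comb x' i"
  by (simp add: comb_def algebra_simps sum_subtractf)

lemma comb_scale: "comb (\<lambda>j. r * x j) i = r * comb x i"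
  by (simp add: comb_def sum_distrib_left mult.left_commute)

lemma abs_comb_le:
  assumes "\<And>j. j < d \<Longrightarrow> \<bar>x j\<bar> \<le> M"
  shows "\<bar>comb x i\<bar> \<le> row_weight i * M"
proof -
  have "\<bar>comb x i\<bar> \<le> (\<Sum>j<d. \<bar>U i j * x j\<bar>)" unfolding comb_def by (rule sum_abs)
  also have "\<dots> \<le> (\<Sum>j<d. \<bar>U i j\<bar> * M)"
    using assms by (intro sum_mono) (auto simp: abs_mult intro!: mult_left_mono)
  finally show ?thesis by (simp add: row_weight_def sum_distrib_right)
qed

text \<open>By the triangle inequality over the columns, the sketches of the d basis vectors control
  the sketches of all combinations simultaneously. The upper bound thus holds for every vector
  without a net.\<close>

lemma block_sums_comb_le:
  assumes x: "\<And>j. j < d \<Longrightarrow> \<bar>x j\<bar> \<le> M"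
  shows "(\<Sum>k\<in>K. \<bar>\<Sum>i\<in>I k. comb x i * c i\<bar>) \<le>
    M * (\<Sum>p\<in>K \<times> {..<d}. \<bar>\<Sum>i\<in>I (fst p). U i (snd p) * c i\<bar>)"
proof -
  have "\<bar>\<Sum>i\<in>I k. comb x i * c i\<bar> \<le> (\<Sum>j<d. M * \<bar>\<Sum>i\<in>I k. U i j * c i\<bar>)" for k
  proof -
    have "(\<Sum>i\<in>I k. comb x i * c i) = (\<Sum>i\<in>I k. \<Sum>j<d. x j * (U i j * c i))"
      by (simp add: comb_def sum_distrib_right) (simp add: mult_ac)
    also have "\<dots> = (\<Sum>j<d. x j * (\<Sum>i\<in>I k. U i j * c i))"
      by (subst sum.swap) (simp add: sum_distrib_left)
    finally have "\<bar>\<Sum>i\<in>I k. comb x i * c i\<bar> \<le> (\<Sum>j<d. \<bar>x j * (\<Sum>i\<in>I k. U i j * c i)\<bar>)"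
      by (simp only: sum_abs)
    also have "\<dots> \<le> (\<Sum>j<d. M * \<bar>\<Sum>i\<in>I k. U i j * c i\<bar>)"
      using x by (intro sum_mono) (auto simp: abs_mult intro!: mult_right_mono)
    finally show ?thesis .
  qed
  hence "(\<Sum>k\<in>K. \<bar>\<Sum>i\<in>I k. comb x i * c i\<bar>) \<le> (\<Sum>k\<in>K. \<Sum>j<d. M * \<bar>\<Sum>i\<in>I k. U i j * c i\<bar>)"
    by (intro sum_mono)
  thus ?thesis by (simp add: sum.cartesian_product case_prod_beta sum_distrib_left)
qed

lemma sum_fibres:
  fixes f :: "nat \<Rightarrow> real"
  assumes "finite K"
  shows "(\<Sum>k\<in>K. \<Sum>i | i < n \<and> P i \<and> h i = k. f i) = (\<Sum>i | i < n \<and> P i \<and> h i \<in> K. f i)"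
proof -
  have "(\<Sum>k\<in>K. \<Sum>i | i < n \<and> P i \<and> h i = k. f i) =
    (\<Sum>k\<in>K. sum f {i \<in> {i. i < n \<and> P i \<and> h i \<in> K}. h i = k})"
    by (intro sum.cong refl arg_cong[of _ _ "sum f"]) auto
  also have "\<dots> = (\<Sum>i | i < n \<and> P i \<and> h i \<in> K. f i)"
    using assms by (intro sum.group) auto
  finally show ?thesis .
qed

lemma block_total_weight:
  assumes "finite K"
  shows "(\<Sum>p\<in>K \<times> {..<d}. \<Sum>i | i < n \<and> P i \<and> h i = fst p. \<bar>U i (snd p)\<bar>) =
    (\<Sum>i | i < n \<and> P i \<and> h i \<in> K. row_weight i)"
proof -
  have "(\<Sum>p\<in>K \<times> {..<d}. \<Sum>i | i < n \<and> P i \<and> h i = fst p. \<bar>U i (snd p)\<bar>) =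
    (\<Sum>k\<in>K. \<Sum>j<d. \<Sum>i | i < n \<and> P i \<and> h i = k. \<bar>U i j\<bar>)"
    using sum.cartesian_product[where g = "\<lambda>k j. \<Sum>i | i < n \<and> P i \<and> h i = k. \<bar>U i j\<bar>" and A = K and B = "{..<d}"]
    by (simp only: case_prod_unfold)
  also have "\<dots> = (\<Sum>k\<in>K. \<Sum>i | i < n \<and> P i \<and> h i = k. row_weight i)"
    unfolding row_weight_def by (intro sum.cong refl sum.swap)
  finally show ?thesis using sum_fibres[OF assms] by simp
qed

end

text \<open>The hash function is now fixed, leaving only the Cauchy coefficients random.
  \<open>\<eta>\<close> times the \<open>b / \<tau>\<close> possible heavy rows is 1/8;
  \<open>t\<close> is the factor of the upper tail for \<open>s * d\<close> sums; \<open>q\<close>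
  makes the grid so fine that rounding changes a sketch by at most 1/256; \<open>net\<close> is the
  union bound over the grid.\<close>

locale hashed_basis = conditioned_basis +
  fixes h :: "nat \<Rightarrow> nat" and \<tau> \<beta> \<eta> t :: real and q :: nat
  assumes h: "\<And>i. i < n \<Longrightarrow> h i < s"
    and good: "good_hash n row_weight \<tau> \<beta> h"
    and \<tau>: "\<tau> > 0" and \<beta>: "\<beta> \<le> 1 / 8"
    and \<eta>: "\<eta> = \<tau> / (8 * b)" "\<eta> \<le> 1 / 64"
    and t: "t \<ge> 1" "t \<ge> 8 * ln (1 + 64 * (real s * real d)\<^sup>2)"
    and noise: "t * \<beta> \<le> \<eta> / 4"
    and q: "real q \<ge> 256 * t * b" "q > 0"
    and net: "real (2 * q + 1) ^ d * exp (- 1 / (256 * \<tau>)) \<le> 1 / 8"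
begin

definition heavy :: "nat set" where
  "heavy = {i. i < n \<and> row_weight i > \<tau>}"

abbreviation light_block :: "nat \<Rightarrow> nat set" where
  "light_block k \<equiv> {i. i < n \<and> row_weight i \<le> \<tau> \<and> h i = k}"

abbreviation block :: "nat \<Rightarrow> nat set" where
  "block k \<equiv> {i. i < n \<and> h i = k}"

definition grid :: "(nat \<Rightarrow> int) set" where
  "grid = ({..<d} \<rightarrow>\<^sub>E {- int q..int q})"

definition grid_point :: "(nat \<Rightarrow> int) \<Rightarrow> nat \<Rightarrow> real" where
  "grid_point z j = real_of_int (z j) / real q"

definition light_buckets :: "nat set" where
  "light_buckets = {..<s} - h ` heavy"

definition light_mass :: "(nat \<Rightarrow> real) \<Rightarrow> real" where
  "light_mass y = (\<Sum>k\<in>light_buckets. \<Sum>i\<in>block k. \<bar>y i\<bar>)"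

text \<open>All that is asked of the coefficients, in terms of the basis and finitely many grid
  points, so that each clause can be ensured by a tail bound or a finite union bound. In order: the
  upper bound, the noise beside heavy rows, the heavy coefficients, and the lower bound on the
  net.\<close>

definition typical :: "(nat \<Rightarrow> real) \<Rightarrow> bool" where
  "typical c \<longleftrightarrow>
     (\<Sum>p\<in>{..<s} \<times> {..<d}. \<bar>\<Sum>i\<in>block (fst p). U i (snd p) * c i\<bar>) \<le> t * b \<and>
     (\<Sum>p\<in>h ` heavy \<times> {..<d}. \<bar>\<Sum>i\<in>light_block (fst p). U i (snd p) * c i\<bar>) \<le> t * \<beta> \<and>
     (\<forall>i\<in>heavy. \<bar>c i\<bar> > \<eta>) \<and>
     (\<forall>z\<in>grid. light_mass (comb (grid_point z)) \<ge> 1 / 8 \<longrightarrow>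
        (\<Sum>k\<in>light_buckets. \<bar>\<Sum>i\<in>block k. comb (grid_point z) i * c i\<bar>) > 1 / 128)"

section \<open>Deterministic consequences of a good hash function and typical coefficients\<close>

lemma finite_heavy: "finite heavy" by (simp add: heavy_def)

lemma heavy_image: "h ` heavy \<subseteq> {..<s}"
  using h by (auto simp: heavy_def)

lemma finite_grid: "finite grid"
  unfolding grid_def by (intro finite_PiE) auto

lemma card_grid: "card grid = (2 * q + 1) ^ d"
proof -
  have "card {- int q..int q} = 2 * q + 1" by simp
  thus ?thesis unfolding grid_def by (simp add: card_PiE)
qed

lemma inj_on_heavy: "inj_on h heavy"
  using good by (simp add: good_hash_def heavy_def)

lemma light_mass_in_heavy_buckets:
  "(\<Sum>i | i < n \<and> row_weight i \<le> \<tau> \<and> h i \<in> h ` heavy. row_weight i) \<le> \<beta>"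
  using good by (simp add: good_hash_def heavy_def)

lemma light_block_weight: "(\<Sum>i\<in>light_block k. row_weight i) \<le> 2 * \<tau>"
  using good by (simp add: good_hash_def)

lemma block_light:
  assumes "k \<in> light_buckets"
  shows "block k = light_block k"
  using assms by (auto simp: light_buckets_def heavy_def not_less)

lemma typical_upper:
  assumes c: "typical c" and x: "\<And>j. j < d \<Longrightarrow> \<bar>x j\<bar> \<le> M"
  shows "sketch_norm h c (comb x) \<le> M * (t * b)"
proof -
  have "M \<ge> 0" using x[of 0] d_pos by simp
  hence "M * (\<Sum>p\<in>{..<s} \<times> {..<d}. \<bar>\<Sum>i\<in>block (fst p). U i (snd p) * c i\<bar>) \<le> M * (t * b)"
    using c unfolding typical_def by (intro mult_left_mono) auto
  thus ?thesis
    using block_sums_comb_le[where x = x and M = M and K = "{..<s}" and I = block and c = c, OF x] unfolding sketch_norm_def by linarith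
qed

text \<open>A heavy bucket holds exactly one heavy row, so its value is
  \<open>comb x i * c i\<close> plus light noise. The first parts sum to at least
  \<open>\<eta> / 2\<close>, and the noise to at most
  \<open>t * \<beta> \<le> \<eta> / 4\<close>.\<close>

lemma typical_heavy:
  assumes c: "typical c" and x: "\<And>j. j < d \<Longrightarrow> \<bar>x j\<bar> \<le> 1"
    and mass: "(\<Sum>i\<in>heavy. \<bar>comb x i\<bar>) \<ge> 1 / 2"
  shows "sketch_norm h c (comb x) \<ge> \<eta> / 4"
proof -
  let ?y = "comb x"
  have \<eta>0: "\<eta> > 0" using \<eta> \<tau> b_pos by simp
  have split: "(\<Sum>i\<in>block (h i). ?y i * c i) = ?y i * c i + (\<Sum>i\<in>light_block (h i). ?y i * c i)"
    if i: "i \<in> heavy" for i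
  proof -
    have "block (h i) = insert i (light_block (h i))"
      using i inj_on_heavy by (auto simp: heavy_def inj_on_def not_less)
    moreover have "i \<notin> light_block (h i)" using i by (auto simp: heavy_def)
    ultimately show ?thesis by simp
  qed
  have "\<eta> * (1 / 2) \<le> \<eta> * (\<Sum>i\<in>heavy. \<bar>?y i\<bar>)"
    using mass \<eta>0 by (intro mult_left_mono) auto
  also have "\<dots> \<le> (\<Sum>i\<in>heavy. \<bar>?y i * c i\<bar>)"
    unfolding sum_distrib_left
  proof (intro sum_mono)
    fix i assume "i \<in> heavy"
    hence "\<bar>c i\<bar> > \<eta>" using c by (simp add: typical_def)
    thus "\<eta> * \<bar>?y i\<bar> \<le> \<bar>?y i * c i\<bar>"
      by (simp add: abs_mult mult.commute[of \<eta>] mult_left_mono)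
  qed
  also have "\<dots> \<le> (\<Sum>i\<in>heavy. \<bar>\<Sum>i\<in>block (h i). ?y i * c i\<bar> + \<bar>\<Sum>i\<in>light_block (h i). ?y i * c i\<bar>)"
  proof (intro sum_mono)
    fix i assume "i \<in> heavy"
    from split[OF this] show "\<bar>?y i * c i\<bar> \<le> \<bar>\<Sum>i\<in>block (h i). ?y i * c i\<bar> + \<bar>\<Sum>i\<in>light_block (h i). ?y i * c i\<bar>"
      by linarith
  qed
  also have "\<dots> = (\<Sum>k\<in>h ` heavy. \<bar>\<Sum>i\<in>block k. ?y i * c i\<bar>) + (\<Sum>k\<in>h ` heavy. \<bar>\<Sum>i\<in>light_block k. ?y i * c i\<bar>)"
    by (simp add: sum.distrib sum.reindex[OF inj_on_heavy])
  also have "(\<Sum>k\<in>h ` heavy. \<bar>\<Sum>i\<in>block k. ?y i * c i\<bar>) \<le> sketch_norm h c ?y"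
    unfolding sketch_norm_def using heavy_image by (intro sum_mono2) auto
  also have "(\<Sum>k\<in>h ` heavy. \<bar>\<Sum>i\<in>light_block k. ?y i * c i\<bar>) \<le> t * \<beta>"
    using block_sums_comb_le[where x = x and M = 1 and K = "h ` heavy" and I = light_block and c = c, OF x] c unfolding typical_def by linarith
  finally show ?thesis using noise by linarith
qed

lemma sum_abs_comb_le:
  assumes "\<And>j. j < d \<Longrightarrow> \<bar>x j\<bar> \<le> M"
  shows "(\<Sum>i<n. \<bar>comb x i\<bar>) \<le> b * M"
proof -
  have M: "M \<ge> 0" using assms[of 0] d_pos by simp
  have "(\<Sum>i<n. \<bar>comb x i\<bar>) \<le> (\<Sum>i<n. row_weight i * M)"
    using assms by (intro sum_mono abs_comb_le)
  also have "\<dots> \<le> b * M" 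
    using sum_row_weight M by (simp add: sum_distrib_right[symmetric] mult_right_mono)
  finally show ?thesis .
qed

lemma light_mass_eq:
  "light_mass y = (\<Sum>i | i < n \<and> row_weight i \<le> \<tau> \<and> h i \<notin> h ` heavy. \<bar>y i\<bar>)"
proof -
  have "light_mass y = (\<Sum>k\<in>light_buckets. \<Sum>i\<in>light_block k. \<bar>y i\<bar>)"
    unfolding light_mass_def using block_light by (intro sum.cong) auto
  also have "\<dots> = (\<Sum>i | i < n \<and> row_weight i \<le> \<tau> \<and> h i \<in> light_buckets. \<bar>y i\<bar>)"
    by (rule sum_fibres) (simp add: light_buckets_def)
  also have "{i. i < n \<and> row_weight i \<le> \<tau> \<and> h i \<in> light_buckets} =
      {i. i < n \<and> row_weight i \<le> \<tau> \<and> h i \<notin> h ` heavy}"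
    using h by (auto simp: light_buckets_def)
  finally show ?thesis .
qed

lemma light_mass_diff: "light_mass y' \<ge> light_mass y - (\<Sum>i<n. \<bar>y i - y' i\<bar>)"
proof -
  let ?L = "{i. i < n \<and> row_weight i \<le> \<tau> \<and> h i \<notin> h ` heavy}"
  have "light_mass y \<le> (\<Sum>i\<in>?L. \<bar>y' i\<bar> + \<bar>y i - y' i\<bar>)"
    unfolding light_mass_eq by (intro sum_mono) linarith
  also have "\<dots> = light_mass y' + (\<Sum>i\<in>?L. \<bar>y i - y' i\<bar>)"
    by (simp add: light_mass_eq sum.distrib)
  also have "(\<Sum>i\<in>?L. \<bar>y i - y' i\<bar>) \<le> (\<Sum>i<n. \<bar>y i - y' i\<bar>)"
    by (intro sum_mono2) auto
  finally show ?thesis by simp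
qed

text \<open>Discarding the light rows in heavy buckets costs at most
  \<open>\<beta> \<le> 1 / 8\<close> of the mass, and rounding to the grid at most 1/256, so the
  grid point keeps light mass 1/8 and its sketch exceeds 1/128. The sketch of the rounding error is
  at most 1/256 by the upper bound, which leaves 1/256.\<close>

lemma typical_light:
  assumes c: "typical c" and x: "\<And>j. j < d \<Longrightarrow> \<bar>x j\<bar> \<le> 1"
    and mass: "(\<Sum>i | i < n \<and> row_weight i \<le> \<tau>. \<bar>comb x i\<bar>) \<ge> 1 / 2"
  shows "sketch_norm h c (comb x) \<ge> 1 / 256"
proof -
  \<comment> \<open>Restriction outside \<open>{..<d}\<close> makes \<open>z\<close> a member of the
    extensional function space that defines \<open>grid\<close>; the floor stays in range because
    the coordinates lie in [-1, 1].\<close>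
  define z where "z = (\<lambda>j\<in>{..<d}. \<lfloor>x j * real q\<rfloor>)"
  define x' where "x' = grid_point z"
  have q0: "real q > 0" using q by simp
  have zg: "z \<in> grid"
  proof -
    have "\<lfloor>x j * real q\<rfloor> \<in> {- int q..int q}" if "j < d" for j
    proof -
      have "\<bar>x j * real q\<bar> \<le> 1 * real q" using mult_right_mono[OF x[OF that], of "real q"] by (simp add: abs_mult)
      thus ?thesis by (auto simp: le_floor_iff floor_le_iff abs_le_iff)
    qed
    thus ?thesis by (auto simp: grid_def z_def)
  qed
  have close: "\<bar>x j - x' j\<bar> \<le> 1 / real q" if "j < d" for j
  proof -
    have "x j - x' j = (x j * real q - of_int \<lfloor>x j * real q\<rfloor>) / real q"
      using that q0 by (simp add: x'_def grid_point_def z_def field_simps)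
    moreover have "\<bar>x j * real q - of_int \<lfloor>x j * real q\<rfloor>\<bar> \<le> 1" by linarith
    ultimately show ?thesis using q0 by (simp add: abs_div divide_right_mono)
  qed
  have qt: "t * b / real q \<le> 1 / 256" using q q0 by (simp add: field_simps)
  \<comment> \<open>Since \<open>t \<ge> 1\<close>, the fineness chosen for sketches also bounds the
    rounding error of the vector itself.\<close>
  have "b * 1 \<le> b * t" using t b_pos by (intro mult_left_mono) auto
  hence qb: "b / real q \<le> 1 / 256" using qt q0 by (simp add: field_simps)
  have "light_mass (comb x) \<ge> 3 / 8"
  proof -
    let ?S = "\<Sum>i | i < n \<and> row_weight i \<le> \<tau> \<and> h i \<in> h ` heavy. \<bar>comb x i\<bar>"
    have "(\<Sum>i | i < n \<and> row_weight i \<le> \<tau>. \<bar>comb x i\<bar>) = ?S + light_mass (comb x)"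
      unfolding light_mass_eq by (subst sum.union_disjoint[symmetric]) (auto intro!: sum.cong)
    moreover have "?S \<le> (\<Sum>i | i < n \<and> row_weight i \<le> \<tau> \<and> h i \<in> h ` heavy. row_weight i)"
    proof (intro sum_mono)
      show "\<bar>comb x i\<bar> \<le> row_weight i" for i
        using abs_comb_le[where x = x and M = 1, OF x] by simp
    qed
    ultimately show ?thesis using mass light_mass_in_heavy_buckets \<beta> by linarith
  qed
  moreover have "(\<Sum>i<n. \<bar>comb x i - comb x' i\<bar>) \<le> b / real q"
    using sum_abs_comb_le[of "\<lambda>j. x j - x' j" "1 / real q"] close by (simp add: comb_diff)
  ultimately have "light_mass (comb x') \<ge> 1 / 8"
    using light_mass_diff[of "comb x" "comb x'"] qb by linarith
  hence "1 / 128 < (\<Sum>k\<in>light_buckets. \<bar>\<Sum>i\<in>block k. comb x' i * c i\<bar>)"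
    using c zg unfolding typical_def x'_def by blast
  moreover have "(\<Sum>k\<in>light_buckets. \<bar>\<Sum>i\<in>block k. comb x' i * c i\<bar>) \<le> sketch_norm h c (comb x')"
    unfolding sketch_norm_def by (intro sum_mono2) (auto simp: light_buckets_def)
  moreover have "sketch_norm h c (comb x') \<le> sketch_norm h c (comb x) + sketch_norm h c (comb (\<lambda>j. x j - x' j))"
    unfolding sketch_norm_def sum.distrib[symmetric]
  proof (intro sum_mono)
    fix k
    have "(\<Sum>i\<in>block k. comb (\<lambda>j. x j - x' j) i * c i) =
      (\<Sum>i\<in>block k. comb x i * c i) - (\<Sum>i\<in>block k. comb x' i * c i)"
      by (simp add: comb_diff sum_subtractf left_diff_distrib)
    thus "\<bar>\<Sum>i\<in>block k. comb x' i * c i\<bar> \<le>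
      \<bar>\<Sum>i\<in>block k. comb x i * c i\<bar> + \<bar>\<Sum>i\<in>block k. comb (\<lambda>j. x j - x' j) i * c i\<bar>" by linarith
  qed
  moreover have "sketch_norm h c (comb (\<lambda>j. x j - x' j)) \<le> 1 / real q * (t * b)"
    using close by (intro typical_upper[OF c])
  moreover have "1 / real q * (t * b) \<le> 1 / 256" using qt by simp
  ultimately show ?thesis by linarith
qed

lemma sketch_norm_scale: "sketch_norm h c (\<lambda>i. r * y i) = \<bar>r\<bar> * sketch_norm h c y"
  by (simp add: sketch_norm_def sum_distrib_left[symmetric] abs_mult mult.assoc)

text \<open>After scaling to l1 norm 1 the coordinates lie in the unit cube, and either the heavy or
  the light rows carry half of the mass. In the light case 1/256 suffices because
  \<open>\<eta> \<le> 1 / 64\<close>.\<close>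

lemma typical_bounds:
  assumes c: "typical c"
  shows "\<eta> / 4 * (\<Sum>i<n. \<bar>comb x i\<bar>) \<le> sketch_norm h c (comb x)"
    and "sketch_norm h c (comb x) \<le> t * b * (\<Sum>i<n. \<bar>comb x i\<bar>)"
proof -
  define N where "N = (\<Sum>i<n. \<bar>comb x i\<bar>)"
  have xN: "\<bar>x j\<bar> \<le> N" if "j < d" for j
    using conditioned[OF that] by (simp add: N_def comb_def)
  show "sketch_norm h c (comb x) \<le> t * b * (\<Sum>i<n. \<bar>comb x i\<bar>)"
    using typical_upper[OF c, where x = x and M = N, OF xN] by (simp add: N_def mult_ac)
  have N0: "N \<ge> 0" by (simp add: N_def sum_nonneg)
  show "\<eta> / 4 * (\<Sum>i<n. \<bar>comb x i\<bar>) \<le> sketch_norm h c (comb x)"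
  proof (cases "N = 0")
    case True
    thus ?thesis by (simp add: N_def[symmetric]) (simp add: sketch_norm_def sum_nonneg)
  next
    case False
    hence N: "N > 0" using N0 by simp
    define x1 where "x1 = (\<lambda>j. (1 / N) * x j)"
    have x1: "\<bar>x1 j\<bar> \<le> 1" if "j < d" for j
      using xN[OF that] N by (simp add: x1_def abs_mult)
    have c1: "comb x1 = (\<lambda>i. (1 / N) * comb x i)"
      unfolding x1_def by (rule ext) (rule comb_scale)
    have "(\<Sum>i<n. \<bar>comb x1 i\<bar>) = (\<Sum>i<n. \<bar>comb x i\<bar> / N)"
      using N by (simp add: c1 abs_mult)
    also have "\<dots> = 1"
      using N by (simp add: sum_divide_distrib[symmetric] N_def[symmetric])
    finally have "(\<Sum>i<n. \<bar>comb x1 i\<bar>) = 1" .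
    moreover have "(\<Sum>i<n. \<bar>comb x1 i\<bar>) =
        (\<Sum>i\<in>heavy. \<bar>comb x1 i\<bar>) + (\<Sum>i | i < n \<and> row_weight i \<le> \<tau>. \<bar>comb x1 i\<bar>)"
      by (subst sum.union_disjoint[symmetric]) (auto simp: heavy_def intro!: sum.cong)
    ultimately consider "(\<Sum>i\<in>heavy. \<bar>comb x1 i\<bar>) \<ge> 1 / 2"
      | "(\<Sum>i | i < n \<and> row_weight i \<le> \<tau>. \<bar>comb x1 i\<bar>) \<ge> 1 / 2" by linarith
    hence "sketch_norm h c (comb x1) \<ge> \<eta> / 4"
      using typical_heavy[OF c, where x = x1, OF x1] typical_light[OF c, where x = x1, OF x1] \<eta> by cases auto
    hence "\<eta> / 4 \<le> 1 / N * sketch_norm h c (comb x)"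
      unfolding c1 sketch_norm_scale using N by simp
    thus ?thesis using N unfolding N_def[symmetric] by (simp add: field_simps)
  qed
qed

section \<open>Probabilities of the four ways in which coefficients fail to be typical\<close>

lemma measurable_abs_block_sums:
  fixes I :: "'q \<Rightarrow> nat set"
  assumes "\<And>k. k \<in> Q \<Longrightarrow> I k \<subseteq> {..<n}"
  shows "(\<lambda>c. \<Sum>k\<in>Q. \<bar>\<Sum>i\<in>I k. a k i * c i\<bar>) \<in> borel_measurable (cauchy_PiM {..<n})"
  using assms by (intro borel_measurable_sum borel_measurable_abs measurable_cauchy_sum)

text \<open>Used twice: with all rows, all buckets and \<open>w = b\<close> for the upper bound, and
  with the light rows in heavy buckets and \<open>w = \<beta>\<close> for the noise.\<close>

lemma prob_block_sums_large:
  fixes P :: "nat \<Rightarrow> bool"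
  assumes K: "K \<subseteq> {..<s}" and wt: "(\<Sum>i | i < n \<and> P i \<and> h i \<in> K. row_weight i) \<le> w"
  defines "f \<equiv> \<lambda>c. \<Sum>p\<in>K \<times> {..<d}. \<bar>\<Sum>i | i < n \<and> P i \<and> h i = fst p. U i (snd p) * c i\<bar>"
  shows "{c \<in> space (cauchy_PiM {..<n}). f c > t * w} \<in> sets (cauchy_PiM {..<n})"
    and "measure (cauchy_PiM {..<n}) {c \<in> space (cauchy_PiM {..<n}). f c > t * w} \<le> 1 / 4"
proof -
  interpret prob_space "cauchy_PiM {..<n}" by (rule prob_space_cauchy_PiM)
  have fK: "finite K" using K finite_subset by blast
  have [measurable]: "f \<in> borel_measurable (cauchy_PiM {..<n})"
    unfolding f_def by (rule measurable_abs_block_sums) auto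
  show "{c \<in> space (cauchy_PiM {..<n}). f c > t * w} \<in> events" by measurable
  define W where "W = (\<Sum>p\<in>K \<times> {..<d}. \<Sum>i | i < n \<and> P i \<and> h i = fst p. \<bar>U i (snd p)\<bar>)"
  have "W \<le> w" unfolding W_def using block_total_weight[OF fK] wt by simp
  hence "t * W \<le> t * w" using t by (intro mult_left_mono) auto
  hence "prob {c \<in> space (cauchy_PiM {..<n}). f c > t * w} \<le> prob {c \<in> space (cauchy_PiM {..<n}). f c > t * W}"
    by (intro finite_measure_mono) auto
  also have "\<dots> \<le> 1 / 4"
    unfolding W_def f_def
  proof (rule cauchy_sums_upper_tail)
    have "card K \<le> s" using card_mono[OF _ K] by simp
    thus "real (card (K \<times> {..<d})) \<le> real s * real d"
      by (simp add: card_cartesian_product mult_right_mono)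
    show "real s * real d \<ge> 1"
      using s_pos d_pos mult_mono[of 1 "real s" 1 "real d"] by simp
  qed (use fK t in auto)
  finally show "prob {c \<in> space (cauchy_PiM {..<n}). f c > t * w} \<le> 1 / 4" .
qed

lemma prob_heavy_small:
  defines "A \<equiv> \<Union>i\<in>heavy. {c \<in> space (cauchy_PiM {..<n}). c i \<in> {x. \<bar>x\<bar> \<le> \<eta>}}"
  shows "A \<in> sets (cauchy_PiM {..<n})" and "measure (cauchy_PiM {..<n}) A \<le> 1 / 8"
proof -
  interpret prob_space "cauchy_PiM {..<n}" by (rule prob_space_cauchy_PiM)
  have \<eta>0: "\<eta> > 0" using \<eta> \<tau> b_pos by simp
  have ev: "{c \<in> space (cauchy_PiM {..<n}). c i \<in> {x. \<bar>x\<bar> \<le> \<eta>}} \<in> events" if "i \<in> heavy" for i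
  proof -
    have [measurable]: "(\<lambda>c. c i) \<in> borel_measurable (cauchy_PiM {..<n})"
      using that by (intro measurable_cauchy_component) (auto simp: heavy_def)
    show ?thesis by measurable
  qed
  show "A \<in> events" unfolding A_def using ev finite_heavy by (intro sets.finite_UN)
  have "prob A \<le> (\<Sum>i\<in>heavy. prob {c \<in> space (cauchy_PiM {..<n}). c i \<in> {x. \<bar>x\<bar> \<le> \<eta>}})"
    unfolding A_def using ev finite_heavy by (intro finite_measure_subadditive_finite) auto
  also have "\<dots> \<le> (\<Sum>i\<in>heavy. \<eta>)"
  proof (intro sum_mono)
    fix i assume "i \<in> heavy"
    hence "prob {c \<in> space (cauchy_PiM {..<n}). c i \<in> {x. \<bar>x\<bar> \<le> \<eta>}} = measure std_cauchy {x. \<bar>x\<bar> \<le> \<eta>}"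
      by (intro measure_cauchy_component) (auto simp: heavy_def)
    also have "\<dots> \<le> \<eta>" using \<eta>0 by (intro measure_std_cauchy_le) simp
    finally show "prob {c \<in> space (cauchy_PiM {..<n}). c i \<in> {x. \<bar>x\<bar> \<le> \<eta>}} \<le> \<eta>" .
  qed
  also have "\<dots> = real (card heavy) * \<eta>" by simp
  also have "\<dots> \<le> b / \<tau> * \<eta>"
    using card_heavy_le[OF row_weight_nonneg sum_row_weight \<tau>] \<eta>0
    unfolding heavy_def by (intro mult_right_mono) auto
  also have "\<dots> = 1 / 8" using \<eta> \<tau> b_pos by simp
  finally show "prob A \<le> 1 / 8" .
qed

lemma prob_grid_small:
  defines "A \<equiv> \<Union>z\<in>{z \<in> grid. light_mass (comb (grid_point z)) \<ge> 1 / 8}. {c \<in> space (cauchy_PiM {..<n}).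
    (\<Sum>k\<in>light_buckets. \<bar>\<Sum>i\<in>block k. comb (grid_point z) i * c i\<bar>) \<le> (1 / 8) / 16}"
  shows "A \<in> sets (cauchy_PiM {..<n})" and "measure (cauchy_PiM {..<n}) A \<le> 1 / 8"
proof -
  interpret prob_space "cauchy_PiM {..<n}" by (rule prob_space_cauchy_PiM)
  define B where "B z = {c \<in> space (cauchy_PiM {..<n}).
    (\<Sum>k\<in>light_buckets. \<bar>\<Sum>i\<in>block k. comb (grid_point z) i * c i\<bar>) \<le> (1 / 8) / 16}" for z
  let ?G = "{z \<in> grid. light_mass (comb (grid_point z)) \<ge> 1 / 8}"
  have A: "A = (\<Union>z\<in>?G. B z)" unfolding A_def B_def ..
  have fG: "finite ?G" using finite_grid by simp
  have ev: "B z \<in> events" for z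
  proof -
    have [measurable]: "(\<lambda>c. \<Sum>k\<in>light_buckets. \<bar>\<Sum>i\<in>block k. comb (grid_point z) i * c i\<bar>) \<in> borel_measurable (cauchy_PiM {..<n})"
      by (rule measurable_abs_block_sums) auto
    show ?thesis unfolding B_def by measurable
  qed
  show "A \<in> events" unfolding A using ev fG by (intro sets.finite_UN)
  have "prob A \<le> (\<Sum>z\<in>?G. prob (B z))"
    unfolding A using ev fG by (intro finite_measure_subadditive_finite) auto
  also have "\<dots> \<le> (\<Sum>z\<in>?G. exp (- 1 / (256 * \<tau>)))"
  proof (intro sum_mono)
    fix z assume z: "z \<in> ?G"
    \<comment> \<open>The block lower tail with mass \<open>G = 1 / 8\<close> and block scale
      \<open>g = 2 * \<tau>\<close>.\<close>
    have "prob (B z) \<le> exp (- (1 / 8) / (16 * (2 * \<tau>)))"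
      unfolding B_def
    proof (rule cauchy_block_sums_lower_tail)
      show "disjoint_family_on block light_buckets" by (auto simp: disjoint_family_on_def)
      show "1 / 8 \<le> (\<Sum>k\<in>light_buckets. \<Sum>i\<in>block k. \<bar>comb (grid_point z) i\<bar>)"
        using z by (simp add: light_mass_def)
      fix k assume k: "k \<in> light_buckets"
      have z1: "\<bar>grid_point z j\<bar> \<le> 1" if "j < d" for j
      proof -
        have "z \<in> {..<d} \<rightarrow>\<^sub>E {- int q..int q}" using z by (simp add: grid_def)
        hence "z j \<in> {- int q..int q}" by (rule PiE_mem) (use that in simp)
        hence "\<bar>real_of_int (z j)\<bar> \<le> real q" by (simp add: abs_le_iff)
        thus ?thesis using q by (simp add: grid_point_def)
      qed
      have "(\<Sum>i\<in>block k. \<bar>comb (grid_point z) i\<bar>) \<le> (\<Sum>i\<in>block k. row_weight i)"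
      proof (intro sum_mono)
        show "\<bar>comb (grid_point z) i\<bar> \<le> row_weight i" for i
          using abs_comb_le[where x = "grid_point z" and M = 1, OF z1] by simp
      qed
      also have "\<dots> \<le> 2 * \<tau>" using block_light[OF k] light_block_weight by simp
      finally show "(\<Sum>i\<in>block k. \<bar>comb (grid_point z) i\<bar>) \<le> 2 * \<tau>" .
    qed (use \<tau> in \<open>auto simp: light_buckets_def\<close>)
    thus "prob (B z) \<le> exp (- 1 / (256 * \<tau>))" by simp
  qed
  also have "\<dots> = real (card ?G) * exp (- 1 / (256 * \<tau>))" by simp
  also have "\<dots> \<le> real ((2 * q + 1) ^ d) * exp (- 1 / (256 * \<tau>))"
  proof (intro mult_right_mono)
    have "card ?G \<le> card grid" using finite_grid by (intro card_mono) auto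
    thus "real (card ?G) \<le> real ((2 * q + 1) ^ d)" unfolding card_grid by (simp only: of_nat_le_iff)
  qed simp
  also have "\<dots> \<le> 1 / 8" using net by (simp only: of_nat_power)
  finally show "prob A \<le> 1 / 8" .
qed

text \<open>The failure probabilities 1/4, 1/4, 1/8 and 1/8 add up to 3/4. The complement of the
  four bad events is returned as an explicit measurable event.\<close>

lemma prob_typical:
  obtains E where "E \<in> sets (cauchy_PiM {..<n})" "measure (cauchy_PiM {..<n}) E \<ge> 1 / 4" "\<And>c. c \<in> E \<Longrightarrow> typical c"
proof -
  let ?C = "cauchy_PiM {..<n}"
  interpret prob_space ?C by (rule prob_space_cauchy_PiM)
  define A1 where "A1 = {c \<in> space ?C. (\<Sum>p\<in>{..<s} \<times> {..<d}. \<bar>\<Sum>i\<in>block (fst p). U i (snd p) * c i\<bar>) > t * b}"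
  define A2 where "A2 = {c \<in> space ?C. (\<Sum>p\<in>h ` heavy \<times> {..<d}. \<bar>\<Sum>i\<in>light_block (fst p). U i (snd p) * c i\<bar>) > t * \<beta>}"
  define A3 where "A3 = (\<Union>i\<in>heavy. {c \<in> space ?C. c i \<in> {x. \<bar>x\<bar> \<le> \<eta>}})"
  define A4 where "A4 = (\<Union>z\<in>{z \<in> grid. light_mass (comb (grid_point z)) \<ge> 1 / 8}. {c \<in> space ?C.
    (\<Sum>k\<in>light_buckets. \<bar>\<Sum>i\<in>block k. comb (grid_point z) i * c i\<bar>) \<le> (1 / 8) / 16})"
  have wt: "(\<Sum>i | i < n \<and> True \<and> h i \<in> {..<s}. row_weight i) \<le> b"
  proof -
    have "{i. i < n \<and> True \<and> h i \<in> {..<s}} = {..<n}" using h by auto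
    thus ?thesis using sum_row_weight by simp
  qed
  have A1: "A1 \<in> events" "prob A1 \<le> 1 / 4"
    using prob_block_sums_large[where P = "\<lambda>_. True" and K = "{..<s}" and w = b, OF subset_refl wt]
    unfolding A1_def by (simp_all only: simp_thms)
  note A2 = prob_block_sums_large[OF heavy_image, of "\<lambda>i. row_weight i \<le> \<tau>", OF light_mass_in_heavy_buckets, folded A2_def]
  note A3 = prob_heavy_small[folded A3_def]
  note A4 = prob_grid_small[folded A4_def]
  have ev: "A1 \<union> A2 \<union> A3 \<union> A4 \<in> events"
    using A1(1) A2(1) A3(1) A4(1) by (intro sets.Un)
  have "prob (A1 \<union> A2 \<union> A3 \<union> A4) \<le> prob A1 + prob A2 + prob A3 + prob A4"
    using measure_Un_le[OF sets.Un[OF sets.Un[OF A1(1) A2(1)] A3(1)] A4(1)]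
      measure_Un_le[OF sets.Un[OF A1(1) A2(1)] A3(1)] measure_Un_le[OF A1(1) A2(1)] by linarith
  also have "\<dots> \<le> 3 / 4" using A1(2) A2(2) A3(2) A4(2) by linarith
  finally have "prob (space ?C - (A1 \<union> A2 \<union> A3 \<union> A4)) \<ge> 1 / 4"
    using prob_compl[OF ev] by linarith
  moreover have "typical c" if "c \<in> space ?C - (A1 \<union> A2 \<union> A3 \<union> A4)" for c
    using that unfolding typical_def A1_def A2_def A3_def A4_def by (auto simp: not_le not_less)
  ultimately show ?thesis using ev by (intro that[of "space ?C - (A1 \<union> A2 \<union> A3 \<union> A4)"]) auto
qed

end

section \<open>Well-conditioned bases\<close>

text \<open>Linear independence concerns the set of columns, where a repeated column would go
  unnoticed. Full rank rules this out, as repetition leaves too few distinct columns.\<close>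

lemma (in vec_space) non_distinct_cols_rank_less:
  assumes A: "A \<in> carrier_mat n nc" and nd: "\<not> distinct (cols A)"
  shows "rank A < nc"
proof -
  obtain S where S: "maximal S (\<lambda>T. T \<subseteq> set (cols A) \<and> lin_indpt T)"
    using maximal_exists[of "(\<lambda>T. T \<subseteq> set (cols A) \<and> lin_indpt T)" "card (set (cols A))" "{}"]
    by (meson List.finite_set card_mono empty_iff empty_subsetI finite_lin_indpt2 rev_finite_subset)
  hence "card S \<le> card (set (cols A))" by (simp add: card_mono maximal_def)
  also have "\<dots> < length (cols A)"
    using nd card_length[of "cols A"] card_distinct[of "cols A"] by linarith
  also have "\<dots> = nc" using A by simp
  finally show ?thesis using rank_card_indpt[OF A S] by simp
qed

lemma (in vec_space) full_rank_kernel_trivial: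
  assumes A: "A \<in> carrier_mat n nc" and r: "rank A = nc"
    and v: "v \<in> carrier_vec nc" "A *\<^sub>v v = 0\<^sub>v n"
  shows "v = 0\<^sub>v nc"
proof -
  have "distinct (cols A)" using non_distinct_cols_rank_less[OF A] r by blast
  thus ?thesis using full_rank_lin_indpt[OF A r] lin_depI[OF A v(1) _ v(2)] by blast
qed

text \<open>The Gram matrix \<open>?T * A\<close> is invertible: if it kills \<open>v\<close>, then
  the squared Euclidean norm of \<open>A *\<^sub>v v\<close> is 0, and full rank forces
  \<open>v = 0\<close>. Its inverse, from the adjugate, times the transpose is the left
  inverse.\<close>

lemma left_inverse_of_full_column_rank:
  assumes A: "A \<in> carrier_mat n d" and r: "full_column_rank A"
  obtains B where "B \<in> carrier_mat d n" "B * A = 1\<^sub>m d"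
proof -
  let ?T = "transpose_mat A"
  have T: "?T \<in> carrier_mat d n" using A by simp
  have TA: "?T * A \<in> carrier_mat d d" using A T by simp
  have "det (?T * A) \<noteq> 0"
  proof
    assume "det (?T * A) = 0"
    then obtain v where v: "v \<in> carrier_vec d" "v \<noteq> 0\<^sub>v d" "(?T * A) *\<^sub>v v = 0\<^sub>v d"
      using det_0_iff_vec_prod_zero_field[OF TA] by blast
    have Av: "A *\<^sub>v v \<in> carrier_vec n" using A v(1) by simp
    have "?T *\<^sub>v (A *\<^sub>v v) = 0\<^sub>v d" using v(3) assoc_mult_mat_vec[OF T A v(1)] by simp
    hence "v \<bullet> (?T *\<^sub>v (A *\<^sub>v v)) = 0" using v(1) by simp
    moreover have "v \<bullet> (?T *\<^sub>v (A *\<^sub>v v)) = (A *\<^sub>v v) \<bullet> (A *\<^sub>v v)"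
      using transpose_vec_mult_scalar[OF A v(1) Av] comm_scalar_prod v(1) A Av T
      by (metis mult_mat_vec_carrier)
    ultimately have "(A *\<^sub>v v) \<bullet> (A *\<^sub>v v) = 0" by simp
    hence "A *\<^sub>v v = 0\<^sub>v n" using conjugate_square_eq_0_vec[OF Av] by (simp add: conjugate_real_def)
    hence "v = 0\<^sub>v d"
      using vec_space.full_rank_kernel_trivial[OF A _ v(1)] r A by (simp add: full_column_rank_def)
    thus False using v(2) by simp
  qed
  let ?D = "det (?T * A)"
  let ?B = "((1 / ?D) \<cdot>\<^sub>m adj_mat (?T * A)) * ?T"
  note adj = adj_mat[OF TA]
  have "?B * A = ((1 / ?D) \<cdot>\<^sub>m adj_mat (?T * A)) * (?T * A)"
    using assoc_mult_mat[OF _ T A, of "(1 / ?D) \<cdot>\<^sub>m adj_mat (?T * A)" d] adj(1) by simp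
  also have "\<dots> = (1 / ?D) \<cdot>\<^sub>m (adj_mat (?T * A) * (?T * A))"
    using mult_smult_assoc_mat[OF adj(1) TA] by simp
  also have "\<dots> = 1\<^sub>m d"
    unfolding adj(3) using \<open>?D \<noteq> 0\<close> by (intro eq_matI) auto
  finally show ?thesis using adj(1) T by (intro that[of ?B]) auto
qed

lemma l1_norm_smult: "l1_norm (r \<cdot>\<^sub>v v) = \<bar>r\<bar> * l1_norm v"
  by (simp add: l1_norm_def abs_mult sum_distrib_left)

lemma l1_norm_nonneg: "l1_norm v \<ge> 0"
  by (simp add: l1_norm_def sum_nonneg)

lemma abs_index_le_l1_norm: "i < dim_vec v \<Longrightarrow> \<bar>v $ i\<bar> \<le> l1_norm v"
  unfolding l1_norm_def by (rule member_le_sum[of i "{..<dim_vec v}" "\<lambda>i. \<bar>v $ i\<bar>"]) auto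

text \<open>A crude bound by the Leibniz expansion; it serves only to make a supremum of
  determinants finite.\<close>

lemma abs_det_le:
  fixes G :: "real mat"
  assumes G: "G \<in> carrier_mat d d" and K: "\<And>i j. i < d \<Longrightarrow> j < d \<Longrightarrow> \<bar>G $$ (i, j)\<bar> \<le> K"
  shows "\<bar>det G\<bar> \<le> real (card {p. p permutes {0..<d}}) * K ^ d"
proof -
  have "\<bar>det G\<bar> \<le> (\<Sum>p | p permutes {0..<d}. \<bar>signof p * (\<Prod>i = 0..<d. G $$ (i, p i))\<bar>)"
    unfolding det_def'[OF G] by (rule sum_abs)
  also have "\<dots> \<le> (\<Sum>p | p permutes {0..<d}. K ^ d)"
  proof (intro sum_mono)
    fix p assume "p \<in> {p. p permutes {0..<d}}"
    hence p: "p i < d" if "i < d" for i using that permutes_in_image[of p "{0..<d}" i] by auto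
    have "\<bar>signof p * (\<Prod>i = 0..<d. G $$ (i, p i))\<bar> = (\<Prod>i = 0..<d. \<bar>G $$ (i, p i)\<bar>)"
      by (simp add: abs_mult abs_prod sign_def)
    also have "\<dots> \<le> (\<Prod>i = 0..<d. K)"
      using K p by (intro prod_mono) auto
    finally show "\<bar>signof p * (\<Prod>i = 0..<d. G $$ (i, p i))\<bar> \<le> K ^ d" by simp
  qed
  finally show ?thesis by simp
qed

text \<open>
  An approximate form of Auerbach's lemma: a basis whose determinant is within a factor two of the supremum over all
  bases of unit vectors is well conditioned, by Cramer's rule. Taking an approximate maximiser avoids compactness.
\<close>

lemma approximate_auerbach_basis:
  assumes A: "A \<in> carrier_mat n d" and r: "full_column_rank A"
  obtains G where "G \<in> carrier_mat d d" "det G \<noteq> 0"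
    "\<And>j. j < d \<Longrightarrow> l1_norm (A *\<^sub>v col G j) \<le> 1"
    "\<And>x j. x \<in> carrier_vec d \<Longrightarrow> j < d \<Longrightarrow> \<bar>x $ j\<bar> \<le> 2 * l1_norm (A *\<^sub>v (G *\<^sub>v x))"
proof -
  obtain B where B: "B \<in> carrier_mat d n" "B * A = 1\<^sub>m d"
    using left_inverse_of_full_column_rank[OF A r] .
  define F where "F = {G \<in> carrier_mat d d. \<forall>j<d. l1_norm (A *\<^sub>v col G j) \<le> 1}"
  define D where "D = (\<lambda>G. \<bar>det G\<bar>) ` F"
  \<comment> \<open>The left inverse recovers \<open>G\<close> from \<open>A * G\<close>, whose
    columns have l1 norm at most 1; hence the entries of all members of \<open>F\<close> are
    uniformly bounded.\<close>
  define K where "K = (\<Sum>i<d. \<Sum>k<n. \<bar>B $$ (i, k)\<bar>)"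
  have entry: "\<bar>G $$ (i, j)\<bar> \<le> K" if G: "G \<in> F" and ij: "i < d" "j < d" for G i j
  proof -
    let ?g = "col G j"
    have g: "?g \<in> carrier_vec d" using G ij unfolding F_def by auto
    have n1: "l1_norm (A *\<^sub>v ?g) \<le> 1" using G ij by (simp add: F_def)
    have "G $$ (i, j) = ?g $ i" using G ij unfolding F_def by auto
    also have "?g = B *\<^sub>v (A *\<^sub>v ?g)"
      using assoc_mult_mat_vec[OF B(1) A g] B(2) g by simp
    also have "\<dots> $ i = (\<Sum>k<n. B $$ (i, k) * (A *\<^sub>v ?g) $ k)"
      using B(1) A ij by (simp add: scalar_prod_def atLeast0LessThan)
    finally have "\<bar>G $$ (i, j)\<bar> \<le> (\<Sum>k<n. \<bar>B $$ (i, k) * (A *\<^sub>v ?g) $ k\<bar>)" by (simp only: sum_abs)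
    also have "\<dots> \<le> (\<Sum>k<n. \<bar>B $$ (i, k)\<bar>)"
    proof (intro sum_mono)
      fix k assume "k \<in> {..<n}"
      hence "\<bar>(A *\<^sub>v ?g) $ k\<bar> \<le> 1" using abs_index_le_l1_norm[of k "A *\<^sub>v ?g"] n1 A by simp
      thus "\<bar>B $$ (i, k) * (A *\<^sub>v ?g) $ k\<bar> \<le> \<bar>B $$ (i, k)\<bar>"
        using mult_left_mono[of "\<bar>(A *\<^sub>v ?g) $ k\<bar>" 1 "\<bar>B $$ (i, k)\<bar>"] by (simp add: abs_mult)
    qed
    also have "\<dots> \<le> K" unfolding K_def
      using ij by (intro member_le_sum[of i "{..<d}" "\<lambda>i. \<Sum>k<n. \<bar>B $$ (i, k)\<bar>"]) (auto simp: sum_nonneg)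
    finally show ?thesis .
  qed
  have bdd: "bdd_above D"
    unfolding D_def
  proof (rule bdd_aboveI2)
    fix G assume "G \<in> F"
    thus "\<bar>det G\<bar> \<le> real (card {p. p permutes {0..<d}}) * K ^ d"
      using entry by (intro abs_det_le) (auto simp: F_def)
  qed
  \<comment> \<open>A scaled identity matrix belongs to \<open>F\<close>, so the supremum of the
    determinants is positive; the summand 1 keeps \<open>M\<close> positive.\<close>
  define M where "M = 1 + (\<Sum>j<d. l1_norm (col A j))"
  have M: "M > 0" unfolding M_def by (intro add_pos_nonneg sum_nonneg l1_norm_nonneg) simp
  have "(1 / M) \<cdot>\<^sub>m 1\<^sub>m d \<in> F"
    unfolding F_def
  proof (intro CollectI conjI allI impI)
    fix j assume j: "j < d"
    have "A *\<^sub>v col ((1 / M) \<cdot>\<^sub>m 1\<^sub>m d) j = (1 / M) \<cdot>\<^sub>v (A *\<^sub>v unit_vec d j)"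
      using A j by (simp add: col_smult mult_mat_vec[OF A])
    also have "A *\<^sub>v unit_vec d j = col A j"
      using A j by (intro eq_vecI) (auto simp: scalar_prod_right_unit)
    finally have "l1_norm (A *\<^sub>v col ((1 / M) \<cdot>\<^sub>m 1\<^sub>m d) j) = l1_norm (col A j) / M"
      using M by (simp add: l1_norm_smult)
    moreover have "l1_norm (col A j) \<le> (\<Sum>j<d. l1_norm (col A j))"
      using j by (intro member_le_sum) (auto simp: l1_norm_nonneg)
    hence "l1_norm (col A j) \<le> M" by (simp add: M_def)
    ultimately show "l1_norm (A *\<^sub>v col ((1 / M) \<cdot>\<^sub>m 1\<^sub>m d) j) \<le> 1" using M by simp
  qed simp
  moreover have "det ((1 / M) \<cdot>\<^sub>m 1\<^sub>m d) = (1 / M) ^ d"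
    by (simp add: det_smult)
  ultimately have mem: "(1 / M) ^ d \<in> D" unfolding D_def using M by (force intro!: image_eqI)
  hence "(1 / M) ^ d \<le> Sup D" using bdd by (rule cSup_upper)
  hence S: "Sup D > 0" using M by (smt (verit) zero_less_power divide_pos_pos)
  hence "Sup D / 2 < Sup D" by simp
  then obtain y where "y \<in> D" "Sup D / 2 < y" using mem less_cSup_iff[OF _ bdd] by blast
  then obtain G where G: "G \<in> F" "Sup D / 2 < \<bar>det G\<bar>" unfolding D_def by blast
  have Gc: "G \<in> carrier_mat d d" using G by (simp add: F_def)
  have cond: "\<bar>x $ j\<bar> \<le> 2 * l1_norm (A *\<^sub>v (G *\<^sub>v x))" if x: "x \<in> carrier_vec d" and j: "j < d" for x j
  proof (rule ccontr)
    let ?N = "l1_norm (A *\<^sub>v (G *\<^sub>v x))"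
    assume "\<not> ?thesis"
    hence N: "2 * ?N < \<bar>x $ j\<bar>" by simp
    hence xj: "\<bar>x $ j\<bar> > 0" using l1_norm_nonneg[of "A *\<^sub>v (G *\<^sub>v x)"] by linarith
    \<comment> \<open>Replacing column \<open>j\<close> by
      \<open>G *\<^sub>v (r \<cdot>\<^sub>v x)\<close> stays in \<open>F\<close> when the claim
      fails, while by Cramer's rule it doubles the absolute determinant, past the supremum.\<close>
    define r where "r = 2 / \<bar>x $ j\<bar>"
    have r: "r > 0" using xj by (simp add: r_def)
    define G' where "G' = replace_col G (G *\<^sub>v (r \<cdot>\<^sub>v x)) j"
    have Gx: "G *\<^sub>v x \<in> carrier_vec d" using Gc x by simp
    have eq: "G *\<^sub>v (r \<cdot>\<^sub>v x) = r \<cdot>\<^sub>v (G *\<^sub>v x)" using Gc x by (simp add: mult_mat_vec)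
    have "G' \<in> F"
      unfolding F_def
    proof (intro CollectI conjI allI impI)
      show "G' \<in> carrier_mat d d" using Gc by (simp add: G'_def replace_col_def)
      fix k assume k: "k < d"
      show "l1_norm (A *\<^sub>v col G' k) \<le> 1"
      proof (cases "k = j")
        case True
        have "col G' k = G *\<^sub>v (r \<cdot>\<^sub>v x)"
          using Gc k True by (intro eq_vecI) (auto simp: G'_def replace_col_def)
        hence "A *\<^sub>v col G' k = r \<cdot>\<^sub>v (A *\<^sub>v (G *\<^sub>v x))"
          using eq mult_mat_vec[OF A Gx] by simp
        hence "l1_norm (A *\<^sub>v col G' k) = r * ?N" using r by (simp add: l1_norm_smult)
        moreover have "2 * ?N / \<bar>x $ j\<bar> \<le> 1" using N xj by simp
        ultimately show ?thesis by (simp add: r_def)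
      next
        case False
        have "col G' k = col G k"
          using Gc k False by (intro eq_vecI) (auto simp: G'_def replace_col_def)
        thus ?thesis using G k by (simp add: F_def)
      qed
    qed
    hence "\<bar>det G'\<bar> \<le> Sup D" unfolding D_def using bdd[unfolded D_def] by (intro cSup_upper) auto
    moreover have "det G' = (r * x $ j) * det G"
      unfolding G'_def using cramer_lemma_mat[OF Gc _ j, of "r \<cdot>\<^sub>v x"] x j by simp
    hence "\<bar>det G'\<bar> = 2 * \<bar>det G\<bar>"
      using xj by (simp add: abs_mult r_def)
    ultimately show False using G by simp
  qed
  show ?thesis
  proof (rule that[OF Gc])
    show "det G \<noteq> 0" using G S by auto
    show "l1_norm (A *\<^sub>v col G j) \<le> 1" if "j < d" for j using G that by (simp add: F_def)
  qed (rule cond)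
qed

lemma mult_mat_vec_surj:
  fixes G :: "real mat"
  assumes G: "G \<in> carrier_mat d d" "det G \<noteq> 0" and x: "x \<in> carrier_vec d"
  obtains y where "y \<in> carrier_vec d" "G *\<^sub>v y = x"
proof -
  note adj = adj_mat[OF G(1)]
  let ?y = "(1 / det G) \<cdot>\<^sub>v (adj_mat G *\<^sub>v x)"
  have ax: "adj_mat G *\<^sub>v x \<in> carrier_vec d" using adj(1) x by simp
  have "G *\<^sub>v ?y = (1 / det G) \<cdot>\<^sub>v (G *\<^sub>v (adj_mat G *\<^sub>v x))"
    using mult_mat_vec[OF G(1) ax] by simp
  also have "G *\<^sub>v (adj_mat G *\<^sub>v x) = (det G \<cdot>\<^sub>m 1\<^sub>m d) *\<^sub>v x"
    using assoc_mult_mat_vec[OF G(1) adj(1) x] adj(2) by simp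
  also have "\<dots> = det G \<cdot>\<^sub>v x"
    using x by (intro eq_vecI) (auto simp: row_smult)
  also have "(1 / det G) \<cdot>\<^sub>v (det G \<cdot>\<^sub>v x) = x"
    using G(2) x by (intro eq_vecI) auto
  finally show ?thesis using ax by (intro that[of ?y]) auto
qed

lemma well_conditioned_basis:
  assumes A: "A \<in> carrier_mat n d" and r: "full_column_rank A"
  obtains U :: "nat \<Rightarrow> nat \<Rightarrow> real" where
    "(\<Sum>i<n. \<Sum>j<d. \<bar>U i j\<bar>) \<le> 2 * real d"
    "\<And>x j. j < d \<Longrightarrow> \<bar>x j\<bar> \<le> (\<Sum>i<n. \<bar>\<Sum>j<d. U i j * x j\<bar>)"
    "\<And>x. x \<in> carrier_vec d \<Longrightarrow> \<exists>y. A *\<^sub>v x = vec n (\<lambda>i. \<Sum>j<d. U i j * y j)"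
proof -
  obtain G where G: "G \<in> carrier_mat d d" "det G \<noteq> 0"
    and unit: "\<And>j. j < d \<Longrightarrow> l1_norm (A *\<^sub>v col G j) \<le> 1"
    and cond: "\<And>x j. x \<in> carrier_vec d \<Longrightarrow> j < d \<Longrightarrow> \<bar>x $ j\<bar> \<le> 2 * l1_norm (A *\<^sub>v (G *\<^sub>v x))"
    using approximate_auerbach_basis[OF A r] by metis
  \<comment> \<open>The factor 2 absorbs the loss from the approximate maximiser, so that
    \<open>conditioned\<close> holds with constant 1 and the total weight becomes
    \<open>2 * real d\<close>.\<close>
  define U where "U i j = 2 * (A * G) $$ (i, j)" for i j
  have AG: "(A *\<^sub>v (G *\<^sub>v x)) $ i = (\<Sum>j<d. (A * G) $$ (i, j) * x $ j)" if "x \<in> carrier_vec d" "i < n" for x i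
  proof -
    have row: "(M *\<^sub>v x) $ i = (\<Sum>j<d. M $$ (i, j) * x $ j)" if "M \<in> carrier_mat n d" for M
      using that \<open>x \<in> carrier_vec d\<close> \<open>i < n\<close> by (simp add: scalar_prod_def atLeast0LessThan)
    have "A *\<^sub>v (G *\<^sub>v x) = (A * G) *\<^sub>v x" using assoc_mult_mat_vec[OF A G(1) that(1)] by simp
    also have "\<dots> $ i = (\<Sum>j<d. (A * G) $$ (i, j) * x $ j)"
      using A G by (intro row) simp
    finally show ?thesis .
  qed
  have dAG: "dim_vec (A *\<^sub>v v) = n" for v using A by simp
  show ?thesis
  proof (rule that[of U])
    have "(\<Sum>i<n. \<bar>(A * G) $$ (i, j)\<bar>) \<le> 1" if j: "j < d" for j
    proof -
      have "(A *\<^sub>v col G j) $ i = (A * G) $$ (i, j)" if "i < n" for i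
        using A G j that by simp
      thus ?thesis using unit[OF j] A by (simp add: l1_norm_def)
    qed
    hence "(\<Sum>j<d. \<Sum>i<n. \<bar>(A * G) $$ (i, j)\<bar>) \<le> (\<Sum>j<d. 1)" by (intro sum_mono) auto
    hence "(\<Sum>i<n. \<Sum>j<d. \<bar>(A * G) $$ (i, j)\<bar>) \<le> real d" by (subst sum.swap) simp
    thus "(\<Sum>i<n. \<Sum>j<d. \<bar>U i j\<bar>) \<le> 2 * real d"
      unfolding U_def by (simp add: abs_mult sum_distrib_left[symmetric])
  next
    fix x :: "nat \<Rightarrow> real" and j assume j: "j < d"
    have v: "vec d x \<in> carrier_vec d" by simp
    have "\<bar>x j\<bar> \<le> 2 * l1_norm (A *\<^sub>v (G *\<^sub>v vec d x))" using cond[OF v j] j by simp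
    also have "\<dots> = 2 * (\<Sum>i<n. \<bar>\<Sum>j<d. (A * G) $$ (i, j) * x j\<bar>)"
    proof -
      have "(A *\<^sub>v (G *\<^sub>v vec d x)) $ i = (\<Sum>j<d. (A * G) $$ (i, j) * x j)" if "i < n" for i
        unfolding AG[OF v that] by simp
      thus ?thesis unfolding l1_norm_def dAG
        by (intro arg_cong[of _ _ "(*) 2"] sum.cong refl) (simp only: lessThan_iff)
    qed
    also have "\<dots> = (\<Sum>i<n. \<bar>\<Sum>j<d. U i j * x j\<bar>)"
      unfolding U_def by (simp add: sum_distrib_left[symmetric] abs_mult mult.assoc)
    finally show "\<bar>x j\<bar> \<le> (\<Sum>i<n. \<bar>\<Sum>j<d. U i j * x j\<bar>)" .
  next
    fix x :: "real vec" assume "x \<in> carrier_vec d"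
    then obtain y where y: "y \<in> carrier_vec d" "G *\<^sub>v y = x"
      using mult_mat_vec_surj[OF G] by metis
    have "A *\<^sub>v x = vec n (\<lambda>i. \<Sum>j<d. U i j * (y $ j / 2))"
      unfolding y(2)[symmetric] using AG[OF y(1)] dAG by (intro eq_vecI) (auto simp: U_def)
    thus "\<exists>y. A *\<^sub>v x = vec n (\<lambda>i. \<Sum>j<d. U i j * y j)" by (rule exI[of _ "\<lambda>j. y $ j / 2"])
  qed
qed

section \<open>Entries of the sketching matrix and the sketch bucket by bucket\<close>

lemma sparse_cauchy_carrier: "sparse_cauchy s n h c \<in> carrier_mat s n"
  unfolding sparse_cauchy_def
proof (rule mult_carrier_mat)
  show "S_mat s n h \<in> carrier_mat s n" by (simp add: S_mat_def mat_of_cols_def)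
  show "C_mat n c \<in> carrier_mat n n" by (simp add: C_mat_def mat_diag_def)
qed

lemma sparse_cauchy_index:
  assumes "k < s" "i < n" and h: "\<And>i. i < n \<Longrightarrow> h i < s"
  shows "sparse_cauchy s n h c $$ (k, i) = (if h i = k then c i else 0)"
proof -
  have S: "S_mat s n h \<in> carrier_mat s n" by (simp add: S_mat_def mat_of_cols_def)
  have "sparse_cauchy s n h c $$ (k, i) = S_mat s n h $$ (k, i) * c i"
    unfolding sparse_cauchy_def C_mat_def mat_diag_mult_right[OF S] using assms by simp
  also have "S_mat s n h $$ (k, i) = (if h i = k then 1 else 0)"
    using assms by (simp add: S_mat_def mat_of_cols_index)
  finally show ?thesis by simp
qed

lemma l1_norm_sparse_cauchy:
  assumes h: "\<And>i. i < n \<Longrightarrow> h i < s" and y: "y \<in> carrier_vec n"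
  shows "l1_norm (sparse_cauchy s n h c *\<^sub>v y) = (\<Sum>k<s. \<bar>\<Sum>i | i < n \<and> h i = k. y $ i * c i\<bar>)"
proof -
  have "(sparse_cauchy s n h c *\<^sub>v y) $ k = (\<Sum>i | i < n \<and> h i = k. y $ i * c i)" if k: "k < s" for k
  proof -
    have "(sparse_cauchy s n h c *\<^sub>v y) $ k = (\<Sum>i<n. (if h i = k then c i else 0) * y $ i)"
      using k y sparse_cauchy_carrier[of s n h c] h
      by (auto simp: scalar_prod_def atLeast0LessThan sparse_cauchy_index intro!: sum.cong)
    also have "\<dots> = (\<Sum>i | i < n \<and> h i = k. y $ i * c i)"
      by (rule sum.mono_neutral_cong_right) auto
    finally show ?thesis .
  qed
  thus ?thesis using sparse_cauchy_carrier[of s n h c] by (simp add: l1_norm_def)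
qed

section \<open>The sketching program\<close>

text \<open>One pass adds the contribution of one stored nonzero entry directly to its output cell.
  All operands are variables, so the increment of \<open>p\<close> first needs the constant in
  \<open>one\<close>; this makes 13 instructions.\<close>

definition sketch_body :: prog where
  "sketch_body =
     Seq (Instr (ILoad ''i'' ''row'' ''p'')) (
     Seq (Instr (ILoad ''j'' ''col'' ''p'')) (
     Seq (Instr (ILoad ''k'' ''S'' ''i'')) (
     Seq (Instr (RLoad ''v'' ''val'' ''p'')) (
     Seq (Instr (RLoad ''c'' ''C'' ''i'')) (
     Seq (Instr (RMul ''v'' ''c'' ''v'')) (
     Seq (Instr (IMul ''k'' ''k'' ''d'')) (
     Seq (Instr (IAdd ''k'' ''k'' ''j'')) (
     Seq (Instr (RLoad ''c'' ''out'' ''k'')) (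
     Seq (Instr (RAdd ''c'' ''c'' ''v'')) (
     Seq (Instr (RStore ''out'' ''k'' ''c'')) (
     Seq (Instr (IConst ''one'' 1)) (
     Instr (IAdd ''p'' ''p'' ''one'')))))))))))))"

definition sketch_prog :: prog where
  "sketch_prog = WhileLess ''p'' ''nnz'' sketch_body"

text \<open>The output is described by flat address and not by row and column, so the invariant
  needs no range conditions; distinctness of addresses is settled once, after the loop.\<close>

definition sketch_inv :: "nat \<Rightarrow> real mat \<Rightarrow> (nat \<times> nat) list \<Rightarrow> (nat \<Rightarrow> nat) \<Rightarrow> (nat \<Rightarrow> real) \<Rightarrow> nat \<Rightarrow> ram_state \<Rightarrow> bool" where
  "sketch_inv s A es h c p st \<longleftrightarrow>
     ivar st ''p'' = p \<and> ivar st ''nnz'' = length es \<and> ivar st ''d'' = dim_col A \<and>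
     iarr st = iarr (input_state s A es h c) \<and>
     rarr st ''val'' = rarr (input_state s A es h c) ''val'' \<and>
     rarr st ''C'' = rarr (input_state s A es h c) ''C'' \<and>
     (\<forall>m. rarr st ''out'' m = (\<Sum>e\<leftarrow>take p es. if h (fst e) * dim_col A + snd e = m then c (fst e) * A $$ e else 0))"

lemma exec_sketch_body:
  assumes inv: "sketch_inv s A es h c p st" and p: "p < length es" and row: "fst (es ! p) < dim_row A"
  shows "\<exists>st'. exec sketch_body st 13 st' \<and> sketch_inv s A es h c (Suc p) st'"
proof -
  define st1 where "st1 = exec_instr (ILoad ''i'' ''row'' ''p'') st"
  define st2 where "st2 = exec_instr (ILoad ''j'' ''col'' ''p'') st1"
  define st3 where "st3 = exec_instr (ILoad ''k'' ''S'' ''i'') st2"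
  define st4 where "st4 = exec_instr (RLoad ''v'' ''val'' ''p'') st3"
  define st5 where "st5 = exec_instr (RLoad ''c'' ''C'' ''i'') st4"
  define st6 where "st6 = exec_instr (RMul ''v'' ''c'' ''v'') st5"
  define st7 where "st7 = exec_instr (IMul ''k'' ''k'' ''d'') st6"
  define st8 where "st8 = exec_instr (IAdd ''k'' ''k'' ''j'') st7"
  define st9 where "st9 = exec_instr (RLoad ''c'' ''out'' ''k'') st8"
  define st10 where "st10 = exec_instr (RAdd ''c'' ''c'' ''v'') st9"
  define st11 where "st11 = exec_instr (RStore ''out'' ''k'' ''c'') st10"
  define st12 where "st12 = exec_instr (IConst ''one'' 1) st11"
  define st13 where "st13 = exec_instr (IAdd ''p'' ''p'' ''one'') st12"
  note defs = st1_def st2_def st3_def st4_def st5_def st6_def st7_def st8_def st9_def st10_def st11_def st12_def st13_def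
  \<comment> \<open>The step count is put into the nested form that the rule for sequencing
    produces.\<close>
  have steps: "(13::nat) = 1 + (1 + (1 + (1 + (1 + (1 + (1 + (1 + (1 + (1 + (1 + (1 + 1)))))))))))" by simp
  have ex: "exec sketch_body st 13 st13"
    unfolding steps sketch_body_def defs by (rule exec.Seq exec.Instr)+
  obtain i j where ij: "es ! p = (i, j)" by (cases "es ! p")
  have i: "i < dim_row A" using row ij by simp
  have old: "rarr st ''out'' m = (\<Sum>e\<leftarrow>take p es. if h (fst e) * dim_col A + snd e = m then c (fst e) * A $$ e else 0)" for m
    using inv by (simp add: sketch_inv_def)
  have rd: "iarr st ''row'' p = i" "iarr st ''col'' p = j" "iarr st ''S'' i = h i"
     "rarr st ''val'' p = A $$ (i, j)" "rarr st ''C'' i = c i" "ivar st ''p'' = p" "ivar st ''d'' = dim_col A"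
    using inv p ij i by (simp_all add: sketch_inv_def input_state_def)
  have "rarr st13 ''out'' = (rarr st ''out'')(h i * dim_col A + j := rarr st ''out'' (h i * dim_col A + j) + c i * A $$ (i, j))"
    unfolding defs by (simp add: rd)
  moreover have "ivar st13 ''p'' = Suc p" "ivar st13 ''nnz'' = length es" "ivar st13 ''d'' = dim_col A" "iarr st13 = iarr st"
     "rarr st13 ''val'' = rarr st ''val''" "rarr st13 ''C'' = rarr st ''C''"
    using inv unfolding defs by (simp_all add: sketch_inv_def)
  ultimately have "sketch_inv s A es h c (Suc p) st13"
    using inv p ij unfolding sketch_inv_def by (simp add: take_Suc_conv_app_nth)
  with ex show ?thesis by blast
qed

text \<open>Each entry costs 13 instructions and one successful guard; the final 1 is the failing
  guard.\<close>

lemma exec_sketch_prog: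
  assumes rows: "\<And>e. e \<in> set es \<Longrightarrow> fst e < dim_row A"
  shows "sketch_inv s A es h c p st \<Longrightarrow> p \<le> length es \<Longrightarrow>
    \<exists>st'. exec sketch_prog st (14 * (length es - p) + 1) st' \<and> sketch_inv s A es h c (length es) st'"
proof (induction "length es - p" arbitrary: p st)
  case 0
  hence "p = length es" by simp
  moreover have "exec sketch_prog st 1 st"
    unfolding sketch_prog_def using 0 \<open>p = length es\<close> by (intro exec.WhileDone) (simp add: sketch_inv_def)
  ultimately show ?case using 0 by auto
next
  case (Suc k)
  hence p: "p < length es" by simp
  obtain st1 where st1: "exec sketch_body st 13 st1" "sketch_inv s A es h c (Suc p) st1"
    using exec_sketch_body[OF Suc.prems(1) p] rows p by auto
  obtain st2 where st2: "exec sketch_prog st1 (14 * (length es - Suc p) + 1) st2" "sketch_inv s A es h c (length es) st2"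
  proof -
    have "k = length es - Suc p" using Suc.hyps(2) by simp
    thus ?thesis using that Suc.hyps(1)[OF _ st1(2)] p by auto
  qed
  have "exec sketch_prog st (1 + 13 + (14 * (length es - Suc p) + 1)) st2"
    unfolding sketch_prog_def using Suc.prems(1) p st1(1) st2(1)[unfolded sketch_prog_def]
    by (intro exec.WhileStep) (simp_all add: sketch_inv_def)
  moreover have "1 + 13 + (14 * (length es - Suc p) + 1) = 14 * (length es - p) + 1"
    using p by simp
  ultimately show ?case using st2(2) by metis
qed

lemma sketch_prog_correct:
  assumes A: "A \<in> carrier_mat n d" and h: "\<And>i. i < n \<Longrightarrow> h i < s" and nz: "nnz A > 0"
  shows "computes_sketch_within sketch_prog (15 * nnz A) s A h c"
  unfolding computes_sketch_within_def
proof (intro allI impI, elim conjE)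
  fix es assume es: "distinct es" "set es = nonzero_positions A"
  have pos: "fst e < n" "snd e < d" if "e \<in> set es" for e
    using that A unfolding es(2) nonzero_positions_def by auto
  have len: "length es = nnz A" using es distinct_card[OF es(1)] by (simp add: nnz_def)
  have "sketch_inv s A es h c 0 (input_state s A es h c)"
    by (simp add: sketch_inv_def input_state_def)
  then obtain st where st: "exec sketch_prog (input_state s A es h c) (14 * length es + 1) st"
    "sketch_inv s A es h c (length es) st"
    using exec_sketch_prog[of es A s h c 0 "input_state s A es h c"] pos(1) A by auto
  have "14 * length es + 1 \<le> 15 * nnz A" using len nz by simp
  moreover have "outputs_mat st (sparse_cauchy s (dim_row A) h c * A)"
    unfolding outputs_mat_def
  proof (intro allI impI)
    fix k j
    assume "k < dim_row (sparse_cauchy s (dim_row A) h c * A)" "j < dim_col (sparse_cauchy s (dim_row A) h c * A)"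
    hence k: "k < s" and j: "j < d"
      using A sparse_cauchy_carrier[of s n h c] by auto
    have dimc: "dim_col (sparse_cauchy s (dim_row A) h c * A) = d" using A by simp
    \<comment> \<open>Row-major addresses determine row and column because the column index is below
      \<open>d\<close>: division by \<open>d\<close> recovers the row.\<close>
    have iff: "h (fst e) * d + snd e = k * d + j \<longleftrightarrow> h (fst e) = k \<and> snd e = j" if "e \<in> set es" for e
    proof
      assume eq: "h (fst e) * d + snd e = k * d + j"
      have "h (fst e) = (h (fst e) * d + snd e) div d" using pos[OF that] by simp
      also have "\<dots> = k" unfolding eq using j by simp
      finally show "h (fst e) = k \<and> snd e = j" using eq by simp
    qed auto
    have "rarr st ''out'' (k * d + j) =
      (\<Sum>e\<leftarrow>es. if h (fst e) * d + snd e = k * d + j then c (fst e) * A $$ e else 0)"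
      using st(2) A by (simp add: sketch_inv_def)
    also have "\<dots> = (\<Sum>e\<in>set es. if h (fst e) * d + snd e = k * d + j then c (fst e) * A $$ e else 0)"
      by (rule sum_list_distinct_conv_sum_set[OF es(1)])
    also have "\<dots> = (\<Sum>e\<in>set es. if h (fst e) = k \<and> snd e = j then c (fst e) * A $$ e else 0)"
      using iff by (intro sum.cong refl) auto
    also have "\<dots> = (\<Sum>e\<in>{..<n} \<times> {..<d}. if h (fst e) = k \<and> snd e = j then c (fst e) * A $$ e else 0)"
      using A unfolding es(2) nonzero_positions_def by (intro sum.mono_neutral_left) auto
    also have "\<dots> = (\<Sum>i<n. \<Sum>j'<d. if h i = k \<and> j' = j then c i * A $$ (i, j') else 0)"
      by (simp only: sum.cartesian_product case_prod_unfold prod.collapse)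
    also have "\<dots> = (\<Sum>i<n. (if h i = k then c i else 0) * A $$ (i, j))"
    proof (intro sum.cong refl)
      fix i
      have "(\<Sum>j'<d. if h i = k \<and> j' = j then c i * A $$ (i, j') else 0) =
        (\<Sum>j'<d. if j' = j then (if h i = k then c i else 0) * A $$ (i, j') else 0)"
        by (intro sum.cong) auto
      thus "(\<Sum>j'<d. if h i = k \<and> j' = j then c i * A $$ (i, j') else 0) = (if h i = k then c i else 0) * A $$ (i, j)"
        using j by simp
    qed
    also have "\<dots> = (sparse_cauchy s n h c * A) $$ (k, j)"
      using A j k sparse_cauchy_carrier[of s n h c] h
      by (auto simp: scalar_prod_def atLeast0LessThan sparse_cauchy_index intro!: sum.cong)
    finally show "rarr st ''out'' (k * dim_col (sparse_cauchy s (dim_row A) h c * A) + j) =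
      (sparse_cauchy s (dim_row A) h c * A) $$ (k, j)"
      unfolding dimc using A by simp
  qed
  ultimately show "\<exists>t st. exec sketch_prog (input_state s A es h c) t st \<and> t \<le> 15 * nnz A \<and>
      outputs_mat st (sparse_cauchy s (dim_row A) h c * A)"
    using st(1) by blast
qed

text \<open>With at least one nonzero entry, the cost of the last guard is covered by a multiple of
  \<open>nnz A\<close>. A matrix without nonzero entries would have rank 0.\<close>

lemma nnz_pos:
  assumes A: "A \<in> carrier_mat n d" and r: "full_column_rank A" and d: "d > 0"
  shows "nnz A > 0"
proof (rule ccontr)
  assume "\<not> nnz A > 0"
  moreover have "nonzero_positions A \<subseteq> {..<n} \<times> {..<d}" using A by (auto simp: nonzero_positions_def)
  hence "finite (nonzero_positions A)" by (rule finite_subset) simp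
  ultimately have "nonzero_positions A = {}" by (simp add: nnz_def)
  hence "A = 0\<^sub>m n d" using A by (intro eq_matI) (auto simp: nonzero_positions_def)
  hence "vec_space.rank n A = 0" using vec_space.rank_0I by metis
  thus False using r A d by (simp add: full_column_rank_def)
qed

section \<open>Embedding probability\<close>

lemma l1_norm_mult_vec:
  assumes A: "A \<in> carrier_mat n d"
  shows "l1_norm (A *\<^sub>v vec d f) = (\<Sum>i<n. \<bar>\<Sum>j<d. A $$ (i, j) * f j\<bar>)"
proof -
  have "(A *\<^sub>v vec d f) $ i = (\<Sum>j<d. A $$ (i, j) * f j)" if "i < n" for i
    using A that by (simp add: scalar_prod_def atLeast0LessThan)
  moreover have "dim_vec (A *\<^sub>v vec d f) = n" using A by simp
  ultimately show ?thesis unfolding l1_norm_def by (metis (no_types, lifting) lessThan_iff sum.cong)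
qed

text \<open>Summing over all rows with a 0/1 factor separates the hash function, which enters
  measurably, from the vector, which enters continuously; this form is used to show that the
  embedding event is measurable.\<close>

lemma l1_norm_sketch_mult_vec:
  assumes A: "A \<in> carrier_mat n d" and h: "\<And>i. i < n \<Longrightarrow> h i < s"
  shows "l1_norm (sparse_cauchy s n h c *\<^sub>v (A *\<^sub>v vec d f)) =
    (\<Sum>k<s. \<bar>\<Sum>i<n. (if h i = k then 1 else 0) * ((\<Sum>j<d. A $$ (i, j) * f j) * c i)\<bar>)"
proof -
  have y: "A *\<^sub>v vec d f \<in> carrier_vec n" using A by simp
  have Ai: "(A *\<^sub>v vec d f) $ i = (\<Sum>j<d. A $$ (i, j) * f j)" if "i < n" for i
    using A that by (simp add: scalar_prod_def atLeast0LessThan)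
  have "(\<Sum>i | i < n \<and> h i = k. (A *\<^sub>v vec d f) $ i * c i) =
      (\<Sum>i<n. (if h i = k then 1 else 0) * ((\<Sum>j<d. A $$ (i, j) * f j) * c i))" for k
    using Ai by (intro sum.mono_neutral_cong_left) (auto simp del: index_mult_mat_vec)
  thus ?thesis using l1_norm_sparse_cauchy[OF h y] by (simp del: index_mult_mat_vec)
qed

lemma space_sparse_cauchy_space:
  "(h, c) \<in> space (sparse_cauchy_space s n) \<longleftrightarrow> h \<in> space (hash_PiM s n) \<and> c \<in> space (cauchy_PiM {..<n})"
  by (simp add: sparse_cauchy_space_def space_pair_measure)

lemma space_hash_PiM_less: "h \<in> space (hash_PiM s n) \<Longrightarrow> i < n \<Longrightarrow> h i < s"
  unfolding space_hash_PiM by (drule PiE_mem[of _ _ _ i]) auto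

definition embeds :: "nat \<Rightarrow> nat \<Rightarrow> nat \<Rightarrow> real mat \<Rightarrow> real \<Rightarrow> real \<Rightarrow> (nat \<Rightarrow> nat) \<Rightarrow> (nat \<Rightarrow> real) \<Rightarrow> bool" where
  "embeds s n d A lo up h c \<longleftrightarrow> (\<forall>x\<in>carrier_vec d.
     lo * l1_norm (A *\<^sub>v x) \<le> l1_norm (sparse_cauchy s n h c *\<^sub>v (A *\<^sub>v x)) \<and>
     l1_norm (sparse_cauchy s n h c *\<^sub>v (A *\<^sub>v x)) \<le> up * l1_norm (A *\<^sub>v x))"

text \<open>
  The quantifier over all vectors reduces to a countable dense set, since both norms are continuous in the vector.
\<close>

lemma sets_embeds:
  assumes A: "A \<in> carrier_mat n d"
  shows "{(h, c) \<in> space (sparse_cauchy_space s n). embeds s n d A lo up h c} \<in> sets (sparse_cauchy_space s n)"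
proof -
  let ?M = "sparse_cauchy_space s n"
  define N where "N f = (\<Sum>i<n. \<bar>\<Sum>j<d. A $$ (i, j) * f j\<bar>)" for f
  define S where "S f p = (\<Sum>k<s. \<bar>\<Sum>i<n. (if fst p i = k then 1 else 0) * ((\<Sum>j<d. A $$ (i, j) * f j) * snd p i)\<bar>)"
    for f and p :: "(nat \<Rightarrow> nat) \<times> (nat \<Rightarrow> real)"
  define Q where "Q f p \<longleftrightarrow> lo * N f \<le> S f p \<and> S f p \<le> up * N f" for f p
  have emb: "embeds s n d A lo up h c \<longleftrightarrow> (\<forall>f. Q f (h, c))" if "(h, c) \<in> space ?M" for h c
  proof -
    have "h \<in> space (hash_PiM s n)" using that by (simp add: space_sparse_cauchy_space)
    hence h: "h i < s" if "i < n" for i using that by (rule space_hash_PiM_less)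
    have sk: "l1_norm (sparse_cauchy s n h c *\<^sub>v (A *\<^sub>v vec d f)) = S f (h, c)" for f
      unfolding S_def fst_conv snd_conv by (rule l1_norm_sketch_mult_vec[OF A]) (rule h)
    have Q: "Q f (h, c) \<longleftrightarrow> lo * l1_norm (A *\<^sub>v vec d f) \<le> l1_norm (sparse_cauchy s n h c *\<^sub>v (A *\<^sub>v vec d f)) \<and>
       l1_norm (sparse_cauchy s n h c *\<^sub>v (A *\<^sub>v vec d f)) \<le> up * l1_norm (A *\<^sub>v vec d f)" for f
      unfolding Q_def sk N_def l1_norm_mult_vec[OF A] ..
    have "x = vec d (\<lambda>i. x $ i)" if "x \<in> carrier_vec d" for x :: "real vec"
      using that by (intro eq_vecI) auto
    thus ?thesis unfolding embeds_def Q by (metis vec_carrier)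
  qed
  \<comment> \<open>Vectors are represented by functions on all naturals with the product topology,
    where a countable dense set exists.\<close>
  obtain D :: "(nat \<Rightarrow> real) set" where D: "countable D" "\<And>X. open X \<Longrightarrow> X \<noteq> {} \<Longrightarrow> \<exists>f\<in>D. f \<in> X"
    using countable_dense_exists by metis
  have dense: "(\<forall>f. Q f p) \<longleftrightarrow> (\<forall>f\<in>D. Q f p)" for p
  proof
    assume "\<forall>f\<in>D. Q f p"
    have c1: "continuous_on UNIV N" unfolding N_def
      by (intro continuous_intros continuous_on_product_coordinates)
    have c2: "continuous_on UNIV (\<lambda>f. S f p)" unfolding S_def
      by (intro continuous_intros continuous_on_product_coordinates)
    have "closed {f. Q f p}"
      unfolding Q_def by (intro closed_Collect_conj closed_Collect_le continuous_on_mult_left c1 c2)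
    hence "open (- {f. Q f p})" by (rule open_Compl)
    hence "- {f. Q f p} = {}" using D(2)[of "- {f. Q f p}"] \<open>\<forall>f\<in>D. Q f p\<close> by blast
    thus "\<forall>f. Q f p" by blast
  qed blast
  have meas: "S f \<in> borel_measurable ?M" for f
    unfolding S_def sparse_cauchy_space_def
  proof (intro borel_measurable_sum borel_measurable_abs borel_measurable_times borel_measurable_const)
    fix i k assume i: "i \<in> {..<n}"
    show "(\<lambda>p. if fst p i = k then 1 else 0 :: real) \<in> borel_measurable (hash_PiM s n \<Otimes>\<^sub>M cauchy_PiM {..<n})"
      by (rule measurable_compose[OF measurable_fst measurable_hash_PiM])
    show "(\<lambda>p. snd p i) \<in> borel_measurable (hash_PiM s n \<Otimes>\<^sub>M cauchy_PiM {..<n})"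
      by (rule measurable_compose[OF measurable_snd measurable_cauchy_component[OF i]])
  qed
  have "{(h, c) \<in> space ?M. embeds s n d A lo up h c} = {p \<in> space ?M. \<forall>f\<in>D. Q f p}"
    using emb dense by auto
  also have "\<dots> \<in> sets ?M"
  proof (rule sets.sets_Collect_countable_All'[OF _ D(1)])
    fix f
    have "{p \<in> space ?M. lo * N f \<le> S f p} \<in> sets ?M" "{p \<in> space ?M. S f p \<le> up * N f} \<in> sets ?M"
      by (intro borel_measurable_le borel_measurable_const meas)+
    moreover have "{p \<in> space ?M. Q f p} = {p \<in> space ?M. lo * N f \<le> S f p} \<inter> {p \<in> space ?M. S f p \<le> up * N f}"
      unfolding Q_def by blast
    ultimately show "{p \<in> space ?M. Q f p} \<in> sets ?M" by simp
  qed
  finally show ?thesis .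
qed

text \<open>The basis depends on \<open>A\<close> alone and is chosen before any randomness. For
  each good hash function the fibre of the embedding event has probability at least 1/4, and
  integrating over the hash functions, half of which in probability are good, gives 1/8. The choice
  of \<open>\<beta>\<close> turns the noise condition into an equality.\<close>

lemma prob_embeds:
  fixes d s :: nat and \<tau> t :: real and q :: nat
  defines "b \<equiv> 2 * real d"
  defines "\<eta> \<equiv> \<tau> / (8 * b)"
  defines "\<beta> \<equiv> \<eta> / (4 * t)"
  assumes A: "A \<in> carrier_mat n d" "full_column_rank A" and d: "d > 0" and s: "s > 0"
    and \<tau>: "\<tau> > 0" and \<beta>: "\<beta> \<le> 1 / 8" and \<eta>: "\<eta> \<le> 1 / 64"
    and t: "t \<ge> 1" "t \<ge> 8 * ln (1 + 64 * (real s * real d)\<^sup>2)"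
    and q: "real q \<ge> 256 * t * b"
    and net: "real (2 * q + 1) ^ d * exp (- 1 / (256 * \<tau>)) \<le> 1 / 8"
    and s_large: "3 * b\<^sup>2 / \<tau>\<^sup>2 + 2 * b\<^sup>2 / (\<tau> * \<beta>) \<le> real s"
    and lo: "lo \<le> \<eta> / 4" and up: "t * b \<le> up"
  shows "measure (sparse_cauchy_space s n) {(h, c) \<in> space (sparse_cauchy_space s n). embeds s n d A lo up h c} \<ge> 1 / 8"
proof -
  let ?H = "hash_PiM s n" and ?C = "cauchy_PiM {..<n}" and ?M = "sparse_cauchy_space s n"
  let ?G = "{(h, c) \<in> space ?M. embeds s n d A lo up h c}"
  interpret H: prob_space ?H using s by (rule prob_space_hash_PiM)
  interpret C: prob_space ?C by (rule prob_space_cauchy_PiM)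
  interpret HC: pair_prob_space ?H ?C ..
  have b: "b > 0" using d by (simp add: b_def)
  have \<eta>0: "\<eta> > 0" using \<tau> b by (simp add: \<eta>_def)
  have \<beta>0: "\<beta> > 0" using \<eta>0 t by (simp add: \<beta>_def)
  obtain U where U: "(\<Sum>i<n. \<Sum>j<d. \<bar>U i j\<bar>) \<le> 2 * real d"
    "\<And>x j. j < d \<Longrightarrow> \<bar>x j\<bar> \<le> (\<Sum>i<n. \<bar>\<Sum>j<d. U i j * x j\<bar>)"
    "\<And>x. x \<in> carrier_vec d \<Longrightarrow> \<exists>y. A *\<^sub>v x = vec n (\<lambda>i. \<Sum>j<d. U i j * y j)"
    using well_conditioned_basis[OF A] by blast
  interpret B: conditioned_basis n d s U b
    using U d s b by unfold_locales (auto simp: b_def)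
  define good where "good h \<longleftrightarrow> good_hash n B.row_weight \<tau> \<beta> h" for h
  have good_ev: "{h \<in> space ?H. good h} \<in> sets ?H"
    by (simp add: sets_hash_PiM space_hash_PiM subset_iff)
  have good_prob: "H.prob {h \<in> space ?H. good h} \<ge> 1 / 2"
    unfolding good_def by (rule prob_good_hash[OF s B.row_weight_nonneg B.sum_row_weight \<tau> \<beta>0 s_large])
  have G: "?G \<in> sets (?H \<Otimes>\<^sub>M ?C)"
    using sets_embeds[OF A(1)] by (simp add: sparse_cauchy_space_def)
  have fibre: "emeasure ?C (Pair h -` ?G) \<ge> ennreal (1 / 4)" if hH: "h \<in> space ?H" "good h" for h
  proof -
    have hs: "h i < s" if "i < n" for i using space_hash_PiM_less[OF hH(1) that] .
    have "q > 0"
    proof -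
      have "256 * t * b > 0" using t b by simp
      thus ?thesis using q by (cases q) auto
    qed
    then interpret hashed_basis n d s U b h \<tau> \<beta> \<eta> t q
      using hs hH(2) \<tau> \<beta> \<eta> t q net unfolding good_def
      by unfold_locales (auto simp: \<eta>_def \<beta>_def)
    obtain E where E: "E \<in> sets ?C" "C.prob E \<ge> 1 / 4" "\<And>c. c \<in> E \<Longrightarrow> typical c"
      using prob_typical by blast
    have "embeds s n d A lo up h c" if c: "c \<in> E" for c
      unfolding embeds_def
    proof
      fix x :: "real vec" assume "x \<in> carrier_vec d"
      then obtain y where "A *\<^sub>v x = vec n (\<lambda>i. \<Sum>j<d. U i j * y j)" using U(3) by blast
      hence Ax: "A *\<^sub>v x = vec n (B.comb y)" by (simp add: B.comb_def[abs_def])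
      define N where "N = (\<Sum>i<n. \<bar>B.comb y i\<bar>)"
      have N0: "N \<ge> 0" by (simp add: N_def sum_nonneg)
      have l1: "l1_norm (A *\<^sub>v x) = N" unfolding Ax by (simp add: l1_norm_def N_def)
      have "(\<Sum>i | i < n \<and> h i = k. vec n (B.comb y) $ i * c i) = (\<Sum>i | i < n \<and> h i = k. B.comb y i * c i)" for k
        by (intro sum.cong) auto
      hence l2: "l1_norm (sparse_cauchy s n h c *\<^sub>v (A *\<^sub>v x)) = B.sketch_norm h c (B.comb y)"
        unfolding Ax B.sketch_norm_def using l1_norm_sparse_cauchy[where y = "vec n (B.comb y)" and c = c and h = h and s = s and n = n, OF hs] by simp
      have "lo * N \<le> \<eta> / 4 * N" "t * b * N \<le> up * N" by (rule mult_right_mono[OF lo N0], rule mult_right_mono[OF up N0])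
      thus "lo * l1_norm (A *\<^sub>v x) \<le> l1_norm (sparse_cauchy s n h c *\<^sub>v (A *\<^sub>v x)) \<and>
         l1_norm (sparse_cauchy s n h c *\<^sub>v (A *\<^sub>v x)) \<le> up * l1_norm (A *\<^sub>v x)"
        unfolding l1 l2 using typical_bounds[OF E(3)[OF c], of y] unfolding N_def by linarith
    qed
    moreover have "(h, c) \<in> space ?M" if "c \<in> E" for c
      using sets.sets_into_space[OF E(1)] hH(1) that by (simp only: space_sparse_cauchy_space subset_iff)
    ultimately have "E \<subseteq> Pair h -` ?G" by (simp add: subset_iff)
    hence "emeasure ?C E \<le> emeasure ?C (Pair h -` ?G)"
      by (rule emeasure_mono) (rule sets_Pair1[OF G])
    moreover have "ennreal (1 / 4) \<le> emeasure ?C E"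
      using E(2) unfolding C.emeasure_eq_measure by (rule ennreal_leI)
    ultimately show ?thesis by (rule order_trans[rotated])
  qed
  have "ennreal (1 / 8) \<le> ennreal (1 / 4) * ennreal (H.prob {h \<in> space ?H. good h})"
    using good_prob by (subst ennreal_mult'[symmetric]) (auto intro!: ennreal_leI)
  also have "\<dots> = (\<integral>\<^sup>+h. ennreal (1 / 4) * indicator {h \<in> space ?H. good h} h \<partial>?H)"
    using good_ev by (simp add: nn_integral_cmult_indicator H.emeasure_eq_measure)
  also have "\<dots> \<le> (\<integral>\<^sup>+h. emeasure ?C (Pair h -` ?G) \<partial>?H)"
    using fibre by (intro nn_integral_mono) (auto simp: indicator_def)
  also have "\<dots> = emeasure (?H \<Otimes>\<^sub>M ?C) ?G"
    using G by (rule C.emeasure_pair_measure_alt[symmetric])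
  finally have "ennreal (1 / 8) \<le> ennreal (measure (?H \<Otimes>\<^sub>M ?C) ?G)"
    by (simp add: HC.emeasure_eq_measure)
  thus ?thesis unfolding sparse_cauchy_space_def[symmetric] by (simp add: ennreal_le_iff)
qed

section \<open>Choice of the parameters in terms of the dimension and the leading constant\<close>

lemma sketch_size_bounds:
  assumes d: "d \<ge> 2" and \<omega>: "\<omega> \<ge> 1"
  shows "\<omega> * real d ^ 5 * ln (real d) ^ 5 \<le> real (sketch_size \<omega> d)"
    and "real (sketch_size \<omega> d) \<le> 2 * \<omega> * real d ^ 10"
    and "sketch_size \<omega> d > 0"
proof -
  define L where "L = ln (real d)"
  have L: "0 < L" "L \<le> real d" using d ln_le_minus_one[of "real d"] by (auto simp: L_def)
  have x: "\<omega> * real d ^ 5 * L ^ 5 > 0" using \<omega> d L by simp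
  have "real (sketch_size \<omega> d) = of_int \<lceil>\<omega> * real d ^ 5 * L ^ 5\<rceil>"
    unfolding sketch_size_def L_def[symmetric] using x by (simp add: of_nat_nat)
  hence b: "\<omega> * real d ^ 5 * L ^ 5 \<le> real (sketch_size \<omega> d)" "real (sketch_size \<omega> d) \<le> \<omega> * real d ^ 5 * L ^ 5 + 1"
    by linarith+
  thus "\<omega> * real d ^ 5 * ln (real d) ^ 5 \<le> real (sketch_size \<omega> d)" by (simp add: L_def)
  show "sketch_size \<omega> d > 0" using b(1) x by (cases "sketch_size \<omega> d") auto
  \<comment> \<open>The upper bound on the sketch size is used only inside a logarithm, so bounding
    each \<open>L\<close> by the dimension is affordable.\<close>
  have "L ^ 5 \<le> real d ^ 5" using L by (intro power_mono) auto
  hence "\<omega> * real d ^ 5 * L ^ 5 \<le> \<omega> * real d ^ 5 * real d ^ 5" using \<omega> by (intro mult_left_mono) auto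
  also have "\<dots> = \<omega> * real d ^ 10" by (simp flip: power_add)
  finally have 1: "\<omega> * real d ^ 5 * L ^ 5 \<le> \<omega> * real d ^ 10" .
  have "1 \<le> real d ^ 10" using d by (intro one_le_power) simp
  hence "1 * 1 \<le> \<omega> * real d ^ 10" using \<omega> by (intro mult_mono) auto
  thus "real (sketch_size \<omega> d) \<le> 2 * \<omega> * real d ^ 10" using b(2) 1 by simp
qed

lemma ln_le_of_le_power2:
  fixes x :: real
  assumes "0 < x" "x \<le> 2 ^ k"
  shows "ln x \<le> real k"
proof -
  have "ln x \<le> ln (2 ^ k)" using assms by simp
  also have "\<dots> = real k * ln 2" by (simp add: ln_realpow)
  also have "\<dots> \<le> real k * 1" using ln_2_less_1 by (intro mult_left_mono) auto
  finally show ?thesis by simp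
qed

lemma ln_two_ge_half: "ln (2::real) \<ge> 1 / 2"
  using ln2_ge_two_thirds by simp

text \<open>The argument is at most \<open>2 ^ 9 * (\<omega>\<^sup>2 * real d ^ 22)\<close>. Taking
  logarithms, \<open>L \<ge> 1 / 2\<close> absorbs the constant 9 and the term
  \<open>2 * ln \<omega>\<close> into a multiple of \<open>L\<close>, which yields the coefficients
  320 and 32 after multiplying by 8.\<close>

lemma log_factor_bound:
  assumes d: "d \<ge> 2" and \<omega>: "\<omega> \<ge> 1" and s: "real s \<le> 2 * \<omega> * real d ^ 10"
  shows "8 * ln (1 + 64 * (real s * real d)\<^sup>2) \<le> (320 + 32 * ln \<omega>) * ln (real d)"
proof -
  define L where "L = ln (real d)"
  have "ln 2 \<le> L" unfolding L_def using d by simp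
  hence L: "L \<ge> 1 / 2" using ln_two_ge_half by linarith
  have lw: "ln \<omega> \<ge> 0" using \<omega> by simp
  have "real s * real d \<le> 2 * \<omega> * real d ^ 10 * real d" using s by (intro mult_right_mono) auto
  also have "\<dots> = 2 * \<omega> * real d ^ 11" by (simp add: eval_nat_numeral)
  finally have "(real s * real d)\<^sup>2 \<le> (2 * \<omega> * real d ^ 11)\<^sup>2" by (intro power_mono) auto
  also have "\<dots> = 4 * \<omega>\<^sup>2 * real d ^ 22" by (simp add: power_mult_distrib flip: power_mult)
  finally have 1: "(real s * real d)\<^sup>2 \<le> 4 * \<omega>\<^sup>2 * real d ^ 22" .
  have "1 \<le> \<omega>\<^sup>2" "1 \<le> real d ^ 22" using \<omega> d by (auto intro!: one_le_power)
  hence "1 * 1 \<le> \<omega>\<^sup>2 * real d ^ 22" by (intro mult_mono) auto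
  hence "1 + 64 * (real s * real d)\<^sup>2 \<le> 2 ^ 9 * (\<omega>\<^sup>2 * real d ^ 22)" using 1 by simp
  hence "ln (1 + 64 * (real s * real d)\<^sup>2) \<le> ln (2 ^ 9 * (\<omega>\<^sup>2 * real d ^ 22))"
    by (intro ln_mono) (auto simp: add_pos_nonneg)
  also have "\<dots> = ln (2 ^ 9) + 2 * ln \<omega> + 22 * L"
    using \<omega> d by (simp add: ln_mult ln_realpow L_def)
  also have "\<dots> \<le> 9 + 2 * ln \<omega> + 22 * L" using ln_le_of_le_power2[of "2 ^ 9" 9] by simp
  also have "\<dots> \<le> (40 + 4 * ln \<omega>) * L"
    using L mult_left_mono[OF L, of "4 * ln \<omega>"] lw by (simp add: algebra_simps)
  finally show ?thesis by (simp add: L_def algebra_simps)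
qed

text \<open>There is an apparent circularity: the number of buckets must be large in terms of
  \<open>t\<close>, while \<open>t\<close> depends on that number. The dependence is logarithmic, so
  the condition on \<open>\<omega>\<close> is only that it exceeds a cube of \<open>T\<close>, a
  polynomial in its own logarithm.\<close>

lemma sketch_embeds_probability:
  fixes \<omega> :: real
  assumes A: "A \<in> carrier_mat n d" "full_column_rank A" and d: "d \<ge> 2" and \<omega>: "\<omega> \<ge> 1"
  defines "T \<equiv> 320 + 32 * ln \<omega>"
  assumes \<omega>_large: "2 ^ 32 * T ^ 3 \<le> \<omega>"
  defines "s \<equiv> sketch_size \<omega> d"
  shows "measure (sparse_cauchy_space s n) {(h, c) \<in> space (sparse_cauchy_space s n).
    embeds s n d A (1 / (131072 * T * real d ^ 2 * ln (real d) ^ 2)) (2 * T * real d * ln (real d)) h c} \<ge> 1 / 8"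
proof -
  define L where "L = ln (real d)"
  define D where "D = real d"
  define t where "t = T * L"
  \<comment> \<open>Chosen such that \<open>1 / (256 * \<tau>) = 4 * X\<close>, against a grid of at
    most \<open>exp (3 * X)\<close> points; the union bound then leaves
    \<open>exp (- X)\<close>.\<close>
  define \<tau> where "\<tau> = 1 / (1024 * T * D * L)"
  define q where "q = nat \<lceil>256 * t * (2 * D)\<rceil>"
  define X where "X = T * D * L"
  have D: "D \<ge> 2" using d by (simp add: D_def)
  have T: "T \<ge> 320" using \<omega> by (simp add: T_def)
  have "ln 2 \<le> L" unfolding L_def using d by simp
  hence L: "L \<ge> 1 / 2" using ln_two_ge_half by linarith
  have LD: "L \<le> D" using d ln_le_minus_one[of "real d"] by (simp add: L_def D_def)
  have DL: "D * L \<ge> 1" using mult_mono[OF D L] D by simp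
  have X: "X \<ge> 320" using mult_mono[OF T DL] T by (simp add: X_def mult.assoc)
  have TL: "T * L \<ge> 160" using mult_mono[OF T L] T by simp
  note ss = sketch_size_bounds[OF d \<omega>, folded s_def]
  have \<eta>: "\<tau> / (8 * (2 * D)) = 1 / (16384 * X * D)"
    by (simp add: \<tau>_def X_def field_simps)
  have \<beta>: "\<tau> / (8 * (2 * D)) / (4 * t) = 1 / (65536 * X\<^sup>2)"
    unfolding \<eta> by (simp add: t_def X_def power2_eq_square field_simps)
  show ?thesis
  proof (rule prob_embeds[where d = d and \<tau> = \<tau> and t = t and q = q, folded D_def, unfolded \<beta>])
    show "d > 0" using d by simp
    show "s > 0" by (rule ss(3))
    show "\<tau> > 0" using T D L by (simp add: \<tau>_def)
    have "X\<^sup>2 \<ge> 1" using X by (intro one_le_power) simp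
    thus "1 / (65536 * X\<^sup>2) \<le> 1 / 8" by (simp add: divide_le_eq)
    have XD: "X * D \<ge> 640" using mult_mono[OF X D] X by simp
    thus "\<tau> / (8 * (2 * D)) \<le> 1 / 64" unfolding \<eta> using XD by (simp add: field_simps)
    show "t \<ge> 1" using TL by (simp add: t_def)
    show "t \<ge> 8 * ln (1 + 64 * (real s * D)\<^sup>2)"
      using log_factor_bound[OF d \<omega> ss(2)] by (simp add: t_def T_def L_def D_def)
    show "real q \<ge> 256 * t * (2 * D)" unfolding q_def by (rule real_nat_ceiling_ge)
    show "real (2 * q + 1) ^ d * exp (- 1 / (256 * \<tau>)) \<le> 1 / 8"
    proof -
      have \<tau>X: "- 1 / (256 * \<tau>) = - 4 * X"
        using T D L by (simp add: \<tau>_def X_def field_simps)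
      have tD: "t * D \<ge> 320" using X by (simp add: t_def X_def mult_ac)
      have "256 * t * (2 * D) \<ge> 0" using tD by simp
      hence "real q = of_int \<lceil>256 * t * (2 * D)\<rceil>" by (simp add: q_def of_nat_nat)
      hence "real q \<le> 256 * t * (2 * D) + 1" by linarith
      \<comment> \<open>Rounding \<open>q\<close> up adds at most 1, and \<open>tD\<close> absorbs
        the resulting constant 3.\<close>
      hence "real (2 * q + 1) \<le> 2048 * (t * D)" using tD by simp
      also have "\<dots> \<le> 2048 * (T * (D * D))"
        using LD T D by (simp add: t_def mult.assoc mult_left_mono mult_mono)
      finally have "ln (real (2 * q + 1)) \<le> ln (2048 * (T * (D * D)))" by (intro ln_mono) auto
      also have "\<dots> = ln 2048 + ln T + 2 * L"
        using T D by (simp add: ln_mult L_def D_def)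
      also have "\<dots> \<le> 11 + T + 2 * L"
        using ln_le_of_le_power2[of 2048 11] ln_le_minus_one[of T] T by simp
      also have "\<dots> \<le> 3 * (T * L)"
      proof -
        have "T * (1 / 2) \<le> T * L" "320 * L \<le> T * L"
          using T L by (auto intro!: mult_left_mono mult_right_mono)
        thus ?thesis using L by linarith
      qed
      finally have lq: "ln (real (2 * q + 1)) \<le> 3 * (T * L)" .
      have "real (2 * q + 1) ^ d = exp (D * ln (real (2 * q + 1)))"
        by (simp add: D_def exp_of_nat_mult)
      also have "\<dots> \<le> exp (D * (3 * (T * L)))" using lq D by (simp add: mult_left_mono)
      also have "D * (3 * (T * L)) = 3 * X" by (simp add: X_def)
      finally have "real (2 * q + 1) ^ d * exp (- 4 * X) \<le> exp (3 * X) * exp (- 4 * X)"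
        by (intro mult_right_mono) auto
      also have "exp (3 * X) * exp (- 4 * X) = exp (- X)" by (simp flip: exp_add)
      also have "\<dots> \<le> 1 / 8"
      proof -
        have "8 \<le> exp X" using exp_ge_add_one_self[of X] X by linarith
        thus ?thesis by (simp add: exp_minus field_simps)
      qed
      finally show ?thesis unfolding \<tau>X .
    qed
    show "3 * (2 * D)\<^sup>2 / \<tau>\<^sup>2 + 2 * (2 * D)\<^sup>2 / (\<tau> * (1 / (65536 * X\<^sup>2))) \<le> real s"
    proof -
      have \<tau>X: "\<tau> = 1 / (1024 * X)" by (simp add: \<tau>_def X_def mult.assoc)
      have "3 * (2 * D)\<^sup>2 / \<tau>\<^sup>2 + 2 * (2 * D)\<^sup>2 / (\<tau> * (1 / (65536 * X\<^sup>2))) =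
          12582912 * (D\<^sup>2 * X\<^sup>2) + 536870912 * (D\<^sup>2 * X ^ 3)"
        using X unfolding \<tau>X by (simp add: field_simps eval_nat_numeral)
      also have "\<dots> \<le> 1073741824 * (D\<^sup>2 * X ^ 3)"
      proof -
        have "D\<^sup>2 * X\<^sup>2 \<le> D\<^sup>2 * X ^ 3"
          using X by (intro mult_left_mono power_increasing) auto
        moreover have "0 \<le> D\<^sup>2 * X ^ 3" using X by (intro mult_nonneg_nonneg) auto
        ultimately show ?thesis by linarith
      qed
      \<comment> \<open>The dominant term \<open>D\<^sup>2 * X ^ 3\<close> is the source of the
        fifth power of the dimension. The factor 1/4 is then bounded by \<open>L\<^sup>2\<close>,
        which completes \<open>L ^ 3\<close> to \<open>L ^ 5\<close>.\<close>
      also have "\<dots> = (2 ^ 32 * T ^ 3) * (1 / 4) * (D ^ 5 * L ^ 3)"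
        by (simp add: X_def eval_nat_numeral)
      also have "\<dots> \<le> \<omega> * L\<^sup>2 * (D ^ 5 * L ^ 3)"
      proof (intro mult_right_mono mult_mono)
        show "1 / 4 \<le> L\<^sup>2" using power_mono[OF L, of 2] by (simp add: power2_eq_square)
      qed (use \<omega>_large \<omega> D L in auto)
      also have "\<dots> = \<omega> * D ^ 5 * L ^ 5" by (simp add: eval_nat_numeral)
      also have "\<dots> \<le> real s" using ss(1) by (simp add: D_def L_def)
      finally show ?thesis .
    qed
    show "1 / (131072 * T * real d ^ 2 * ln (real d) ^ 2) \<le> \<tau> / (8 * (2 * D)) / 4"
    proof -
      \<comment> \<open>The bound obtained has a single logarithm; \<open>1 \<le> 2 * L\<close>
        brings it to the stated form with a squared logarithm.\<close>
      have "65536 * (X * D) * 1 \<le> 65536 * (X * D) * (2 * L)"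
        using L X D by (intro mult_left_mono) auto
      also have "\<dots> = 131072 * T * D ^ 2 * L ^ 2" by (simp add: X_def power2_eq_square)
      finally have "1 / (131072 * T * D ^ 2 * L ^ 2) \<le> 1 / (65536 * (X * D))"
        using X D by (intro frac_le) auto
      thus ?thesis unfolding \<eta> by (simp add: L_def D_def)
    qed
    show "t * (2 * D) \<le> 2 * T * real d * ln (real d)" by (simp add: t_def L_def D_def)
  qed (rule A)+
qed

theorem theorem2:
  shows "\<exists>(p::real) (\<omega>\<^sub>0::real) (P::prog) (K::nat). p > 0 \<and> \<omega>\<^sub>0 > 0 \<and>
    (\<forall>\<omega>\<ge>\<omega>\<^sub>0. \<exists>(c\<^sub>1::real) (c\<^sub>2::real). c\<^sub>1 > 0 \<and> c\<^sub>2 > 0 \<and>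
      (\<forall>(n::nat) (d::nat) (A::real mat).
        d \<ge> 2 \<and> A \<in> carrier_mat n d \<and> full_column_rank A \<longrightarrow>
        (let s = sketch_size \<omega> d; M = sparse_cauchy_space s n in
          measure M {(h, c) \<in> space M. \<forall>x \<in> carrier_vec d.
              1 / (c\<^sub>1 * real d ^ 2 * ln (real d) ^ 2) * l1_norm (A *\<^sub>v x)
                \<le> l1_norm (sparse_cauchy s n h c *\<^sub>v (A *\<^sub>v x)) \<and>
              l1_norm (sparse_cauchy s n h c *\<^sub>v (A *\<^sub>v x))
                \<le> c\<^sub>2 * real d * ln (real d) * l1_norm (A *\<^sub>v x)} \<ge> p \<and>
          (\<forall>(h, c) \<in> space M. computes_sketch_within P (K * nnz A) s A h c))))"
proof -
  \<comment> \<open>A power of a logarithm is eventually below its argument; this fixes the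
    threshold for the leading constant.\<close>
  have "eventually (\<lambda>\<omega>::real. 2 ^ 32 * (320 + 32 * ln \<omega>) ^ 3 \<le> \<omega>) at_top" by real_asymp
  then obtain \<omega>\<^sub>1 :: real where \<omega>\<^sub>1: "\<And>\<omega>. \<omega> \<ge> \<omega>\<^sub>1 \<Longrightarrow> 2 ^ 32 * (320 + 32 * ln \<omega>) ^ 3 \<le> \<omega>"
    by (auto simp: eventually_at_top_linorder)
  show ?thesis
  proof (rule exI[of _ "1 / 8"], rule exI[of _ "max 1 \<omega>\<^sub>1"], rule exI[of _ sketch_prog], rule exI[of _ 15],
      intro conjI allI impI)
    fix \<omega> :: real assume "\<omega> \<ge> max 1 \<omega>\<^sub>1"
    hence \<omega>: "\<omega> \<ge> 1" "2 ^ 32 * (320 + 32 * ln \<omega>) ^ 3 \<le> \<omega>" using \<omega>\<^sub>1 by auto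
    \<comment> \<open>Both distortion constants are multiples of \<open>T\<close>, which is
      determined by \<open>\<omega>\<close> before \<open>n\<close>, \<open>d\<close> and
      \<open>A\<close> are introduced.\<close>
    define T where "T = 320 + 32 * ln \<omega>"
    have T: "T > 0" using \<omega>(1) by (simp add: T_def add_pos_nonneg)
    show "\<exists>(c\<^sub>1::real) (c\<^sub>2::real). c\<^sub>1 > 0 \<and> c\<^sub>2 > 0 \<and>
      (\<forall>(n::nat) (d::nat) (A::real mat).
        d \<ge> 2 \<and> A \<in> carrier_mat n d \<and> full_column_rank A \<longrightarrow>
        (let s = sketch_size \<omega> d; M = sparse_cauchy_space s n in
          measure M {(h, c) \<in> space M. \<forall>x \<in> carrier_vec d.
              1 / (c\<^sub>1 * real d ^ 2 * ln (real d) ^ 2) * l1_norm (A *\<^sub>v x)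
                \<le> l1_norm (sparse_cauchy s n h c *\<^sub>v (A *\<^sub>v x)) \<and>
              l1_norm (sparse_cauchy s n h c *\<^sub>v (A *\<^sub>v x))
                \<le> c\<^sub>2 * real d * ln (real d) * l1_norm (A *\<^sub>v x)} \<ge> 1 / 8 \<and>
          (\<forall>(h, c) \<in> space M. computes_sketch_within sketch_prog (15 * nnz A) s A h c)))"
    proof (rule exI[of _ "131072 * T"], rule exI[of _ "2 * T"], intro conjI allI impI)
      fix n d :: nat and A :: "real mat"
      assume *: "d \<ge> 2 \<and> A \<in> carrier_mat n d \<and> full_column_rank A"
      define s where "s = sketch_size \<omega> d"
      have "computes_sketch_within sketch_prog (15 * nnz A) s A h c" if "(h, c) \<in> space (sparse_cauchy_space s n)" for h c
        using that * nnz_pos[of A n d]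
        by (intro sketch_prog_correct[of A n d]) (auto simp: space_sparse_cauchy_space space_hash_PiM_less)
      moreover have "measure (sparse_cauchy_space s n) {(h, c) \<in> space (sparse_cauchy_space s n).
          embeds s n d A (1 / (131072 * T * real d ^ 2 * ln (real d) ^ 2)) (2 * T * real d * ln (real d)) h c} \<ge> 1 / 8"
        unfolding s_def T_def using * \<omega> by (intro sketch_embeds_probability) auto
      ultimately show "let s = sketch_size \<omega> d; M = sparse_cauchy_space s n in
          measure M {(h, c) \<in> space M. \<forall>x \<in> carrier_vec d.
              1 / (131072 * T * real d ^ 2 * ln (real d) ^ 2) * l1_norm (A *\<^sub>v x)
                \<le> l1_norm (sparse_cauchy s n h c *\<^sub>v (A *\<^sub>v x)) \<and>
              l1_norm (sparse_cauchy s n h c *\<^sub>v (A *\<^sub>v x))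
                \<le> 2 * T * real d * ln (real d) * l1_norm (A *\<^sub>v x)} \<ge> 1 / 8 \<and>
          (\<forall>(h, c) \<in> space M. computes_sketch_within sketch_prog (15 * nnz A) s A h c)"
        unfolding Let_def s_def[symmetric] embeds_def by blast
    qed (use T in auto)
  qed auto
qed

end
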